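(* Suppose that Artin's primitive root conjecture holds or that the Elliott–Halberstam conjecture holds. Let $(N,B,L)$ be a Hadamard triple in $\mathbb{R}$ with $0\in B\cap L$, and let $(\mu_{N,B},\Lambda)$ be the canonical spectral pair generated by $(N,B,L)$, where $\mu_{N,B}$ is singular continuous. Then there are infinitely many spectral eigenvalues of $(\mu_{N,B},\Lambda)$.
   Context: $\#A$ denotes the cardinality of a set $A$. Spectral pairs: for a Borel probability measure $\mu$ on $\mathbb{R}$ and a countable set $\Lambda\subset\mathbb{R}$, $(\mu,\Lambda)$ is a spectral pair (and $\Lambda$ is a spectrum of $\mu$) if $\{e_\lambda(x)=e^{2\pi \mathrm{i}\lambda x}:\lambda\in\Lambda\}$ is an orthonormal basis of $L^2(\mu)$. A real number $t$ is a spectral eigenvalue of the spectral pair $(\mu,\Lambda)$ if $(\mu,t\Lambda)$ is also a spectral pair. Hadamard triple: let $N\ge 2$ be an integer and $B,L\subset\mathbb{Z}$ finite sets with $\#B=\#L\ge 2$. $(N,B,L)$ is a Hadamard triple in $\mathbb{R}$ if the matrix $\left(\frac{1}{\sqrt{\#B}}e^{2\pi \mathrm{i} b\ell/N}\right)_{b\in B,\ell\in L}$ is unitary. Self-similar measure: $\mu_{N,B}$ is the unique Borel probability measure $\mu$ on $\mathbb{R}$ satisfying $\mu=\frac{1}{\#B}\sum_{b\in B}\mu\circ\tau_b^{-1}$, where $\tau_b(x)=(x+b)/N$. Canonical spectral pair: let $(N,B,L)$ be a Hadamard triple with $0\in B\cap L$. Let $m_B(x)=\frac{1}{\#B}\sum_{b\in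 B}e^{2\pi \mathrm{i}bx}$ and $\tau_\ell(x)=(x+\ell)/N$ for $\ell\in L$. A finite set $C=\{x_1,\dots,x_k\}\subset\mathbb{R}$ is a cycle if there are $\ell_1,\dots,\ell_k\in L$ with $\tau_{\ell_j}(x_j)=x_{j+1}$ for $1\le j\le k-1$ and $\tau_{\ell_k}(x_k)=x_1$; it is an $m_B$-cycle if in addition $|m_B(x_j)|=1$ for all $1\le j\le k$. Let $\Lambda$ be the smallest set that contains $-C$ for all $m_B$-cycles $C$ and satisfies $N\Lambda+L\subset\Lambda$. It is known (Dutkay–Jorgensen) that $\Lambda$ is a spectrum of $\mu_{N,B}$; the pair $(\mu_{N,B},\Lambda)$ is called the canonical spectral pair generated by $(N,B,L)$. Artin's primitive root conjecture: for every integer $a\ge 2$ that is not a square number, there are infinitely many primes $p$ such that $\mathrm{Ord}_a(p)=p-1$. Here, for a prime $p\nmid a$, $\mathrm{Ord}_a(p)$ is the smallest positive integer $n$ with $a^n\equiv 1\pmod p$. Elliott–Halberstam conjecture: for every $0<\theta<1$ and $A>0$ there exists a constant $C>0$ such that $$\sum_{1\le q\le x^\theta}\max_{y\le x}\max_{\gcd(a,q)=1}\left|\pi(y;q,a)-\frac{\pi(y)}{\varphi(q)}\right|\le\frac{Cx}{(\log x)^A}\quad\text{for all }x>2,$$ where $\pi(y)$ is the number of primes $\le y$, $\pi(y;q,a)$ is the number of primes $p\le y$ with $p\equiv a\pmod q$ (for $a\in\mathbb{Z}$ with $\gcd(a,q)=1$), and $\varphi$ is Euler's totient function. *)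

theory Defs
  imports "HOL-Probability.Probability" "HOL-Number_Theory.Number_Theory"
begin

section \<open>Spectral pairs\<close>

definition e_fun :: "real \<Rightarrow> real \<Rightarrow> complex" where
  "e_fun t x = exp (2 * of_real pi * \<i> * of_real (t * x))"

text \<open>
  The library has no complex Hilbert space \<open>L\<^sup>2(M)\<close>; it is represented by measurable
  square-integrable functions, not quotiented by equality almost everywhere.
\<close>

definition L2_space :: "'a measure \<Rightarrow> ('a \<Rightarrow> complex) set" where
  "L2_space M = {f \<in> borel_measurable M. integrable M (\<lambda>x. (cmod (f x))\<^sup>2)}"

definition L2_inner :: "'a measure \<Rightarrow> ('a \<Rightarrow> complex) \<Rightarrow> ('a \<Rightarrow> complex) \<Rightarrow> complex" where
  "L2_inner M f g = (\<integral>x. f x * cnj (g x) \<partial>M)"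

definition L2_norm :: "'a measure \<Rightarrow> ('a \<Rightarrow> complex) \<Rightarrow> real" where
  "L2_norm M f = sqrt (\<integral>x. (cmod (f x))\<^sup>2 \<partial>M)"

text \<open>An orthonormal basis is an orthonormal family whose complex linear span is dense.\<close>

definition L2_orthonormal_basis :: "'a measure \<Rightarrow> 'i set \<Rightarrow> ('i \<Rightarrow> 'a \<Rightarrow> complex) \<Rightarrow> bool" where
  "L2_orthonormal_basis M I \<phi> \<longleftrightarrow>
     (\<forall>i\<in>I. \<phi> i \<in> L2_space M) \<and>
     (\<forall>i\<in>I. \<forall>j\<in>I. L2_inner M (\<phi> i) (\<phi> j) = (if i = j then 1 else 0)) \<and>
     (\<forall>f\<in>L2_space M. \<forall>\<epsilon>>0. \<exists>F c. finite F \<and> F \<subseteq> I \<and>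
        L2_norm M (\<lambda>x. f x - (\<Sum>i\<in>F. c i * \<phi> i x)) < \<epsilon>)"

definition borel_prob_measure :: "real measure \<Rightarrow> bool" where
  "borel_prob_measure \<mu> \<longleftrightarrow> prob_space \<mu> \<and> sets \<mu> = sets borel"

definition spectral_pair :: "real measure \<Rightarrow> real set \<Rightarrow> bool" where
  "spectral_pair \<mu> \<Lambda> \<longleftrightarrow>
     borel_prob_measure \<mu> \<and> countable \<Lambda> \<and> L2_orthonormal_basis \<mu> \<Lambda> e_fun"

definition spectral_eigenvalue :: "real measure \<Rightarrow> real set \<Rightarrow> real \<Rightarrow> bool" where
  "spectral_eigenvalue \<mu> \<Lambda> t \<longleftrightarrow>
     spectral_pair \<mu> \<Lambda> \<and> spectral_pair \<mu> ((\<lambda>x. t * x) ` \<Lambda>)"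

section \<open>Hadamard triples and self-similar measures\<close>

text \<open>A matrix indexed by finite sets \<open>I\<close> (rows) and \<open>J\<close> (columns) is a function; the two
  conditions are \<open>U U\<^sup>* = 1\<close> and \<open>U\<^sup>* U = 1\<close>.\<close>

definition unitary_on :: "'i set \<Rightarrow> 'j set \<Rightarrow> ('i \<Rightarrow> 'j \<Rightarrow> complex) \<Rightarrow> bool" where
  "unitary_on I J U \<longleftrightarrow>
     (\<forall>i\<in>I. \<forall>i'\<in>I. (\<Sum>j\<in>J. U i j * cnj (U i' j)) = (if i = i' then 1 else 0)) \<and>
     (\<forall>j\<in>J. \<forall>j'\<in>J. (\<Sum>i\<in>I. cnj (U i j) * U i j') = (if j = j' then 1 else 0))"

definition hadamard_triple :: "nat \<Rightarrow> int set \<Rightarrow> int set \<Rightarrow> bool" where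
  "hadamard_triple N B L \<longleftrightarrow>
     N \<ge> 2 \<and> finite B \<and> finite L \<and> card B = card L \<and> card B \<ge> 2 \<and>
     unitary_on B L (\<lambda>b l. of_real (1 / sqrt (real (card B))) *
       exp (2 * of_real pi * \<i> * of_int b * of_int l / of_nat N))"

definition tau :: "nat \<Rightarrow> int \<Rightarrow> real \<Rightarrow> real" where
  "tau N b x = (x + of_int b) / real N"

text \<open>Since \<open>\<mu>\<^sub>N\<^sub>,\<^sub>B\<close> is the unique Borel probability measure satisfying the invariance equation,
  it is specified by a predicate rather than by a description operator.\<close>

definition is_self_similar_measure :: "nat \<Rightarrow> int set \<Rightarrow> real measure \<Rightarrow> bool" where
  "is_self_similar_measure N B \<mu> \<longleftrightarrow>
     borel_prob_measure \<mu> \<and>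
     (\<forall>A\<in>sets borel. measure \<mu> A = 1 / real (card B) * (\<Sum>b\<in>B. measure \<mu> (tau N b -` A)))"

definition singular_continuous :: "real measure \<Rightarrow> bool" where
  "singular_continuous \<mu> \<longleftrightarrow>
     (\<forall>x. measure \<mu> {x} = 0) \<and>
     (\<exists>S\<in>sets borel. emeasure lborel S = 0 \<and> emeasure \<mu> (- S) = 0)"

section \<open>The canonical spectral pair\<close>

definition m_fun :: "int set \<Rightarrow> real \<Rightarrow> complex" where
  "m_fun B x = 1 / of_nat (card B) * (\<Sum>b\<in>B. exp (2 * of_real pi * \<i> * of_int b * of_real x))"

text \<open>The points \<open>x 1, \<dots>, x k\<close> need not be distinct. A closed walk with repetitions is a union of
  closed walks without, so this does not change the union of all \<open>m\<^sub>B\<close>-cycles.\<close>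

definition is_cycle :: "nat \<Rightarrow> int set \<Rightarrow> real set \<Rightarrow> bool" where
  "is_cycle N L C \<longleftrightarrow>
     (\<exists>k\<ge>1. \<exists>(x :: nat \<Rightarrow> real) (l :: nat \<Rightarrow> int).
        C = x ` {1..k} \<and> (\<forall>j\<in>{1..k}. l j \<in> L) \<and>
        (\<forall>j\<in>{1..<k}. tau N (l j) (x j) = x (j + 1)) \<and>
        tau N (l k) (x k) = x 1)"

definition is_m_cycle :: "nat \<Rightarrow> int set \<Rightarrow> int set \<Rightarrow> real set \<Rightarrow> bool" where
  "is_m_cycle N B L C \<longleftrightarrow> is_cycle N L C \<and> (\<forall>x\<in>C. cmod (m_fun B x) = 1)"

inductive_set canonical_spectrum :: "nat \<Rightarrow> int set \<Rightarrow> int set \<Rightarrow> real set"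
  for N :: nat and B L :: "int set" where
  cycle: "is_m_cycle N B L C \<Longrightarrow> x \<in> C \<Longrightarrow> - x \<in> canonical_spectrum N B L"
| step: "y \<in> canonical_spectrum N B L \<Longrightarrow> l \<in> L \<Longrightarrow>
    real N * y + of_int l \<in> canonical_spectrum N B L"

section \<open>The two number-theoretic conjectures\<close>

definition artin_conjecture :: bool where
  "artin_conjecture \<longleftrightarrow>
     (\<forall>a::nat. a \<ge> 2 \<and> (\<nexists>b. a = b\<^sup>2) \<longrightarrow>
        infinite {p. prime p \<and> \<not> p dvd a \<and> ord p a = p - 1})"

definition prime_count :: "real \<Rightarrow> nat" where
  "prime_count y = card {p::nat. prime p \<and> real p \<le> y}"

definition prime_count_mod :: "real \<Rightarrow> nat \<Rightarrow> int \<Rightarrow> nat" where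
  "prime_count_mod y q a = card {p::nat. prime p \<and> real p \<le> y \<and> [int p = a] (mod int q)}"

definition EH_error :: "nat \<Rightarrow> real \<Rightarrow> int \<Rightarrow> real" where
  "EH_error q y a = \<bar>real (prime_count_mod y q a) - real (prime_count y) / real (totient q)\<bar>"

definition EH_max_error :: "nat \<Rightarrow> real \<Rightarrow> real" where
  "EH_max_error q x = (MAX y\<in>{..x}. MAX a\<in>{a. coprime a (int q)}. EH_error q y a)"

text \<open>\<^const>\<open>Max\<close> is meaningful only for finite nonempty sets. Both index sets above are infinite,
  but the sets of values are finite:\<close>

lemma prime_count_le: "y \<le> x \<Longrightarrow> prime_count y \<le> prime_count x"
  and prime_count_mod_le: "prime_count_mod y q a \<le> prime_count y"
proof -
  have fin: "finite {p::nat. prime p \<and> real p \<le> z}" for z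
    by (rule finite_subset[of _ "{..nat \<lfloor>z\<rfloor>}"]) (auto simp: le_nat_floor)
  show "y \<le> x \<Longrightarrow> prime_count y \<le> prime_count x"
    unfolding prime_count_def by (rule card_mono[OF fin]) auto
  show "prime_count_mod y q a \<le> prime_count y"
    unfolding prime_count_def prime_count_mod_def by (rule card_mono[OF fin]) auto
qed

lemma EH_error_finite:
  "finite ((\<lambda>(y, a). EH_error q y a) ` ({..x} \<times> A))"
proof (rule finite_subset)
  show "(\<lambda>(y, a). EH_error q y a) ` ({..x} \<times> A) \<subseteq>
    (\<lambda>(m, n). \<bar>real m - real n / real (totient q)\<bar>) ` ({..prime_count x} \<times> {..prime_count x})"
  proof clarify
    fix y a assume "y \<le> x"
    then have "prime_count y \<le> prime_count x" "prime_count_mod y q a \<le> prime_count x"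
      using prime_count_le[of y x] prime_count_mod_le[of y q a] by auto
    then show "EH_error q y a \<in> (\<lambda>(m, n). \<bar>real m - real n / real (totient q)\<bar>) `
        ({..prime_count x} \<times> {..prime_count x})"
      unfolding EH_error_def
      by (intro image_eqI[where x = "(prime_count_mod y q a, prime_count y)"]) auto
  qed
qed auto

lemma EH_inner_finite: "finite (EH_error q y ` A)"
  by (rule finite_subset[OF _ EH_error_finite[of q y A]]) force

lemma EH_outer_finite:
  "finite ((\<lambda>y. MAX a\<in>{a. coprime a (int q)}. EH_error q y a) ` {..x})"
proof (rule finite_subset[OF _ EH_error_finite[of q x "{a. coprime a (int q)}"]], clarify)
  fix y assume "y \<le> x"
  have "(1::int) \<in> {a. coprime a (int q)}" by simp
  then have "EH_error q y ` {a. coprime a (int q)} \<noteq> {}" by blast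
  from Max_in[OF EH_inner_finite this]
  obtain a where "coprime a (int q)"
    "(MAX a\<in>{a. coprime a (int q)}. EH_error q y a) = EH_error q y a" by auto
  with \<open>y \<le> x\<close> show "(MAX a\<in>{a. coprime a (int q)}. EH_error q y a)
      \<in> (\<lambda>(y, a). EH_error q y a) ` ({..x} \<times> {a. coprime a (int q)})"
    by (intro image_eqI[where x = "(y, a)"]) auto
qed

definition elliott_halberstam_conjecture :: bool where
  "elliott_halberstam_conjecture \<longleftrightarrow>
     (\<forall>\<theta> A :: real. 0 < \<theta> \<and> \<theta> < 1 \<and> A > 0 \<longrightarrow>
        (\<exists>C>0. \<forall>x>2.
           (\<Sum>q | 1 \<le> q \<and> real q \<le> x powr \<theta>. EH_max_error q x) \<le> C * x / (ln x) powr A))"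

end

theory Submission
  imports Defs "HOL-Complex_Analysis.Complex_Analysis" "HOL-Real_Asymp.Real_Asymp"
begin

text \<open>
  The eigenvalues are primes \<open>p\<close> for which \<open>N\<close> has large multiplicative order. If \<open>p\<close> does not divide \<open>N\<close>, then
  Galois conjugation turns the vanishing sums of \<open>N\<close>-th roots of unity for \<open>L\<close> into those for \<open>p L\<close>, so
  \<open>(N, B, p L)\<close> is again a Hadamard triple and its canonical spectrum is a spectrum of the same measure.
  It equals \<open>p \<Lambda>\<close> unless \<open>p L\<close> has an \<open>m\<^sub>B\<close>-cycle that is not \<open>p\<close> times an \<open>m\<^sub>B\<close>-cycle of \<open>L\<close>. Scaled to integers,
  such a cycle meets a full coset of the group generated by \<open>N\<close> modulo \<open>p\<close>, but its points lie near a Cantor set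
  of dimension \<open>s = log\<^sub>N #L\<close>, so that the order of \<open>N\<close> modulo \<open>p\<close> is \<open>O(p\<^sup>s)\<close>. Singularity of the measure
  forces \<open>#L < N\<close>, that is \<open>s < 1\<close>, and hence infinitely many primes with order above \<open>K p\<^sup>s\<close> suffice.

  Under Artin's conjecture one writes \<open>N = M\<^sup>m\<close> with \<open>M\<close> not a square. Under the Elliott--Halberstam conjecture,
  summing \<open>ln (p - 1) = \<Sum> \<Lambda>(m)\<close> over \<open>m\<close> dividing \<open>p - 1\<close> shows that the \<open>m \<le> x\<^sup>\<theta>\<close> account only for
  about the fraction \<open>\<theta>\<close>; so many \<open>p \<le> x\<close> have a prime factor \<open>q > x\<^sup>\<theta>\<close> of \<open>p - 1\<close>, and \<open>q\<close> divides the order of \<open>N\<close>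
  with few exceptions.

  That canonical spectra are spectra (Dutkay--Jorgensen) is seen from the Parseval function
  \<open>Q(t) = \<Sum> |F(t + \<lambda>)|\<^sup>2\<close>, \<open>F\<close> the Fourier transform, which is entire, at most 1, and an average of its values at the points \<open>\<tau>\<^sub>l t\<close> with
  weights \<open>|m\<^sub>B(\<tau>\<^sub>l t)|\<^sup>2\<close>. If its minimum on a large interval were below 1, the finite set of minimizers would be invariant
  and thus contain an \<open>m\<^sub>B\<close>-cycle \<open>C\<close>; but \<open>Q\<close> is 1 on \<open>C\<close>, as \<open>- C\<close> lies in the spectrum.
\<close>

text \<open>Singularity of \<open>\<mu>\<close> enters only through \<open>card L < N\<close>, that
  is s < 1. As s can be arbitrarily close to 1, no single bound \<open>ord p N > p^c\<close> with c
  < 1 serves all triples; hence the strength of the conjectures. Scaling is one-sided: since 0 lies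
  in B, |m_B(x)| = 1 means that b x is an integer for every b in B. This survives multiplication by
  p; only division by p can fail. After division, a failing cycle has a point a / (b p) with a prime
  to p, hence invertible modulo p, which is why its orbit under multiplication by N has the full
  length \<open>ord p N\<close>. Cutting the Cantor set at the level k with N^k <= p < N^(k+1)
  leaves at most (card L)^k <= p^s intervals, each holding boundedly many of the scaled points. In
  the Parseval argument the minimizers are finitely many because an entire function constant on an
  infinite bounded set is constant, which Q(0) = 1 excludes.\<close>

section \<open>Exponentials and the function m_B\<close>

lemma e_fun_commute: "e_fun t x = e_fun x t"
  by (simp add: e_fun_def mult.commute)

lemma e_fun_add: "e_fun (s + t) x = e_fun s x * e_fun t x"
  by (simp add: e_fun_def algebra_simps exp_add)

lemma e_fun_minus: "e_fun (- t) x = cnj (e_fun t x)"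
  by (simp add: e_fun_def exp_cnj)

lemma e_fun_0 [simp]: "e_fun 0 x = 1"
  by (simp add: e_fun_def)

lemma e_fun_0_right [simp]: "e_fun t 0 = 1"
  by (simp add: e_fun_def)

lemma cmod_e_fun [simp]: "cmod (e_fun t x) = 1"
  by (simp add: e_fun_def norm_exp_eq_Re)

lemma e_fun_int: "t * x \<in> \<int> \<Longrightarrow> e_fun t x = 1"
proof -
  assume "t * x \<in> \<int>"
  then obtain k where "t * x = of_int k" by (elim Ints_cases)
  then show ?thesis
    using exp_two_pi_i[THEN arg_cong, of "\<lambda>w. w powi k"]
    unfolding e_fun_def by (simp add: exp_power_int mult_ac)
qed

lemma e_fun_eq_1_iff: "e_fun t x = 1 \<longleftrightarrow> t * x \<in> \<int>"
proof
  assume "e_fun t x = 1"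
  then obtain n where "2 * pi * (t * x) = of_int (2 * n) * pi"
    unfolding e_fun_def exp_eq_1 by (auto simp: mult_ac)
  then have "t * x = of_int n" by simp
  then show "t * x \<in> \<int>" by simp
qed (rule e_fun_int)

lemma measurable_e_fun [measurable]: "e_fun t \<in> borel_measurable borel"
  unfolding e_fun_def[abs_def]
  by (intro borel_measurable_continuous_onI continuous_intros)

lemma m_fun_altdef: "m_fun B x = (\<Sum>b\<in>B. e_fun (of_int b) x) / of_nat (card B)"
  by (simp add: m_fun_def e_fun_def mult_ac)

lemma m_fun_periodic:
  assumes "\<And>b. b \<in> B \<Longrightarrow> of_int b * y \<in> \<int>"
  shows "m_fun B (x + y) = m_fun B x"
proof -
  have "e_fun (of_int b) (x + y) = e_fun (of_int b) x" if "b \<in> B" for b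
    using e_fun_add[of x y "of_int b"] e_fun_int[OF assms[OF that], unfolded e_fun_commute[of _ y]]
    by (simp add: e_fun_commute[of "of_int b"])
  then show ?thesis by (simp add: m_fun_altdef)
qed

text \<open>Turns the analytic condition on a cycle into integrality of \<open>b * x\<close>, which
  is stable under y \<mapsto> N y + l, makes points of the spectrum periods of m_B, and can be
  followed under scaling by p.\<close>

lemma cmod_m_fun_eq_1_iff:
  assumes "finite B" "0 \<in> B"
  shows "cmod (m_fun B x) = 1 \<longleftrightarrow> (\<forall>b\<in>B. of_int b * x \<in> \<int>)"
proof
  assume *: "\<forall>b\<in>B. of_int b * x \<in> \<int>"
  then have "m_fun B (0 + x) = m_fun B 0" by (intro m_fun_periodic) auto
  also have "m_fun B 0 = 1"
  proof -
    have "card B \<noteq> 0" using assms by auto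
    then show ?thesis by (simp add: m_fun_altdef)
  qed
  finally show "cmod (m_fun B x) = 1" by simp
next
  assume *: "cmod (m_fun B x) = 1"
  have n: "card B > 0" using assms by (auto simp: card_gt_0_iff)
  let ?S = "\<Sum>b\<in>B. e_fun (of_int b) x"
  have S: "cmod ?S = card B" using * n by (simp add: m_fun_altdef norm_divide)
  \<comment> \<open>a sum of \<open>n\<close> unit vectors of norm \<open>n\<close>: all of them equal \<open>S / n\<close>, and the one for \<open>b = 0\<close> is \<open>1\<close>\<close>
  define u where "u = ?S / of_nat (card B)"
  have u: "cmod u = 1" using S n by (simp add: u_def norm_divide)
  have ucnj: "u * cnj u = 1" using u by (simp add: complex_norm_square[symmetric])
  have le: "Re (e_fun (of_int b) x * cnj u) \<le> 1" for b
    using complex_Re_le_cmod[of "e_fun (of_int b) x * cnj u"] u by (simp add: norm_mult)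
  have "(\<Sum>b\<in>B. e_fun (of_int b) x * cnj u) = of_nat (card B)"
  proof -
    have "?S = of_nat (card B) * u" using n by (simp add: u_def)
    then show ?thesis by (simp add: sum_distrib_right[symmetric] mult.assoc ucnj)
  qed
  from arg_cong[OF this, of Re] have "(\<Sum>b\<in>B. Re (e_fun (of_int b) x * cnj u)) = card B"
    by (simp only: Re_sum complex_Re_of_nat)
  then have "(\<Sum>b\<in>B. 1 - Re (e_fun (of_int b) x * cnj u)) = 0"
    by (simp add: sum_subtractf)
  then have "\<forall>b\<in>B. 1 - Re (e_fun (of_int b) x * cnj u) = 0"
    using le by (subst (asm) sum_nonneg_eq_0_iff[OF assms(1)]) auto
  then have *: "e_fun (of_int b) x * cnj u = 1" if "b \<in> B" for b
  proof -
    have "Re (e_fun (of_int b) x * cnj u) = 1" using \<open>\<forall>b\<in>B. _\<close> that by auto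
    moreover have "cmod (e_fun (of_int b) x * cnj u) = 1" using u by (simp add: norm_mult)
    ultimately show ?thesis
      using cmod_power2[of "e_fun (of_int b) x * cnj u"] by (intro complex_eqI) auto
  qed
  have "cnj u = 1" using *[OF assms(2)] by simp
  then show "\<forall>b\<in>B. of_int b * x \<in> \<int>" using * by (simp add: e_fun_eq_1_iff)
qed

section \<open>Fourier transform of a measure with bounded support\<close>

text \<open>The argument is complex, although spectra only need real ones, so that the identity
  theorem can be applied to the Parseval function.\<close>

definition ftrans :: "real measure \<Rightarrow> complex \<Rightarrow> complex" where
  "ftrans M z = (\<integral>x. exp (2 * of_real pi * \<i> * z * of_real x) \<partial>M)"

lemma ftrans_of_real: "ftrans M (of_real t) = (\<integral>x. e_fun t x \<partial>M)"
  by (simp add: ftrans_def e_fun_def mult_ac)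

lemma L2_inner_e_fun: "L2_inner M (e_fun s) (e_fun t) = ftrans M (of_real (s - t))"
  unfolding ftrans_of_real L2_inner_def
  by (simp add: e_fun_minus[symmetric] e_fun_add[symmetric])

lemma cnj_ftrans: "cnj (ftrans M z) = ftrans M (- cnj z)"
proof -
  have "cnj (ftrans M z) = (\<integral>x. cnj (exp (2 * of_real pi * \<i> * z * of_real x)) \<partial>M)"
    by (simp add: ftrans_def)
  also have "\<dots> = ftrans M (- cnj z)"
    unfolding ftrans_def by (intro Bochner_Integration.integral_cong) (simp_all add: exp_cnj del: Bochner_Integration.integral_cnj)
  finally show ?thesis .
qed

text \<open>The n-th term of the exponential series is bounded by (2 pi R |z|)^n / n!, so
  integration term by term exhibits the transform as an everywhere convergent power series.\<close>

lemma holomorphic_ftrans: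
  assumes "prob_space M" "sets M = sets borel" "AE x in M. \<bar>x\<bar> \<le> R"
  shows "ftrans M holomorphic_on UNIV"
proof -
  interpret prob_space M by fact
  note [measurable_cong] = assms(2)
  define a where "a n = (\<integral>x. (2 * of_real pi * \<i> * of_real x) ^ n / fact n \<partial>M)" for n
  have R: "R \<ge> 0" 
  proof (rule ccontr)
    assume "\<not> R \<ge> 0"
    then have "AE x in M. False"
      using assms(3) by (rule_tac eventually_mono[OF assms(3)]) auto
    then show False by simp
  qed
  have bound: "AE x in M. norm (((2 * of_real pi * \<i> * of_real x) ^ n / fact n) * z ^ n) \<le> (2 * pi * R * cmod z) ^ n / fact n"
    for n z
    using assms(3)
  proof eventually_elim
    case (elim x)
    have "norm (((2 * of_real pi * \<i> * of_real x) ^ n / fact n) * z ^ n) = (2 * pi * \<bar>x\<bar> * cmod z) ^ n / fact n"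
      by (simp add: norm_mult norm_divide norm_power power_mult_distrib)
    also have "\<dots> \<le> (2 * pi * R * cmod z) ^ n / fact n"
      using elim by (intro divide_right_mono power_mono mult_right_mono mult_left_mono) auto
    finally show ?case .
  qed
  have int: "integrable M (\<lambda>x. ((2 * of_real pi * \<i> * of_real x) ^ n / fact n) * z ^ n)" for n z
    by (rule integrable_const_bound[OF bound]) measurable
  have "(\<lambda>n. a n * z ^ n) sums ftrans M z" for z
  proof -
    have "(\<lambda>n. \<integral>x. ((2 * of_real pi * \<i> * of_real x) ^ n / fact n) * z ^ n \<partial>M) sums
        (\<integral>x. (\<Sum>n. ((2 * of_real pi * \<i> * of_real x) ^ n / fact n) * z ^ n) \<partial>M)"
    proof (rule sums_integral[OF int])
      have "AE x in M. \<forall>n. norm (((2 * of_real pi * \<i> * of_real x) ^ n / fact n) * z ^ n) \<le> (2 * pi * R * cmod z) ^ n / fact n"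
        using bound by (simp add: AE_all_countable)
      then show "AE x in M. summable (\<lambda>n. norm (((2 * of_real pi * \<i> * of_real x) ^ n / fact n) * z ^ n))"
      proof eventually_elim
        case (elim x)
        show ?case
          by (rule summable_comparison_test'[OF summable_exp_generic[of "2 * pi * R * cmod z"], of 0])
             (use elim in \<open>auto simp: divide_inverse mult_ac\<close>)
      qed
      show "summable (\<lambda>n. \<integral>x. norm (((2 * of_real pi * \<i> * of_real x) ^ n / fact n) * z ^ n) \<partial>M)"
      proof (rule summable_comparison_test'[OF summable_exp_generic[of "2 * pi * R * cmod z"], of 0])
        fix n
        have "(\<integral>x. norm (((2 * of_real pi * \<i> * of_real x) ^ n / fact n) * z ^ n) \<partial>M) \<le> (\<integral>x. (2 * pi * R * cmod z) ^ n / fact n \<partial>M)"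
          by (intro integral_mono_AE integrable_norm int bound) auto
        then show "norm (\<integral>x. norm (((2 * of_real pi * \<i> * of_real x) ^ n / fact n) * z ^ n) \<partial>M) \<le> (2 * pi * R * cmod z) ^ n /\<^sub>R fact n"
          by (simp add: prob_space divide_inverse mult_ac)
      qed
    qed
    also have "(\<lambda>n. \<integral>x. ((2 * of_real pi * \<i> * of_real x) ^ n / fact n) * z ^ n \<partial>M) = (\<lambda>n. a n * z ^ n)"
      by (simp add: a_def)
    also have "(\<lambda>x::real. \<Sum>n. ((2 * of_real pi * \<i> * of_real x) ^ n / fact n) * z ^ n) = (\<lambda>x. exp (2 * of_real pi * \<i> * z * of_real x))"
    proof
      fix x :: real
      show "(\<Sum>n. ((2 * of_real pi * \<i> * of_real x) ^ n / fact n) * z ^ n) = exp (2 * of_real pi * \<i> * z * of_real x)"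
      using exp_converges[of "2 * of_real pi * \<i> * z * of_real x", THEN sums_unique]
      by (simp add: power_mult_distrib scaleR_conv_of_real divide_inverse mult_ac)
    qed
    finally show ?thesis by (simp add: ftrans_def)
  qed
  then have "ftrans M holomorphic_on ball 0 r" for r
    by (intro power_series_holomorphic[of 0 r a]) simp
  then have "ftrans M holomorphic_on (\<Union>r. ball 0 r)"
    by (intro holomorphic_on_UN_open) auto
  also have "(\<Union>r. ball 0 r) = (UNIV :: complex set)"
    by (auto intro: lt_ex gt_ex)
  finally show ?thesis .
qed


section \<open>Integrals and support of a self-similar measure\<close>

lemma (in prob_space) integrable_bounded_AE:
  fixes f :: "'a \<Rightarrow> complex"
  assumes [measurable]: "f \<in> borel_measurable M" and "AE x in M. cmod (f x) \<le> K"
  shows "integrable M f"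
  using assms by (intro integrable_const_bound[of _ K]) auto

lemma borel_prob_measureD:
  assumes "borel_prob_measure M"
  shows "prob_space M" "sets M = sets borel" "space M = UNIV"
  using assms sets_eq_imp_space_eq[of M borel] by (auto simp: borel_prob_measure_def)

text \<open>The measure is viewed as the image of the product of the uniform distribution on \<open>B\<close> with itself.\<close>

lemma self_similar_integral:
  fixes f :: "real \<Rightarrow> complex"
  assumes ss: "is_self_similar_measure N B M" and B: "finite B" "B \<noteq> {}"
    and f [measurable]: "f \<in> borel_measurable borel" and bound: "\<And>x. cmod (f x) \<le> K"
  shows "(\<integral>x. f x \<partial>M) = (\<Sum>b\<in>B. \<integral>x. f (tau N b x) \<partial>M) / of_nat (card B)"
proof -
  have bp: "borel_prob_measure M" using ss by (simp add: is_self_similar_measure_def)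
  interpret prob_space M by (rule borel_prob_measureD[OF bp])
  note [measurable_cong] = borel_prob_measureD(2)[OF bp]
  let ?K = "measure_pmf (pmf_of_set B)"
  interpret P: pair_prob_space ?K M ..
  have tau [measurable]: "tau N b \<in> borel_measurable borel" for b
    unfolding tau_def[abs_def] by simp
  have t [measurable]: "(\<lambda>(b, x). tau N b x) \<in> borel_measurable (?K \<Otimes>\<^sub>M M)"
  proof -
    have "(\<lambda>(b, x). tau N b x) \<in> borel_measurable (count_space UNIV \<Otimes>\<^sub>M borel)"
      by (rule measurable_pair_measure_countable1) auto
    moreover have "sets (?K \<Otimes>\<^sub>M M) = sets (count_space UNIV \<Otimes>\<^sub>M borel)"
      by (intro sets_pair_measure_cong) (auto simp: borel_prob_measureD[OF bp])
    ultimately show ?thesis by (simp cong: measurable_cong_sets)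
  qed
  have "M = distr (?K \<Otimes>\<^sub>M M) borel (\<lambda>(b, x). tau N b x)" (is "_ = ?D")
  proof (rule measure_eqI)
    show "sets M = sets ?D" using borel_prob_measureD[OF bp] by simp
    fix A assume "A \<in> sets M"
    then have A [measurable]: "A \<in> sets borel" using borel_prob_measureD[OF bp] by simp
    have "emeasure ?D A = emeasure (?K \<Otimes>\<^sub>M M) ((\<lambda>(b, x). tau N b x) -` A \<inter> space (?K \<Otimes>\<^sub>M M))"
      by (rule emeasure_distr) auto
    also have "\<dots> = (\<integral>\<^sup>+ b. emeasure M (Pair b -` ((\<lambda>(b, x). tau N b x) -` A \<inter> space (?K \<Otimes>\<^sub>M M))) \<partial>?K)"
      by (rule emeasure_pair_measure_alt) measurable
    also have "\<dots> = (\<integral>\<^sup>+ b. emeasure M (tau N b -` A) \<partial>?K)"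
      by (intro nn_integral_cong arg_cong[of _ _ "emeasure M"]) (auto simp: space_pair_measure borel_prob_measureD[OF bp])
    also have "\<dots> = (\<integral>\<^sup>+ b. ennreal (measure M (tau N b -` A)) \<partial>?K)"
      by (simp add: emeasure_eq_measure)
    also have "\<dots> = ennreal (\<integral> b. measure M (tau N b -` A) \<partial>?K)"
      by (rule nn_integral_eq_integral) (auto intro!: measure_pmf.integrable_const_bound[of _ 1])
    also have "(\<integral> b. measure M (tau N b -` A) \<partial>?K) = measure M A"
      using ss B A unfolding is_self_similar_measure_def
      by (simp add: integral_pmf_of_set)
    finally show "emeasure M A = emeasure ?D A" by (simp add: emeasure_eq_measure)
  qed
  then have "(\<integral>x. f x \<partial>M) = (\<integral>x. f x \<partial>?D)" by simp
  also have "\<dots> = (\<integral>p. f (case p of (b, x) \<Rightarrow> tau N b x) \<partial>(?K \<Otimes>\<^sub>M M))"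
    by (rule integral_distr) auto
  also have "\<dots> = (\<integral>b. (\<integral>x. f (tau N b x) \<partial>M) \<partial>?K)"
    by (subst P.integral_fst'[symmetric])
       (auto intro!: P.integrable_const_bound[of _ K] bound)
  also have "\<dots> = (\<Sum>b\<in>B. \<integral>x. f (tau N b x) \<partial>M) / of_nat (card B)"
    using B by (subst integral_measure_pmf[of B])
      (auto simp: scaleR_conv_of_real sum_distrib_left divide_inverse mult.commute)
  finally show ?thesis .
qed

text \<open>A zero of m_B at t / N is a zero of the transform at t: this is how orthogonality of
  exponentials is detected.\<close>

lemma ftrans_self_similar:
  assumes ss: "is_self_similar_measure N B M" and B: "finite B" "B \<noteq> {}" and "N > 0"
  shows "ftrans M (of_real t) = m_fun B (t / N) * ftrans M (of_real (t / N))"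
proof -
  have "e_fun t (tau N b x) = e_fun (of_int b) (t / N) * e_fun (t / N) x" for b x
    unfolding e_fun_def tau_def using assms(4) by (simp add: exp_add[symmetric] field_simps)
  then show ?thesis
    unfolding ftrans_of_real
    by (subst self_similar_integral[OF ss B, of _ 1]) (auto simp: m_fun_altdef sum_distrib_right)
qed

text \<open>If |tau_b(x)| > r then |x| > N r - \<beta>, so the tail mass at r is at most that at N r
  - \<beta>. Started at \<beta> + 1, this expansion passes \<beta> + N^k for every k, and the tail
  mass there tends to 0.\<close>

lemma self_similar_support:
  assumes ss: "is_self_similar_measure N B M" and B: "finite B" "B \<noteq> {}" and N: "N \<ge> 2"
  obtains R where "R > 0" "AE x in M. \<bar>x\<bar> \<le> R"
proof -
  have bp: "borel_prob_measure M" using ss by (simp add: is_self_similar_measure_def)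
  interpret prob_space M by (rule borel_prob_measureD[OF bp])
  note [measurable_cong] = borel_prob_measureD(2)[OF bp]
  define \<beta> where "\<beta> = real_of_int (Max (abs ` B))"
  have \<beta>: "\<bar>of_int b\<bar> \<le> \<beta>" if "b \<in> B" for b
    using that B by (auto simp: \<beta>_def simp flip: of_int_abs)
  define A where "A r = {x::real. r < \<bar>x\<bar>}" for r
  have [measurable]: "A r \<in> sets borel" for r unfolding A_def by measurable
  define g where "g r = measure M (A r)" for r
  have step: "g r \<le> g (real N * r - \<beta>)" for r
  proof -
    have "measure M (tau N b -` A r) \<le> g (real N * r - \<beta>)" if "b \<in> B" for b
      unfolding g_def
    proof (rule finite_measure_mono)
      show "tau N b -` A r \<subseteq> A (real N * r - \<beta>)"
        using \<beta>[OF that] N by (auto simp: A_def tau_def field_simps abs_if split: if_splits)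
    qed auto
    then have "(\<Sum>b\<in>B. measure M (tau N b -` A r)) \<le> card B * g (real N * r - \<beta>)"
      by (rule sum_bounded_above)
    moreover have "g r = 1 / card B * (\<Sum>b\<in>B. measure M (tau N b -` A r))"
      using ss unfolding is_self_similar_measure_def g_def by auto
    ultimately show ?thesis
      using mult_le_cancel_left_pos[of "real (card B)" "g r" "g (real N * r - \<beta>)"] B
      by (simp add: card_gt_0_iff)
  qed
  have "\<beta> \<ge> 0" using B \<beta> by fastforce
  have iter: "g (\<beta> + 1) \<le> g (\<beta> + real N ^ k)" for k
  proof (induction k)
    case (Suc k)
    have "g (\<beta> + real N ^ k) \<le> g (N * (\<beta> + real N ^ k) - \<beta>)" by (rule step)
    also have "\<dots> \<le> g (\<beta> + real N ^ Suc k)"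
      unfolding g_def
    proof (rule finite_measure_mono)
      have "2 * \<beta> \<le> real N * \<beta>" using N \<open>\<beta> \<ge> 0\<close> by (intro mult_right_mono) auto
      then show "A (N * (\<beta> + real N ^ k) - \<beta>) \<subseteq> A (\<beta> + real N ^ Suc k)"
        by (auto simp: A_def algebra_simps)
    qed auto
    finally show ?case using Suc by simp
  qed simp
  have "(\<lambda>k. g (\<beta> + real N ^ k)) \<longlonglongrightarrow> measure M (\<Inter>k. A (\<beta> + real N ^ k))"
    unfolding g_def
  proof (rule finite_Lim_measure_decseq)
    show "decseq (\<lambda>k. A (\<beta> + real N ^ k))"
      unfolding decseq_def
    proof (intro allI impI)
      fix m n :: nat assume "m \<le> n"
      then have "real N ^ m \<le> real N ^ n" using N by (intro power_increasing) auto
      then show "A (\<beta> + real N ^ n) \<subseteq> A (\<beta> + real N ^ m)" by (auto simp: A_def)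
    qed
  qed auto
  also have "(\<Inter>k. A (\<beta> + real N ^ k)) = {}"
  proof -
    have "\<exists>k. \<bar>x\<bar> \<le> \<beta> + real N ^ k" for x
    proof -
      obtain k where "\<bar>x\<bar> < real N ^ k" using real_arch_pow[of "real N" "\<bar>x\<bar>"] N by auto
      then show ?thesis using \<open>\<beta> \<ge> 0\<close> by (intro exI[of _ k]) linarith
    qed
    then have "\<exists>k. x \<notin> A (\<beta> + real N ^ k)" for x by (simp add: A_def not_less)
    then show ?thesis by blast
  qed
  finally have "g (\<beta> + 1) \<le> 0"
    by (intro LIMSEQ_le_const[of "\<lambda>k. g (\<beta> + real N ^ k)"]) (auto intro!: exI[of _ 0] iter)
  then have "emeasure M (A (\<beta> + 1)) = 0"
    by (simp add: g_def emeasure_eq_measure measure_le_0_iff)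
  then have "AE x in M. \<bar>x\<bar> \<le> \<beta> + 1"
    by (intro AE_I[of _ _ "A (\<beta> + 1)"]) (auto simp: A_def not_le[symmetric])
  then show ?thesis using that[of "\<beta> + 1"] \<open>\<beta> \<ge> 0\<close> by simp
qed

lemma m_fun_0: "finite B \<Longrightarrow> B \<noteq> {} \<Longrightarrow> m_fun B 0 = 1"
  by (simp add: m_fun_altdef)

section \<open>Hadamard triples in terms of zeros of m_B and m_L\<close>

text \<open>The entries of the two Gram matrices are values of m_L and m_B. In this form the
  symmetry between B and L is visible, and Galois conjugation can act on single entries.\<close>

lemma hadamard_triple_iff:
  "hadamard_triple N B L \<longleftrightarrow> N \<ge> 2 \<and> finite B \<and> finite L \<and> card B = card L \<and> card B \<ge> 2 \<and>
     (\<forall>b\<in>B. \<forall>b'\<in>B. b \<noteq> b' \<longrightarrow> m_fun L (of_int (b - b') / N) = 0) \<and>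
     (\<forall>l\<in>L. \<forall>l'\<in>L. l \<noteq> l' \<longrightarrow> m_fun B (of_int (l - l') / N) = 0)"
proof (cases "N \<ge> 2 \<and> finite B \<and> finite L \<and> card B = card L \<and> card B \<ge> 2")
  case True
  let ?s = "complex_of_real (1 / sqrt (real (card B)))"
  let ?U = "\<lambda>b l. ?s * exp (2 * of_real pi * \<i> * of_int b * of_int l / of_nat N)"
  have U: "?U b l = ?s * e_fun (of_int b) (of_int l / N)" "?U b l = ?s * e_fun (of_int l) (of_int b / N)" for b l
    by (simp_all add: e_fun_def mult_ac)
  have sq: "?s * ?s = 1 / of_nat (card B)"
    by (simp flip: of_real_mult add: real_sqrt_mult_self)
  have prod: "(\<Sum>k\<in>K. (?s * e_fun (of_int k) x) * cnj (?s * e_fun (of_int k) y)) = m_fun K (x - y)"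
    if "card K = card B" for K x y
  proof -
    have "(?s * e_fun (of_int k) x) * cnj (?s * e_fun (of_int k) y) = ?s * ?s * e_fun (of_int k) (x - y)" for k
      using e_fun_add[of x "- y" "of_int k"] by (simp add: e_fun_commute[of "of_int k"] e_fun_minus mult_ac)
    then show ?thesis using that unfolding sq by (simp add: m_fun_altdef sum_divide_distrib)
  qed
  have row: "(\<Sum>l\<in>L. ?U b l * cnj (?U b' l)) = m_fun L (of_int (b - b') / N)" for b b'
    unfolding U(2) using True by (subst prod) (simp_all add: diff_divide_distrib)
  have col: "(\<Sum>b\<in>B. cnj (?U b l) * ?U b l') = m_fun B (of_int (l' - l) / N)" for l l'
    unfolding U(1) mult.commute[of "cnj _"] by (subst prod) (simp_all add: diff_divide_distrib)
  have "m_fun L 0 = 1" "m_fun B 0 = 1" using True by (auto intro!: m_fun_0)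
  then show ?thesis
    using True unfolding hadamard_triple_def unitary_on_def row col by (auto simp del: of_int_diff)
qed (auto simp: hadamard_triple_def)

lemma hadamard_transpose: "hadamard_triple N B L \<longleftrightarrow> hadamard_triple N L B"
  by (auto simp: hadamard_triple_iff)

text \<open>For the second claim expand |m_B|^2 over pairs b, b'; summing over l produces m_L((b -
  b') / N), so that only the diagonal survives. The squares are thus transition probabilities of x
  \<mapsto> tau_l(x).\<close>

lemma m_fun_hadamard:
  assumes "hadamard_triple N B L"
  shows "l \<in> L \<Longrightarrow> l' \<in> L \<Longrightarrow> l \<noteq> l' \<Longrightarrow> m_fun B (of_int (l - l') / N) = 0"
    and "(\<Sum>l\<in>L. (cmod (m_fun B (tau N l x)))\<^sup>2) = 1"
proof -
  let ?n = "of_nat (card B) :: complex"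
  have H: "finite B" "finite L" "card L = card B" "?n \<noteq> 0" "L \<noteq> {}"
    using assms by (auto simp: hadamard_triple_iff)
  show "m_fun B (of_int (l - l') / N) = 0" if "l \<in> L" "l' \<in> L" "l \<noteq> l'"
    using that assms unfolding hadamard_triple_iff by blast
  have "of_real (\<Sum>l\<in>L. (cmod (m_fun B (tau N l x)))\<^sup>2) = (\<Sum>l\<in>L. m_fun B (tau N l x) * cnj (m_fun B (tau N l x)))"
    by (simp only: of_real_sum complex_norm_square)
  also have "\<dots> = (\<Sum>l\<in>L. \<Sum>b\<in>B. \<Sum>b'\<in>B. e_fun (of_int (b - b')) (tau N l x) / ?n\<^sup>2)"
    using e_fun_add[of "of_int b" "- of_int b'" for b b']
    by (simp add: m_fun_altdef sum_product e_fun_minus sum_divide_distrib power2_eq_square)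
  also have "\<dots> = (\<Sum>b\<in>B. \<Sum>b'\<in>B. \<Sum>l\<in>L. e_fun (of_int (b - b')) (tau N l x) / ?n\<^sup>2)"
    by (subst sum.swap) (intro sum.cong refl sum.swap)
  also have "\<dots> = (\<Sum>b\<in>B. \<Sum>b'\<in>B. e_fun (of_int (b - b')) (x / N) / ?n * m_fun L (of_int (b - b') / N))"
  proof (intro sum.cong refl)
    fix b b'
    have "e_fun (of_int (b - b')) (tau N l x) = e_fun (of_int (b - b')) (x / N) * e_fun (of_int l) (of_int (b - b') / N)" for l
      by (simp add: e_fun_def tau_def add_divide_distrib distrib_left exp_add mult_ac)
    then show "(\<Sum>l\<in>L. e_fun (of_int (b - b')) (tau N l x) / ?n\<^sup>2) = e_fun (of_int (b - b')) (x / N) / ?n * m_fun L (of_int (b - b') / N)"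
      by (simp add: m_fun_altdef H power2_eq_square sum_distrib_left sum_divide_distrib mult_ac)
  qed
  also have "\<dots> = (\<Sum>b\<in>B. \<Sum>b'\<in>B. if b = b' then 1 / ?n else 0)"
    using assms m_fun_0[OF H(2,5)] by (intro sum.cong refl) (auto simp: hadamard_triple_iff simp del: of_int_diff)
  also have "\<dots> = of_real 1" using H by simp
  finally show "(\<Sum>l\<in>L. (cmod (m_fun B (tau N l x)))\<^sup>2) = 1"
    unfolding of_real_eq_iff .
qed

section \<open>Cycles and the digit structure of the canonical spectrum\<close>

lemma is_cycleE:
  assumes "is_cycle N L C"
  obtains k :: nat and z :: "nat \<Rightarrow> real" and l where "k \<ge> 1" "C = z ` {1..k}" "\<And>j. j \<in> {1..k} \<Longrightarrow> l j \<in> L"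
    "\<And>j. j \<in> {1..<k} \<Longrightarrow> tau N (l j) (z j) = z (j + 1)" "tau N (l k) (z k) = z 1"
  using assms unfolding is_cycle_def by blast

lemma cycle_predecessor:
  assumes "is_cycle N L C" "x \<in> C"
  obtains y l where "y \<in> C" "l \<in> L" "tau N l y = x"
proof -
  obtain k :: nat and z l where C: "k \<ge> 1" "C = z ` {1..k}" "\<And>j. j \<in> {1..k} \<Longrightarrow> l j \<in> L"
    "\<And>j. j \<in> {1..<k} \<Longrightarrow> tau N (l j) (z j) = z (j + 1)" "tau N (l k) (z k) = z 1"
    using assms(1) by (rule is_cycleE) blast
  obtain j where j: "j \<in> {1..k}" "x = z j" using assms(2) C by auto
  show ?thesis
  proof (cases "j = 1")
    case True
    then show ?thesis using that[of "z k" "l k"] C j by auto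
  next
    case False
    then have "j - 1 \<in> {1..<k}" using j by auto
    then show ?thesis using that[of "z (j - 1)" "l (j - 1)"] C j False by auto
  qed
qed

lemma cycle_successor:
  assumes "is_cycle N L C" "x \<in> C"
  obtains l where "l \<in> L" "tau N l x \<in> C"
proof -
  obtain k :: nat and z l where C: "k \<ge> 1" "C = z ` {1..k}" "\<And>j. j \<in> {1..k} \<Longrightarrow> l j \<in> L"
    "\<And>j. j \<in> {1..<k} \<Longrightarrow> tau N (l j) (z j) = z (j + 1)" "tau N (l k) (z k) = z 1"
    using assms(1) by (rule is_cycleE) blast
  obtain j where j: "j \<in> {1..k}" "x = z j" using assms(2) C by auto
  show ?thesis
  proof (cases "j = k")
    case True
    then show ?thesis using that[of "l k"] C j by auto
  next
    case False
    then show ?thesis using that[of "l j"] C(2-4) j by auto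
  qed
qed

locale hadamard_system =
  fixes N :: nat and B L :: "int set"
  assumes hadamard: "hadamard_triple N B L" and zero_B: "0 \<in> B" and zero_L: "0 \<in> L"
begin

abbreviation \<Lambda> :: "real set" where "\<Lambda> \<equiv> canonical_spectrum N B L"

lemma N_ge_2: "N \<ge> 2" and finite_B: "finite B" and finite_L: "finite L"
  and card_B: "card B \<ge> 2" and card_L: "card L = card B"
  using hadamard by (auto simp: hadamard_triple_def)

text \<open>Multiplication by such a \<open>b\<close> embeds \<open>\<Lambda>\<close> into the
  integers. This yields countability and an integer quantity for descent.\<close>

lemma nonzero_digit: obtains b where "b \<in> B" "b \<noteq> 0"
proof -
  have "\<not> B \<subseteq> {0}" using card_B card_mono[of "{0}" B] by auto
  then show ?thesis using that by auto
qed

lemma spectrum_integral: "y \<in> \<Lambda> \<Longrightarrow> b \<in> B \<Longrightarrow> of_int b * y \<in> \<int>"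
proof (induction rule: canonical_spectrum.induct)
  case (cycle C x)
  then have "of_int b * x \<in> \<int>"
    using cmod_m_fun_eq_1_iff[OF finite_B zero_B, of x] by (auto simp: is_m_cycle_def)
  then show ?case by simp
next
  case (step y l)
  have "real_of_int b * (real N * y + of_int l) = real N * (of_int b * y) + of_int (b * l)"
    by (simp add: algebra_simps)
  also have "\<dots> \<in> \<int>" using step.IH[OF step.prems] by (intro Ints_add Ints_mult[OF Ints_of_nat] Ints_of_int)
  finally show ?case .
qed

lemma m_fun_plus_spectrum: "y \<in> \<Lambda> \<Longrightarrow> m_fun B (x + y) = m_fun B x"
  using spectrum_integral by (intro m_fun_periodic) auto

lemma m_fun_minus_spectrum: "y \<in> \<Lambda> \<Longrightarrow> m_fun B (x - y) = m_fun B x"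
  using m_fun_plus_spectrum[of y "x - y"] by simp

text \<open>The reverse of N \<Lambda> + L \<subseteq> \<Lambda>. Only generators - x with x in a
  cycle need an argument: the successor tau_l(x) stays in the cycle, and - x = N (- tau_l(x)) +
  l.\<close>

lemma spectrum_decompose:
  assumes "y \<in> \<Lambda>"
  obtains y' l where "y' \<in> \<Lambda>" "l \<in> L" "y = real N * y' + of_int l"
  using assms
proof (cases rule: canonical_spectrum.cases)
  case (cycle C x)
  then have "is_cycle N L C" by (simp add: is_m_cycle_def)
  then obtain l where l: "l \<in> L" "tau N l x \<in> C" using cycle cycle_successor by metis
  have "- x = real N * (- tau N l x) + of_int l"
    using N_ge_2 by (simp add: tau_def)
  then show ?thesis
    using that[of "- tau N l x" l] cycle l canonical_spectrum.cycle by auto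
qed (use that in auto)

text \<open>The argument is (l - l') / N plus y - y', and both y and y' are periods of m_B.\<close>

lemma m_fun_diff_eq_0:
  assumes "y \<in> \<Lambda>" "y' \<in> \<Lambda>" "l \<in> L" "l' \<in> L" "l \<noteq> l'"
  shows "m_fun B ((real N * y + of_int l - (real N * y' + of_int l')) / N) = 0"
proof -
  have "(real N * y + of_int l - (real N * y' + of_int l')) / N = of_int (l - l') / N + y - y'"
    using N_ge_2 by (simp add: field_simps)
  then show ?thesis
    using m_fun_hadamard(1)[OF hadamard assms(3-5)] assms(1,2)
    by (simp add: m_fun_plus_spectrum m_fun_minus_spectrum del: of_int_diff)
qed

lemma m_fun_at_0: "m_fun B 0 = 1"
  using zero_B by (intro m_fun_0[OF finite_B]) auto

lemma spectrum_decompose_unique: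
  assumes "y \<in> \<Lambda>" "y' \<in> \<Lambda>" "l \<in> L" "l' \<in> L" "real N * y + of_int l = real N * y' + of_int l'"
  shows "y = y'" "l = l'"
proof -
  \<comment> \<open>Different digits would make m_B vanish at 0, where its value is 1.\<close>
  show "l = l'"
    using m_fun_diff_eq_0[OF assms(1-4)] m_fun_at_0 assms(5) by auto
  then show "y = y'" using assms(5) N_ge_2 by simp
qed

lemma zero_in_spectrum: "0 \<in> \<Lambda>"
proof -
  have "is_m_cycle N B L {0}"
    unfolding is_m_cycle_def is_cycle_def using zero_L m_fun_at_0
    by (auto intro!: exI[of _ 1] exI[of _ "\<lambda>_. 0"] simp: tau_def)
  from canonical_spectrum.cycle[OF this, of 0] show ?thesis by simp
qed

lemma countable_spectrum: "countable \<Lambda>"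
proof -
  obtain b where b: "b \<in> B" "b \<noteq> 0" by (rule nonzero_digit)
  have "\<Lambda> \<subseteq> (\<lambda>k. of_int k / of_int b) ` UNIV"
  proof
    fix y assume "y \<in> \<Lambda>"
    then obtain k where "of_int b * y = of_int k" using spectrum_integral[of y b] b by (auto elim: Ints_cases)
    then have "y = of_int k / of_int b" using b by (simp add: field_simps)
    then show "y \<in> (\<lambda>k. of_int k / of_int b) ` UNIV" by blast
  qed
  then show ?thesis by (rule countable_subset) auto
qed

text \<open>Descent on the integer \<open>|b (y - y')|\<close>: either the first digits of \<open>y\<close> and \<open>y'\<close> differ and
  the corresponding factor of the Fourier transform vanishes, or \<open>N\<close> divides out.\<close>

lemma spectrum_orthogonal:
  assumes ss: "is_self_similar_measure N B \<mu>"
  assumes "y \<in> \<Lambda>" "y' \<in> \<Lambda>" "y \<noteq> y'"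
  shows "ftrans \<mu> (of_real (y - y')) = 0"
proof -
  obtain b where b: "b \<in> B" "b \<noteq> 0" by (rule nonzero_digit)
  define d where "d y y' = nat \<lfloor>\<bar>of_int b * (y - y')\<bar>\<rfloor>" for y y' :: real
  have d: "real (d y y') = \<bar>of_int b * (y - y')\<bar>" if "y \<in> \<Lambda>" "y' \<in> \<Lambda>" for y y'
  proof -
    have "of_int b * (y - y') \<in> \<int>"
      using spectrum_integral[OF that(1) b(1)] spectrum_integral[OF that(2) b(1)]
      by (simp add: right_diff_distrib)
    then have "\<bar>of_int b * (y - y')\<bar> \<in> \<int>" by simp
    then show ?thesis by (simp add: d_def of_int_floor)
  qed
  have "\<forall>y y'. y \<in> \<Lambda> \<longrightarrow> y' \<in> \<Lambda> \<longrightarrow> y \<noteq> y' \<longrightarrow> d y y' = k \<longrightarrow> ftrans \<mu> (of_real (y - y')) = 0" for k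
  proof (induction k rule: less_induct)
    case (less k)
    show ?case
    proof (intro allI impI)
      fix y y' assume y: "y \<in> \<Lambda>" "y' \<in> \<Lambda>" "y \<noteq> y'" "d y y' = k"
      obtain z l where z: "z \<in> \<Lambda>" "l \<in> L" "y = real N * z + of_int l" using spectrum_decompose[OF y(1)] .
      obtain z' l' where z': "z' \<in> \<Lambda>" "l' \<in> L" "y' = real N * z' + of_int l'" using spectrum_decompose[OF y(2)] .
      have ft: "ftrans \<mu> (of_real (y - y')) = m_fun B ((y - y') / N) * ftrans \<mu> (of_real ((y - y') / N))"
        using ftrans_self_similar[OF ss finite_B _, of "y - y'"] zero_B N_ge_2 by auto
      show "ftrans \<mu> (of_real (y - y')) = 0"
      proof (cases "l = l'")
        case False
        then show ?thesis
          using m_fun_diff_eq_0[OF z(1) z'(1) z(2) z'(2)] ft z(3) z'(3) by simp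
      next
        case True
        then have eq: "y - y' = N * (z - z')" using z z' by (simp add: algebra_simps)
        then have "z \<noteq> z'" using y by auto
        have "real (d y y') = N * real (d z z')"
          unfolding d[OF y(1,2)] d[OF z(1) z'(1)] eq by (simp add: abs_mult)
        moreover have "real (d y y') > 0" unfolding d[OF y(1,2)] using y b by simp
        moreover have "2 * real (d z z') \<le> real N * real (d z z')"
          using N_ge_2 by (intro mult_right_mono) auto
        ultimately have "real (d z z') < real (d y y')" by linarith
        then have "d z z' < k" using y by simp
        then have "ftrans \<mu> (of_real (z - z')) = 0" using less \<open>z \<noteq> z'\<close> z z' by blast
        moreover have "(y - y') / N = z - z'" using eq N_ge_2 by simp
        ultimately show ?thesis using ft by simp
      qed
    qed
  qed
  then show ?thesis using assms by blast
qed

end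

section \<open>Orthonormal exponentials in \<open>L\<^sup>2\<close> of a probability measure\<close>

lemma borel_measurable_cnj [measurable (raw)]:
  "f \<in> borel_measurable M \<Longrightarrow> (\<lambda>x. cnj (f x)) \<in> borel_measurable M"
  by (erule measurable_compose) (intro borel_measurable_continuous_onI continuous_intros)

lemma L2_integrable:
  assumes "prob_space M" "f \<in> L2_space M"
  shows "integrable M f"
proof -
  interpret prob_space M by fact
  have [measurable]: "f \<in> borel_measurable M" using assms by (simp add: L2_space_def)
  show ?thesis
  proof (rule Bochner_Integration.integrable_bound)
    show "integrable M (\<lambda>x. 1 + (cmod (f x))\<^sup>2)" using assms by (simp add: L2_space_def)
    show "AE x in M. norm (f x) \<le> norm (1 + (cmod (f x))\<^sup>2)"
    proof (intro always_eventually allI)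
      fix x
      have "0 \<le> (cmod (f x) - 1)\<^sup>2" by simp
      then have "2 * cmod (f x) \<le> 1 + (cmod (f x))\<^sup>2"
        by (simp add: power2_eq_square algebra_simps)
      then show "norm (f x) \<le> norm (1 + (cmod (f x))\<^sup>2)"
        using norm_ge_zero[of "f x"] by (simp only: real_norm_def)
    qed
  qed measurable
qed

text \<open>Bounding the \<open>e i\<close> by 1 makes every cross term integrable as soon as
  \<open>f\<close> is. The exact identity serves twice: its sign gives Bessel's inequality, and its
  value turns Q = 1 into density.\<close>

lemma L2_norm_diff_projection:
  fixes e :: "'i \<Rightarrow> 'a \<Rightarrow> complex"
  assumes "prob_space M" and f: "f \<in> L2_space M" and "finite F"
    and e: "\<And>i. i \<in> F \<Longrightarrow> e i \<in> borel_measurable M" "\<And>i x. i \<in> F \<Longrightarrow> cmod (e i x) \<le> 1"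
    and orth: "\<And>i j. i \<in> F \<Longrightarrow> j \<in> F \<Longrightarrow> L2_inner M (e i) (e j) = (if i = j then 1 else 0)"
  shows "(\<integral>x. (cmod (f x - (\<Sum>i\<in>F. L2_inner M f (e i) * e i x)))\<^sup>2 \<partial>M)
     = (\<integral>x. (cmod (f x))\<^sup>2 \<partial>M) - (\<Sum>i\<in>F. (cmod (L2_inner M f (e i)))\<^sup>2)"
proof -
  interpret prob_space M by fact
  have [measurable]: "f \<in> borel_measurable M" using assms by (simp add: L2_space_def)
  note [measurable] = e(1)
  have intf: "integrable M f" by (rule L2_integrable) fact+
  define c where "c i = L2_inner M f (e i)" for i
  have m: "(\<lambda>x. f x * cnj (e i x)) \<in> borel_measurable M" "(\<lambda>x. e i x * cnj (f x)) \<in> borel_measurable M" if "i \<in> F" for i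
    using e(1)[OF that] by measurable
  have m': "(\<lambda>x. e i x * cnj (e j x)) \<in> borel_measurable M" if "i \<in> F" "j \<in> F" for i j
    using e(1)[OF that(1)] e(1)[OF that(2)] by measurable
  have int1: "integrable M (\<lambda>x. f x * cnj (e i x))" if "i \<in> F" for i
    by (rule Bochner_Integration.integrable_bound[OF intf])
       (use that e(2)[OF that] m[OF that] in \<open>auto simp: norm_mult mult_left_le\<close>)
  have int2: "integrable M (\<lambda>x. e i x * cnj (f x))" if "i \<in> F" for i
    by (rule Bochner_Integration.integrable_bound[OF intf])
       (use that e(2)[OF that] m[OF that] in \<open>auto simp: norm_mult mult_left_le_one_le\<close>)
  have int3: "integrable M (\<lambda>x. e i x * cnj (e j x))" if "i \<in> F" "j \<in> F" for i j
    by (rule integrable_bounded_AE[of _ 1])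
       (use that e(2)[OF that(1)] e(2)[OF that(2)] m'[OF that] in \<open>auto simp: norm_mult intro!: mult_le_one\<close>)
  have int0: "integrable M (\<lambda>x. complex_of_real ((cmod (f x))\<^sup>2))" 
    using f by (simp add: L2_space_def del: of_real_power)
  have exp: "complex_of_real ((cmod (f x - (\<Sum>i\<in>F. c i * e i x)))\<^sup>2) =
      of_real ((cmod (f x))\<^sup>2) - (\<Sum>i\<in>F. cnj (c i) * (f x * cnj (e i x))) - (\<Sum>i\<in>F. c i * (e i x * cnj (f x)))
      + (\<Sum>i\<in>F. \<Sum>j\<in>F. c i * cnj (c j) * (e i x * cnj (e j x)))" for x
    unfolding complex_norm_square
    by (subst sum.swap) (simp add: algebra_simps sum_distrib_left sum_distrib_right sum_product)
  have i2: "(\<integral>x. e i x * cnj (f x) \<partial>M) = cnj (c i)" for i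
  proof -
    have "cnj (c i) = (\<integral>x. cnj (f x * cnj (e i x)) \<partial>M)"
      unfolding c_def L2_inner_def by (rule Bochner_Integration.integral_cnj[symmetric])
    then show ?thesis by (simp add: mult.commute)
  qed
  have "complex_of_real (\<integral>x. (cmod (f x - (\<Sum>i\<in>F. c i * e i x)))\<^sup>2 \<partial>M)
     = (\<integral>x. of_real ((cmod (f x))\<^sup>2) - (\<Sum>i\<in>F. cnj (c i) * (f x * cnj (e i x))) - (\<Sum>i\<in>F. c i * (e i x * cnj (f x)))
      + (\<Sum>i\<in>F. \<Sum>j\<in>F. c i * cnj (c j) * (e i x * cnj (e j x))) \<partial>M)"
    unfolding exp[symmetric] by (rule integral_complex_of_real[symmetric])
  also have "\<dots> = (\<integral>x. of_real ((cmod (f x))\<^sup>2) \<partial>M) - (\<Sum>i\<in>F. cnj (c i) * (\<integral>x. f x * cnj (e i x) \<partial>M))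
     - (\<Sum>i\<in>F. c i * (\<integral>x. e i x * cnj (f x) \<partial>M)) + (\<Sum>i\<in>F. \<Sum>j\<in>F. c i * cnj (c j) * (\<integral>x. e i x * cnj (e j x) \<partial>M))"
    using int0 int1 int2 int3 by (simp del: of_real_power)
  also have "\<dots> = (\<integral>x. of_real ((cmod (f x))\<^sup>2) \<partial>M) - (\<Sum>i\<in>F. cnj (c i) * c i)
     - (\<Sum>i\<in>F. c i * cnj (c i)) + (\<Sum>i\<in>F. \<Sum>j\<in>F. c i * cnj (c j) * (if i = j then 1 else 0))"
    using orth unfolding i2 by (simp add: c_def L2_inner_def)
  also have "\<dots> = (\<integral>x. of_real ((cmod (f x))\<^sup>2) \<partial>M) - (\<Sum>i\<in>F. c i * cnj (c i))"
    using assms(3) by (simp add: mult.commute if_distrib cong: if_cong)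
  also have "\<dots> = of_real ((\<integral>x. (cmod (f x))\<^sup>2 \<partial>M) - (\<Sum>i\<in>F. (cmod (c i))\<^sup>2))"
    by (simp only: of_real_diff of_real_sum complex_norm_square[symmetric] integral_complex_of_real)
  finally show ?thesis unfolding of_real_eq_iff c_def .
qed

lemma L2_bessel:
  fixes e :: "'i \<Rightarrow> 'a \<Rightarrow> complex"
  assumes "prob_space M" "f \<in> L2_space M" "finite F"
    and "\<And>i. i \<in> F \<Longrightarrow> e i \<in> borel_measurable M" "\<And>i x. i \<in> F \<Longrightarrow> cmod (e i x) \<le> 1"
    and "\<And>i j. i \<in> F \<Longrightarrow> j \<in> F \<Longrightarrow> L2_inner M (e i) (e j) = (if i = j then 1 else 0)"
  shows "(\<Sum>i\<in>F. (cmod (L2_inner M f (e i)))\<^sup>2) \<le> (\<integral>x. (cmod (f x))\<^sup>2 \<partial>M)"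
proof -
  have "0 \<le> (\<integral>x. (cmod (f x - (\<Sum>i\<in>F. L2_inner M f (e i) * e i x)))\<^sup>2 \<partial>M)" by simp
  then show ?thesis using L2_norm_diff_projection[OF assms] by simp
qed

section \<open>The Parseval function of the canonical spectrum\<close>

lemma periodic_point_finite:
  assumes "finite E" "x \<in> E" "\<And>x. x \<in> E \<Longrightarrow> s x \<in> E"
  obtains y k where "y \<in> E" "k \<ge> 1" "(s ^^ k) y = y"
proof -
  have orbit: "(s ^^ n) x \<in> E" for n
    by (induction n) (auto intro: assms)
  have "\<not> inj (\<lambda>n. (s ^^ n) x)"
    using finite_subset[OF _ assms(1), of "range (\<lambda>n. (s ^^ n) x)"] orbit range_inj_infinite by blast
  then obtain a b where ab: "a < b" "(s ^^ a) x = (s ^^ b) x"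
    unfolding inj_on_def by (metis nat_neq_iff)
  have "(s ^^ (b - a)) ((s ^^ a) x) = (s ^^ a) x"
    using ab by (metis funpow_add le_add_diff_inverse2 less_imp_le o_apply)
  then show ?thesis using that[of "(s ^^ a) x" "b - a"] orbit ab by auto
qed

text \<open>The transition probabilities at a point sum to 1, so a point with only one possible
  transition takes it with |m_B| = 1; iteration in a finite set closes up to a cycle.\<close>

lemma (in hadamard_system) m_cycle_in_finite_invariant_set:
  assumes E: "finite E" "E \<noteq> {}"
    and inv: "\<And>x l. x \<in> E \<Longrightarrow> l \<in> L \<Longrightarrow> m_fun B (tau N l x) \<noteq> 0 \<Longrightarrow> tau N l x \<in> E"
  obtains C x where "is_m_cycle N B L C" "x \<in> C" "x \<in> E"
proof -
  define S where "S = {(x, l). x \<in> E \<and> l \<in> L \<and> m_fun B (tau N l x) \<noteq> 0}"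
  have ex: "\<exists>l. (x, l) \<in> S" if "x \<in> E" for x
  proof (rule ccontr)
    assume "\<not> (\<exists>l. (x, l) \<in> S)"
    then have "(\<Sum>l\<in>L. (cmod (m_fun B (tau N l x)))\<^sup>2) = 0"
      using that by (intro sum.neutral) (auto simp: S_def)
    then show False using m_fun_hadamard(2)[OF hadamard, of x] by simp
  qed
  \<comment> \<open>Modulo 1, the map \<open>x \<mapsto> N x\<close> inverts every transition, so on the finite set \<open>E\<close> modulo 1 it is
    onto, hence injective: each point of \<open>E\<close> has exactly one transition.\<close>
  define P where "P = (\<lambda>(x, l). frac (tau N l x)) ` S"
  have "P \<subseteq> frac ` E" unfolding P_def S_def using inv by auto
  then have finP: "finite P" "card P \<le> card (frac ` E)"
    using E by (auto intro: finite_subset card_mono)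
  have R: "frac (real N * frac (tau N l x)) = frac x" if "(x, l) \<in> S" for x l
  proof -
    have "real N * frac (tau N l x) = x + of_int (l - int N * \<lfloor>tau N l x\<rfloor>)"
      using N_ge_2 by (simp add: frac_def tau_def right_diff_distrib)
    then show ?thesis by (simp add: frac_def del: of_int_diff)
  qed
  have "frac ` E \<subseteq> (\<lambda>p. frac (real N * p)) ` P"
  proof
    fix p assume "p \<in> frac ` E"
    then obtain x where x: "x \<in> E" "p = frac x" by auto
    then obtain l where "(x, l) \<in> S" using ex by blast
    then show "p \<in> (\<lambda>p. frac (real N * p)) ` P"
      using R x(2) unfolding P_def by (force simp: image_image)
  qed
  then have "card (frac ` E) \<le> card ((\<lambda>p. frac (real N * p)) ` P)"
    using finP by (intro card_mono) auto
  then have "card ((\<lambda>p. frac (real N * p)) ` P) = card P"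
    using finP card_image_le[OF finP(1), of "\<lambda>p. frac (real N * p)"] by linarith
  then have inj: "inj_on (\<lambda>p. frac (real N * p)) P"
    using finP eq_card_imp_inj_on by blast
  have unique: "l = l'" if "(x, l) \<in> S" "(x, l') \<in> S" for x l l'
  proof (rule ccontr)
    assume "l \<noteq> l'"
    \<comment> \<open>Equal fractional parts make (l - l') / N an integer and hence a period of m_B,
      whereas the Hadamard property makes m_B vanish there.\<close>
    have "frac (tau N l x) = frac (tau N l' x)"
      using inj R[OF that(1)] R[OF that(2)] that unfolding P_def inj_on_def by force
    then have "tau N l x - tau N l' x = of_int (\<lfloor>tau N l x\<rfloor> - \<lfloor>tau N l' x\<rfloor>)"
      by (simp add: frac_def)
    then have *: "of_int (l - l') / real N = of_int (\<lfloor>tau N l x\<rfloor> - \<lfloor>tau N l' x\<rfloor>)"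
      by (simp add: tau_def diff_divide_distrib add_divide_distrib)
    have "m_fun B (0 + of_int (l - l') / N) = m_fun B 0"
      unfolding * by (rule m_fun_periodic) (metis Ints_of_int of_int_mult)
    moreover have "l \<in> L" "l' \<in> L" using that by (auto simp: S_def)
    ultimately show False using m_fun_hadamard(1)[OF hadamard _ _ \<open>l \<noteq> l'\<close>] m_fun_at_0 by simp
  qed
  define d where "d x = (SOME l. (x, l) \<in> S)" for x
  have d: "(x, d x) \<in> S" if "x \<in> E" for x
    using someI_ex[OF ex[OF that]] by (simp add: d_def)
  have norm1: "cmod (m_fun B (tau N (d x) x)) = 1" if "x \<in> E" for x
  proof -
    have "1 = (\<Sum>l\<in>L. (cmod (m_fun B (tau N l x)))\<^sup>2)" by (simp add: m_fun_hadamard(2)[OF hadamard])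
    also have "\<dots> = (\<Sum>l\<in>{d x}. (cmod (m_fun B (tau N l x)))\<^sup>2)"
    proof (rule sum.mono_neutral_right)
      show "{d x} \<subseteq> L" using d[OF that] by (simp add: S_def)
      show "\<forall>l\<in>L - {d x}. (cmod (m_fun B (tau N l x)))\<^sup>2 = 0"
        using unique[OF _ d[OF that]] that by (auto simp: S_def)
    qed (rule finite_L)
    finally have "(cmod (m_fun B (tau N (d x) x)))\<^sup>2 = 1\<^sup>2" by simp
    then show ?thesis by (rule power2_eq_imp_eq) auto
  qed
  define s where "s x = tau N (d x) x" for x
  have sE: "s x \<in> E" if "x \<in> E" for x
    using d[OF that] inv by (auto simp: S_def s_def)
  obtain x0 where "x0 \<in> E" using E by auto
  then obtain x k where x: "x \<in> E" "k \<ge> 1" "(s ^^ k) x = x"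
    by (rule periodic_point_finite[OF E(1) _ sE]) auto
  have orbit: "(s ^^ n) x \<in> E" for n by (induction n) (auto intro: sE x)
  define z where "z j = (s ^^ (j - 1)) x" for j :: nat
  have step: "tau N (d (z j)) (z j) = (s ^^ j) x" if "j \<ge> 1" for j
    using that by (cases j) (auto simp: z_def s_def)
  have "is_cycle N L (z ` {1..k})"
    unfolding is_cycle_def
  proof (intro exI conjI)
    show "\<forall>j\<in>{1..k}. (d \<circ> z) j \<in> L" using d orbit by (auto simp: S_def z_def)
    show "\<forall>j\<in>{1..<k}. tau N ((d \<circ> z) j) (z j) = z (j + 1)" using step by (simp add: z_def)
    show "tau N ((d \<circ> z) k) (z k) = z 1" using step[OF x(2)] x by (simp add: z_def)
  qed (use x in auto)
  moreover have "cmod (m_fun B y) = 1" if "y \<in> z ` {1..k}" for y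
  proof -
    \<comment> \<open>\<open>norm1\<close> speaks about images under \<open>s\<close>, so the first
      point of the cycle has to be seen as the image of the last one.\<close>
    have "\<exists>j\<ge>1. y = (s ^^ j) x"
    proof -
      obtain j where j: "j \<in> {1..k}" "y = (s ^^ (j - 1)) x"
        using \<open>y \<in> z ` {1..k}\<close> unfolding z_def by blast
      show ?thesis
      proof (cases "j = 1")
        case True then show ?thesis using x j by (intro exI[of _ k]) auto
      next
        case False then show ?thesis using j by (intro exI[of _ "j - 1"]) auto
      qed
    qed
    then obtain j where "j \<ge> 1" "y = tau N (d (z j)) (z j)" using step by auto
    then show ?thesis using norm1[of "z j"] orbit by (simp add: z_def)
  qed
  moreover have "x \<in> z ` {1..k}" using x by (auto simp: z_def intro!: image_eqI[of _ _ 1])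
  ultimately show ?thesis using that x unfolding is_m_cycle_def by blast
qed

locale hadamard_measure = hadamard_system +
  fixes \<mu> :: "real measure"
  assumes self_similar: "is_self_similar_measure N B \<mu>"
begin

lemma borel_prob: "borel_prob_measure \<mu>"
  using self_similar by (simp add: is_self_similar_measure_def)

sublocale prob_space \<mu>
  by (rule borel_prob_measureD[OF borel_prob])

lemma sets_mu [measurable_cong]: "sets \<mu> = sets borel"
  by (rule borel_prob_measureD[OF borel_prob])

lemma bounded_support: obtains R where "R > 0" "AE x in \<mu>. \<bar>x\<bar> \<le> R"
  using self_similar_support[OF self_similar finite_B _ N_ge_2] zero_B by auto

lemma ftrans_0: "ftrans \<mu> 0 = 1"
  by (simp add: ftrans_def prob_space)

lemma orthonormal:
  "y \<in> \<Lambda> \<Longrightarrow> y' \<in> \<Lambda> \<Longrightarrow> L2_inner \<mu> (e_fun y) (e_fun y') = (if y = y' then 1 else 0)"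
  using spectrum_orthogonal[OF self_similar] by (simp add: L2_inner_e_fun ftrans_0 del: of_real_diff)

text \<open>Bessel's inequality for the exponential with complex frequency z, which is bounded on
  the support. The bound does not depend on \<open>F\<close>, and so provides the local boundedness
  required for a normal family.\<close>

lemma ftrans_bessel_complex:
  assumes R: "AE x in \<mu>. \<bar>x\<bar> \<le> R" and F: "finite F" "F \<subseteq> \<Lambda>"
  shows "(\<Sum>y\<in>F. (cmod (ftrans \<mu> (z + of_real y)))\<^sup>2) \<le> exp (4 * pi * R * \<bar>Im z\<bar>)"
proof -
  \<comment> \<open>Conjugated because \<open>L2_inner\<close> conjugates its second argument: the
    coefficient at \<open>e_fun y\<close> then has the modulus of the transform at z + y.\<close>
  define f where "f x = cnj (exp (2 * of_real pi * \<i> * z * of_real x))" for x :: real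
  have [measurable]: "f \<in> borel_measurable \<mu>"
    unfolding f_def measurable_cong_sets[OF sets_mu refl]
    by (intro borel_measurable_continuous_onI continuous_intros)
  have bound: "AE x in \<mu>. (cmod (f x))\<^sup>2 \<le> exp (4 * pi * R * \<bar>Im z\<bar>)"
    using R
  proof eventually_elim
    case (elim x)
    have "(cmod (f x))\<^sup>2 = exp (- (4 * pi * (Im z * x)))"
      by (simp add: f_def norm_exp_eq_Re power2_eq_square flip: exp_add)
    also have "- (Im z * x) \<le> \<bar>Im z\<bar> * R"
      using elim abs_le_iff[of "Im z * x" "\<bar>Im z\<bar> * \<bar>x\<bar>"] mult_left_mono[of "\<bar>x\<bar>" R "\<bar>Im z\<bar>"]
      by (simp add: abs_mult)
    then have "exp (- (4 * pi * (Im z * x))) \<le> exp (4 * pi * R * \<bar>Im z\<bar>)"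
      using mult_left_mono[of "- (Im z * x)" "\<bar>Im z\<bar> * R" "4 * pi"] by (simp add: mult_ac)
    finally show ?case .
  qed
  have int: "integrable \<mu> (\<lambda>x. (cmod (f x))\<^sup>2)"
    using bound by (intro integrable_const_bound[of _ "exp (4 * pi * R * \<bar>Im z\<bar>)"]) auto
  have f: "f \<in> L2_space \<mu>" using int by (simp add: L2_space_def)
  have inner: "L2_inner \<mu> f (e_fun y) = cnj (ftrans \<mu> (z + of_real y))" for y
  proof -
    have "cnj (ftrans \<mu> (z + of_real y)) = (\<integral>x. cnj (exp (2 * of_real pi * \<i> * (z + of_real y) * of_real x)) \<partial>\<mu>)"
      by (simp add: ftrans_def)
    also have "\<dots> = L2_inner \<mu> f (e_fun y)"
      unfolding L2_inner_def f_def e_fun_def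
      by (intro Bochner_Integration.integral_cong refl)
         (simp add: exp_cnj exp_add algebra_simps flip: exp_add)
    finally show ?thesis by simp
  qed
  have "(\<Sum>y\<in>F. (cmod (ftrans \<mu> (z + of_real y)))\<^sup>2) = (\<Sum>y\<in>F. (cmod (L2_inner \<mu> f (e_fun y)))\<^sup>2)"
    by (simp add: inner)
  also have "\<dots> \<le> (\<integral>x. (cmod (f x))\<^sup>2 \<partial>\<mu>)"
    using F orthonormal by (intro L2_bessel f prob_space_axioms) (auto simp: subset_iff)
  also have "\<dots> \<le> (\<integral>x. exp (4 * pi * R * \<bar>Im z\<bar>) \<partial>\<mu>)"
    by (intro integral_mono_AE int bound) auto
  finally show ?thesis by (simp add: prob_space)
qed

definition Q :: "real \<Rightarrow> real" where
  "Q t = (\<Sum>\<^sub>\<infinity>y\<in>\<Lambda>. (cmod (ftrans \<mu> (of_real (t + y))))\<^sup>2)"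

lemma ftrans_bessel:
  assumes "finite F" "F \<subseteq> \<Lambda>"
  shows "(\<Sum>y\<in>F. (cmod (ftrans \<mu> (of_real (t + y))))\<^sup>2) \<le> 1"
proof -
  obtain R where "AE x in \<mu>. \<bar>x\<bar> \<le> R" by (rule bounded_support)
  from ftrans_bessel_complex[OF this assms, of "of_real t"] show ?thesis by simp
qed

lemma Q_summable: "(\<lambda>y. (cmod (ftrans \<mu> (of_real (t + y))))\<^sup>2) summable_on \<Lambda>"
  using ftrans_bessel by (intro nonneg_bdd_above_summable_on bdd_aboveI[of _ 1]) auto

lemma Q_has_sum: "((\<lambda>y. (cmod (ftrans \<mu> (of_real (t + y))))\<^sup>2) has_sum Q t) \<Lambda>"
  unfolding Q_def using Q_summable by (rule has_sum_infsum)

lemma Q_le_1: "Q t \<le> 1"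
  unfolding Q_def by (rule infsum_le_finite_sums[OF Q_summable]) (rule ftrans_bessel)

lemma Q_ge_1_on_spectrum:
  assumes "- t \<in> \<Lambda>"
  shows "Q t \<ge> 1"
proof -
  have "(\<Sum>y\<in>{- t}. (cmod (ftrans \<mu> (of_real (t + y))))\<^sup>2) \<le> Q t"
    using assms by (intro finite_sum_le_has_sum[OF Q_has_sum]) auto
  then show ?thesis by (simp add: ftrans_0)
qed

lemma Q_transfer: "Q t = (\<Sum>l\<in>L. (cmod (m_fun B (tau N l t)))\<^sup>2 * Q (tau N l t))"
proof -
  let ?f = "\<lambda>y. (cmod (ftrans \<mu> (of_real (t + y))))\<^sup>2"
  let ?\<phi> = "\<lambda>l y. real N * y + of_int l"
  have "(?f has_sum (cmod (m_fun B (tau N l t)))\<^sup>2 * Q (tau N l t)) (?\<phi> l ` \<Lambda>)" if "l \<in> L" for l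
  proof -
    have inj: "inj_on (?\<phi> l) \<Lambda>" using N_ge_2 by (auto simp: inj_on_def)
    have "(?f \<circ> ?\<phi> l) y = (cmod (m_fun B (tau N l t)))\<^sup>2 * (cmod (ftrans \<mu> (of_real (tau N l t + y))))\<^sup>2"
      if "y \<in> \<Lambda>" for y
    proof -
      have "(t + ?\<phi> l y) / N = tau N l t + y" using N_ge_2 by (simp add: tau_def field_simps)
      then have "ftrans \<mu> (of_real (t + ?\<phi> l y)) = m_fun B (tau N l t) * ftrans \<mu> (of_real (tau N l t + y))"
        using ftrans_self_similar[OF self_similar finite_B _, of "t + ?\<phi> l y"] zero_B N_ge_2 m_fun_plus_spectrum[OF that]
        by auto
      then show ?thesis by (simp add: norm_mult power_mult_distrib)
    qed
    then have "((?f \<circ> ?\<phi> l) has_sum (cmod (m_fun B (tau N l t)))\<^sup>2 * Q (tau N l t)) \<Lambda>"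
      using has_sum_cmult_right[OF Q_has_sum, of "(cmod (m_fun B (tau N l t)))\<^sup>2" "tau N l t"]
      by (subst has_sum_cong) auto
    then show ?thesis by (simp add: has_sum_reindex[OF inj])
  qed
  then have "(?f has_sum (\<Sum>l\<in>L. (cmod (m_fun B (tau N l t)))\<^sup>2 * Q (tau N l t))) (\<Union>l\<in>L. ?\<phi> l ` \<Lambda>)"
  proof (intro sum_has_sum finite_L)
    fix l l' assume "l \<in> L" "l' \<in> L" "l \<noteq> l'"
    then show "?\<phi> l ` \<Lambda> \<inter> ?\<phi> l' ` \<Lambda> = {}" using spectrum_decompose_unique(2) by blast
  qed
  also have "(\<Union>l\<in>L. ?\<phi> l ` \<Lambda>) = \<Lambda>"
  proof
    show "(\<Union>l\<in>L. ?\<phi> l ` \<Lambda>) \<subseteq> \<Lambda>" using canonical_spectrum.step by blast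
    show "\<Lambda> \<subseteq> (\<Union>l\<in>L. ?\<phi> l ` \<Lambda>)"
    proof
      fix y assume "y \<in> \<Lambda>"
      then show "y \<in> (\<Union>l\<in>L. ?\<phi> l ` \<Lambda>)" by (rule spectrum_decompose) blast
    qed
  qed
  finally show ?thesis using Q_has_sum has_sum_unique by blast
qed

text \<open>The squared modulus is not holomorphic; it is replaced by F(z + y) F(- z - y), which
  agrees with it for real z because F(- t) is the conjugate of F(t).\<close>

lemma Q_entire:
  obtains g where "g holomorphic_on UNIV" "\<And>t. g (of_real t) = of_real (Q t)"
proof -
  obtain R where R: "R > 0" "AE x in \<mu>. \<bar>x\<bar> \<le> R" by (rule bounded_support)
  note hol = holomorphic_ftrans[OF prob_space_axioms sets_mu R(2)]
  \<comment> \<open>Initial segments of an enumeration are cofinal among the finite subsets, which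
    turns the unordered sum into a limit of a sequence.\<close>
  define F where "F n = {y \<in> \<Lambda>. to_nat_on \<Lambda> y < n}" for n
  have F: "finite (F n)" "F n \<subseteq> \<Lambda>" for n
  proof -
    have "inj_on (to_nat_on \<Lambda>) (F n)"
      using inj_on_to_nat_on[OF countable_spectrum] by (rule inj_on_subset) (auto simp: F_def)
    moreover have "to_nat_on \<Lambda> ` F n \<subseteq> {..<n}" by (auto simp: F_def)
    ultimately show "finite (F n)" by (meson finite_imageD finite_lessThan finite_subset)
  qed (auto simp: F_def)
  have lim: "filterlim F (finite_subsets_at_top \<Lambda>) sequentially"
  proof (subst filterlim_finite_subsets_at_top, intro allI impI)
    fix X assume X: "finite X \<and> X \<subseteq> \<Lambda>"
    obtain n where n: "\<forall>y\<in>X. to_nat_on \<Lambda> y < n"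
      using X by (meson finite_imageI finite_nat_set_iff_bounded imageI)
    show "\<forall>\<^sub>F k in sequentially. finite (F k) \<and> X \<subseteq> F k \<and> F k \<subseteq> \<Lambda>"
      using eventually_ge_at_top[of n]
    proof eventually_elim
      case (elim k)
      then show ?case using F[of k] X n by (force simp: F_def)
    qed
  qed
  define G where "G n z = (\<Sum>y\<in>F n. ftrans \<mu> (z + of_real y) * ftrans \<mu> (- z - of_real y))" for n z
  have conj: "ftrans \<mu> (- z - of_real y) = cnj (ftrans \<mu> (cnj z + of_real y))" for z y
    by (simp add: cnj_ftrans)
  have bound: "cmod (G n z) \<le> exp (4 * pi * R * \<bar>Im z\<bar>)" for n z
  proof -
    have "cmod (G n z) \<le> (\<Sum>y\<in>F n. cmod (ftrans \<mu> (z + of_real y)) * cmod (ftrans \<mu> (cnj z + of_real y)))"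
      unfolding G_def conj by (rule sum_norm_le) (simp add: norm_mult)
    also have "\<dots> \<le> (\<Sum>y\<in>F n. (cmod (ftrans \<mu> (z + of_real y)))\<^sup>2 / 2 + (cmod (ftrans \<mu> (cnj z + of_real y)))\<^sup>2 / 2)"
    proof (rule sum_mono)
      fix y
      show "cmod (ftrans \<mu> (z + of_real y)) * cmod (ftrans \<mu> (cnj z + of_real y))
        \<le> (cmod (ftrans \<mu> (z + of_real y)))\<^sup>2 / 2 + (cmod (ftrans \<mu> (cnj z + of_real y)))\<^sup>2 / 2"
        using sum_squares_bound[of "cmod (ftrans \<mu> (z + of_real y))" "cmod (ftrans \<mu> (cnj z + of_real y))"] by simp
    qed
    also have "\<dots> \<le> exp (4 * pi * R * \<bar>Im z\<bar>)"
      using ftrans_bessel_complex[OF R(2) F[of n], of z] ftrans_bessel_complex[OF R(2) F[of n], of "cnj z"]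
      by (simp add: sum.distrib sum_divide_distrib[symmetric])
    finally show ?thesis .
  qed
  have G_hol: "G n holomorphic_on UNIV" for n
  proof -
    have "(\<lambda>z. ftrans \<mu> (h z)) holomorphic_on UNIV" if "h holomorphic_on UNIV" for h
      using holomorphic_on_compose_gen[OF that hol] by (simp add: o_def)
    note this [holomorphic_intros]
    then show ?thesis unfolding G_def by (intro holomorphic_intros)
  qed
  \<comment> \<open>Montel's theorem gives only a subsequence. This is enough, since on the real
    line the partial sums are already known to converge to \<open>Q\<close>.\<close>
  obtain g r where g: "g holomorphic_on UNIV" and r: "strict_mono (r :: nat \<Rightarrow> nat)"
    and gr: "\<And>z. z \<in> UNIV \<Longrightarrow> (\<lambda>n. G (r n) z) \<longlonglongrightarrow> g z"
  proof (rule Montel[of UNIV "range G" G])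
    fix K :: "complex set" assume "compact K"
    then have "bounded K" by (rule compact_imp_bounded)
    then obtain b where b: "\<And>z. z \<in> K \<Longrightarrow> cmod z \<le> b" by (auto simp: bounded_iff)
    have "cmod (G n z) \<le> exp (4 * pi * R * b)" if "z \<in> K" for n z
    proof -
      have "\<bar>Im z\<bar> \<le> b" using b[OF that] abs_Im_le_cmod[of z] by linarith
      then have "4 * pi * R * \<bar>Im z\<bar> \<le> 4 * pi * R * b" using R by (intro mult_left_mono) auto
      then show ?thesis using bound[of n z] by (meson exp_le_cancel_iff order_trans)
    qed
    then show "\<exists>b. \<forall>h\<in>range G. \<forall>z\<in>K. cmod (h z) \<le> b" by blast
  qed (use G_hol in auto)
  have "g (of_real t) = of_real (Q t)" for t
  proof -
    have "(\<lambda>n. \<Sum>y\<in>F n. (cmod (ftrans \<mu> (of_real (t + y))))\<^sup>2) \<longlonglongrightarrow> Q t"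
      using Q_has_sum[of t] unfolding has_sum_def by (rule filterlim_compose[OF _ lim])
    then have "((\<lambda>n. \<Sum>y\<in>F n. (cmod (ftrans \<mu> (of_real (t + y))))\<^sup>2) \<circ> r) \<longlonglongrightarrow> Q t"
      using r by (rule LIMSEQ_subseq_LIMSEQ)
    then have "(\<lambda>n. complex_of_real (\<Sum>y\<in>F (r n). (cmod (ftrans \<mu> (of_real (t + y))))\<^sup>2)) \<longlonglongrightarrow> of_real (Q t)"
      by (intro tendsto_of_real) (simp add: o_def)
    also have "(\<lambda>n. complex_of_real (\<Sum>y\<in>F (r n). (cmod (ftrans \<mu> (of_real (t + y))))\<^sup>2)) = (\<lambda>n. G (r n) (of_real t))"
      unfolding G_def conj by (simp only: of_real_sum complex_norm_square) simp
    finally show ?thesis using gr[of "of_real t"] LIMSEQ_unique by blast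
  qed
  then show ?thesis using that g by blast
qed

lemma tau_bound:
  assumes "l \<in> L" "\<bar>t\<bar> \<le> T" "\<And>l. l \<in> L \<Longrightarrow> \<bar>real_of_int l\<bar> \<le> T"
  shows "\<bar>tau N l t\<bar> \<le> T"
proof -
  have "\<bar>t + of_int l\<bar> \<le> 2 * T" using assms(2) assms(3)[OF assms(1)] by linarith
  also have "\<dots> \<le> N * T" using N_ge_2 assms(2) by (intro mult_right_mono) auto
  finally show ?thesis using N_ge_2 by (simp add: tau_def field_simps)
qed

lemma Q_eq_1: "Q t = 1"
proof (rule ccontr)
  assume "Q t \<noteq> 1"
  then have "Q t < 1" using Q_le_1[of t] by simp
  obtain g where g: "g holomorphic_on UNIV" "\<And>t. g (of_real t) = of_real (Q t)" by (rule Q_entire) blast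
  \<comment> \<open>\<open>T\<close> dominates all digits, so [-T, T] is mapped into itself by each
    tau_l (as N >= 2), and it contains \<open>t\<close>.\<close>
  define T where "T = Max (insert \<bar>t\<bar> ((\<lambda>l. \<bar>real_of_int l\<bar>) ` L))"
  have T: "\<bar>t\<bar> \<le> T" "\<And>l. l \<in> L \<Longrightarrow> \<bar>real_of_int l\<bar> \<le> T"
    unfolding T_def using finite_L by auto
  have cont: "continuous_on {-T..T} Q"
  proof -
    have "continuous_on UNIV (\<lambda>t. Re (g (of_real t)))"
      by (intro continuous_on_Re continuous_on_of_real_id
          continuous_on_compose2[OF holomorphic_on_imp_continuous_on[OF g(1)]]) auto
    then show ?thesis unfolding g(2) by (auto intro: continuous_on_subset)
  qed
  obtain x where x: "x \<in> {-T..T}" "\<And>y. y \<in> {-T..T} \<Longrightarrow> Q x \<le> Q y"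
  proof -
    have "{-T..T} \<noteq> {}" using T(1) by auto
    from continuous_attains_inf[OF compact_Icc this cont] show ?thesis using that by (elim bexE) auto
  qed
  define m where "m = Q x"
  define E where "E = {y \<in> {-T..T}. Q y = m}"
  have "m < 1" using x(2)[of t] T(1) \<open>Q t < 1\<close> by (auto simp: m_def abs_le_iff)
  \<comment> \<open>Otherwise the minimizers accumulate in the compact interval and the entire
    extension of \<open>Q\<close> is constant, against Q(0) >= 1 > m.\<close>
  have "finite E"
  proof (rule ccontr)
    assume "infinite E"
    then have "infinite (complex_of_real ` E)" by (simp add: finite_image_iff inj_on_def)
    moreover have "complex_of_real ` E \<subseteq> complex_of_real ` {-T..T}" by (auto simp: E_def)
    moreover have "compact (complex_of_real ` {-T..T})"
      by (intro compact_continuous_image continuous_intros) auto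
    ultimately obtain \<xi> where "\<xi> islimpt (complex_of_real ` E)"
      using compact_eq_Bolzano_Weierstrass by blast
    moreover have "g constant_on (complex_of_real ` E)"
      unfolding constant_on_def using g(2) by (auto simp: E_def)
    ultimately have "g constant_on UNIV"
      using analytic_continuation'[OF g(1), of "complex_of_real ` E" \<xi>] by auto
    then have "g (of_real 0) = g (of_real x)" unfolding constant_on_def by auto
    then have "Q 0 = m" unfolding g(2) m_def by (simp only: of_real_eq_iff)
    moreover have "Q 0 \<ge> 1" using zero_in_spectrum by (intro Q_ge_1_on_spectrum) simp
    ultimately show False using \<open>m < 1\<close> by simp
  qed
  moreover have "E \<noteq> {}" using x by (auto simp: E_def m_def)
  moreover have "tau N l y \<in> E" if "y \<in> E" "l \<in> L" "m_fun B (tau N l y) \<noteq> 0" for y l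
  proof -
    have bd: "tau N l' y \<in> {-T..T}" if "l' \<in> L" for l'
      using tau_bound[OF that _ T(2), of y] \<open>y \<in> E\<close> by (force simp: E_def)
    then have ge: "Q (tau N l' y) \<ge> m" if "l' \<in> L" for l' using that x(2) by (simp add: m_def)
    \<comment> \<open>At a minimizer the weighted average of the nonnegative excesses over
      \<open>m\<close> is 0, so every transition of positive weight leads to a minimizer.\<close>
    have "(\<Sum>l\<in>L. (cmod (m_fun B (tau N l y)))\<^sup>2 * (Q (tau N l y) - m)) = Q y - m"
      unfolding right_diff_distrib sum_subtractf sum_distrib_right[symmetric]
      using Q_transfer[of y] m_fun_hadamard(2)[OF hadamard, of y] by simp
    also have "\<dots> = 0" using that by (simp add: E_def)
    finally have "\<forall>l\<in>L. (cmod (m_fun B (tau N l y)))\<^sup>2 * (Q (tau N l y) - m) = 0"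
      using ge by (subst (asm) sum_nonneg_eq_0_iff[OF finite_L]) auto
    then show ?thesis using that bd by (auto simp: E_def)
  qed
  ultimately obtain C y where "is_m_cycle N B L C" "y \<in> C" "y \<in> E"
    using m_cycle_in_finite_invariant_set by metis
  then have "Q y \<ge> 1" using canonical_spectrum.cycle by (intro Q_ge_1_on_spectrum) blast
  then show False using \<open>y \<in> E\<close> \<open>m < 1\<close> by (simp add: E_def)
qed

end

section \<open>Density of exponentials in \<open>L\<^sup>2\<close>\<close>

abbreviation L2_sq :: "'a measure \<Rightarrow> ('a \<Rightarrow> complex) \<Rightarrow> real" where
  "L2_sq M f \<equiv> (\<integral>x. (cmod (f x))\<^sup>2 \<partial>M)"

text \<open>Formulated with the squared distance, to which integral estimates apply directly; the
  root in \<open>L2_norm\<close> is taken only in the final theorem on spectral pairs.\<close>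

definition L2_closed_span :: "'a measure \<Rightarrow> 'i set \<Rightarrow> ('i \<Rightarrow> 'a \<Rightarrow> complex) \<Rightarrow> ('a \<Rightarrow> complex) set" where
  "L2_closed_span M I \<phi> = {f \<in> L2_space M. \<forall>\<epsilon>>0. \<exists>F c. finite F \<and> F \<subseteq> I \<and>
     L2_sq M (\<lambda>x. f x - (\<Sum>i\<in>F. c i * \<phi> i x)) < \<epsilon>}"

lemma cmod_add_square_le: "(cmod (a + b))\<^sup>2 \<le> 2 * (cmod a)\<^sup>2 + 2 * (cmod b)\<^sup>2"
proof -
  have "(cmod (a + b))\<^sup>2 \<le> (cmod a + cmod b)\<^sup>2" by (intro power_mono norm_triangle_ineq) auto
  also have "\<dots> \<le> 2 * (cmod a)\<^sup>2 + 2 * (cmod b)\<^sup>2"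
    using zero_le_power2[of "cmod a - cmod b"] by (simp add: power2_eq_square algebra_simps)
  finally show ?thesis .
qed

lemma L2_space_add:
  assumes "f \<in> L2_space M" "g \<in> L2_space M"
  shows "(\<lambda>x. f x + g x) \<in> L2_space M"
proof -
  have [measurable]: "f \<in> borel_measurable M" "g \<in> borel_measurable M" using assms by (auto simp: L2_space_def)
  have "integrable M (\<lambda>x. (cmod (f x + g x))\<^sup>2)"
  proof (rule Bochner_Integration.integrable_bound)
    show "integrable M (\<lambda>x. 2 * (cmod (f x))\<^sup>2 + 2 * (cmod (g x))\<^sup>2)"
      using assms by (auto simp: L2_space_def)
  qed (use cmod_add_square_le in \<open>auto intro!: AE_I2\<close>)
  then show ?thesis by (simp add: L2_space_def)
qed

lemma L2_space_scale: "f \<in> L2_space M \<Longrightarrow> (\<lambda>x. c * f x) \<in> L2_space M"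
  by (auto simp: L2_space_def norm_mult power_mult_distrib)

lemma L2_space_diff:
  assumes "f \<in> L2_space M" "g \<in> L2_space M"
  shows "(\<lambda>x. f x - g x) \<in> L2_space M"
  using L2_space_add[OF assms(1) L2_space_scale[OF assms(2), of "-1"]] by simp

lemma L2_space_sum: "(\<And>i. i \<in> F \<Longrightarrow> f i \<in> L2_space M) \<Longrightarrow> (\<lambda>x. \<Sum>i\<in>F. f i x) \<in> L2_space M"
proof (induction F rule: infinite_finite_induct)
  case (insert i F)
  then show ?case using L2_space_add[of "f i" M "\<lambda>x. \<Sum>i\<in>F. f i x"] by simp
qed (auto simp: L2_space_def)

text \<open>A substitute for the triangle inequality. Its factors 2 are the reason for the errors
  \<epsilon> / 4 in the closure properties below.\<close>

lemma L2_integral_add_le: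
  assumes "f \<in> L2_space M" "g \<in> L2_space M"
  shows "L2_sq M (\<lambda>x. f x + g x) \<le> 2 * L2_sq M f + 2 * L2_sq M g"
proof -
  have "L2_sq M (\<lambda>x. f x + g x) \<le> (\<integral>x. 2 * (cmod (f x))\<^sup>2 + 2 * (cmod (g x))\<^sup>2 \<partial>M)"
    using assms L2_space_add[OF assms] by (intro integral_mono cmod_add_square_le) (auto simp: L2_space_def)
  then show ?thesis using assms by (simp add: L2_space_def)
qed

context
  fixes M :: "'a measure" and I :: "'i set" and \<phi> :: "'i \<Rightarrow> 'a \<Rightarrow> complex"
  assumes \<phi>: "\<And>i. i \<in> I \<Longrightarrow> \<phi> i \<in> L2_space M"
begin

abbreviation comb :: "'i set \<Rightarrow> ('i \<Rightarrow> complex) \<Rightarrow> 'a \<Rightarrow> complex" where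
  "comb F c \<equiv> \<lambda>x. \<Sum>i\<in>F. c i * \<phi> i x"

lemma L2_combination: "F \<subseteq> I \<Longrightarrow> comb F c \<in> L2_space M"
  by (intro L2_space_sum L2_space_scale \<phi>) auto

lemma L2_closed_span_limit:
  assumes "f \<in> L2_space M"
    and "\<And>\<epsilon>. \<epsilon> > 0 \<Longrightarrow> \<exists>g\<in>L2_closed_span M I \<phi>. L2_sq M (\<lambda>x. f x - g x) < \<epsilon>"
  shows "f \<in> L2_closed_span M I \<phi>"
proof -
  have "\<exists>F c. finite F \<and> F \<subseteq> I \<and> L2_sq M (\<lambda>x. f x - comb F c x) < \<epsilon>"
    if "\<epsilon> > 0" for \<epsilon>
  proof -
    obtain g where g: "g \<in> L2_closed_span M I \<phi>" "L2_sq M (\<lambda>x. f x - g x) < \<epsilon> / 4"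
      using assms(2)[of "\<epsilon> / 4"] \<open>\<epsilon> > 0\<close> by auto
    have "\<epsilon> / 4 > 0" using \<open>\<epsilon> > 0\<close> by simp
    then obtain F c where F: "finite F" "F \<subseteq> I" "L2_sq M (\<lambda>x. g x - comb F c x) < \<epsilon> / 4"
      using g(1) unfolding L2_closed_span_def by blast
    have "L2_sq M (\<lambda>x. (f x - g x) + (g x - comb F c x))
      \<le> 2 * L2_sq M (\<lambda>x. f x - g x) + 2 * L2_sq M (\<lambda>x. g x - comb F c x)"
      using assms(1) g(1) F(2)
      by (intro L2_integral_add_le L2_space_diff L2_combination) (auto simp: L2_closed_span_def)
    then have "L2_sq M (\<lambda>x. f x - comb F c x) < \<epsilon>"
      using g(2) F(3) by simp
    then show ?thesis using F by blast
  qed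
  then show ?thesis using assms(1) by (simp add: L2_closed_span_def)
qed

lemma L2_closed_span_add:
  assumes "f \<in> L2_closed_span M I \<phi>" "g \<in> L2_closed_span M I \<phi>"
  shows "(\<lambda>x. f x + g x) \<in> L2_closed_span M I \<phi>"
proof -
  have "\<exists>F c. finite F \<and> F \<subseteq> I \<and> L2_sq M (\<lambda>x. f x + g x - comb F c x) < \<epsilon>"
    if "\<epsilon> > 0" for \<epsilon>
  proof -
    have "\<epsilon> / 4 > 0" using that by simp
    then obtain F c where F: "finite F" "F \<subseteq> I" "L2_sq M (\<lambda>x. f x - comb F c x) < \<epsilon> / 4"
      using assms(1) unfolding L2_closed_span_def by blast
    from \<open>\<epsilon> / 4 > 0\<close> obtain G d where G: "finite G" "G \<subseteq> I" "L2_sq M (\<lambda>x. g x - comb G d x) < \<epsilon> / 4"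
      using assms(2) unfolding L2_closed_span_def by blast
    \<comment> \<open>Both coefficient families are extended by 0 to the union of the index sets; on
      the overlap they add up.\<close>
    define h where "h i = (if i \<in> F then c i else 0) + (if i \<in> G then d i else 0)" for i
    have h: "(\<Sum>i\<in>F \<union> G. h i * \<phi> i x) = comb F c x + comb G d x" for x
    proof -
      have "comb F c x = (\<Sum>i\<in>F \<union> G. if i \<in> F then c i * \<phi> i x else 0)"
        "comb G d x = (\<Sum>i\<in>F \<union> G. if i \<in> G then d i * \<phi> i x else 0)"
        using F(1) G(1) by (auto simp: sum.If_cases intro!: sum.cong)
      then show ?thesis
        unfolding sum.distrib[symmetric] by (simp only: sum.distrib[symmetric]) (auto simp: h_def distrib_right intro!: sum.cong)
    qed
    have "L2_sq M (\<lambda>x. (f x - comb F c x) + (g x - comb G d x))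
      \<le> 2 * L2_sq M (\<lambda>x. f x - comb F c x) + 2 * L2_sq M (\<lambda>x. g x - comb G d x)"
      using assms F(2) G(2)
      by (intro L2_integral_add_le L2_space_diff L2_combination) (auto simp: L2_closed_span_def)
    also have "\<dots> < \<epsilon>" using F G by simp
    finally have "L2_sq M (\<lambda>x. f x + g x - (\<Sum>i\<in>F \<union> G. h i * \<phi> i x)) < \<epsilon>"
      by (simp add: h algebra_simps)
    then show ?thesis using F G by (intro exI[of _ "F \<union> G"] exI[of _ h]) auto
  qed
  then show ?thesis using assms by (auto simp: L2_closed_span_def intro: L2_space_add)
qed

lemma L2_closed_span_scale:
  assumes "f \<in> L2_closed_span M I \<phi>"
  shows "(\<lambda>x. a * f x) \<in> L2_closed_span M I \<phi>"
proof -
  have "\<exists>F c. finite F \<and> F \<subseteq> I \<and> L2_sq M (\<lambda>x. a * f x - comb F c x) < \<epsilon>"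
    if "\<epsilon> > 0" for \<epsilon>
  proof -
    \<comment> \<open>The summand 1 keeps the denominator positive when \<open>a\<close> is
      0.\<close>
    have "\<epsilon> / ((cmod a)\<^sup>2 + 1) > 0" using that by (intro divide_pos_pos) (auto intro: add_nonneg_pos)
    then obtain F c where F: "finite F" "F \<subseteq> I" "L2_sq M (\<lambda>x. f x - comb F c x) < \<epsilon> / ((cmod a)\<^sup>2 + 1)"
      using assms(1) unfolding L2_closed_span_def by blast
    let ?J = "\<integral>x. (cmod (f x - comb F c x))\<^sup>2 \<partial>M"
    have "L2_sq M (\<lambda>x. a * f x - (\<Sum>i\<in>F. (a * c i) * \<phi> i x)) = (\<integral>x. (cmod a)\<^sup>2 * (cmod (f x - comb F c x))\<^sup>2 \<partial>M)"
    proof (intro Bochner_Integration.integral_cong refl)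
      fix x
      have "a * f x - (\<Sum>i\<in>F. (a * c i) * \<phi> i x) = a * (f x - comb F c x)"
        by (simp add: right_diff_distrib sum_distrib_left mult.assoc)
      then show "(cmod (a * f x - (\<Sum>i\<in>F. (a * c i) * \<phi> i x)))\<^sup>2 = (cmod a)\<^sup>2 * (cmod (f x - comb F c x))\<^sup>2"
        by (simp only: norm_mult power_mult_distrib)
    qed
    also have "\<dots> = (cmod a)\<^sup>2 * ?J" by (rule integral_mult_right_zero)
    also have "\<dots> \<le> ((cmod a)\<^sup>2 + 1) * ?J" by (intro mult_right_mono) auto
    also have "\<dots> < \<epsilon>"
    proof -
      have "(cmod a)\<^sup>2 + 1 > 0" by (intro add_nonneg_pos) auto
      then show ?thesis using F(3) by (simp only: pos_less_divide_eq mult.commute)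
    qed
    finally show ?thesis using F(1,2) by (intro exI[of _ F] exI[of _ "\<lambda>i. a * c i"] conjI)
  qed
  then show ?thesis using assms by (auto simp: L2_closed_span_def intro: L2_space_scale)
qed

lemma L2_closed_span_0: "(\<lambda>x. 0) \<in> L2_closed_span M I \<phi>"
  by (auto simp: L2_closed_span_def L2_space_def intro!: exI[of _ "{}"])

lemma L2_closed_span_sum:
  "(\<And>k. k \<in> K \<Longrightarrow> f k \<in> L2_closed_span M I \<phi>) \<Longrightarrow> (\<lambda>x. \<Sum>k\<in>K. f k x) \<in> L2_closed_span M I \<phi>"
  by (induction K rule: infinite_finite_induct) (auto intro: L2_closed_span_add L2_closed_span_0)

text \<open>Each later extension, to half-lines, to countable disjoint unions and finally to all of
  \<open>L2_space\<close>, is an instance of this closure under dominated limits.\<close>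

lemma L2_closed_span_dominated:
  assumes fn: "\<And>n. f n \<in> L2_closed_span M I \<phi>" and g: "g \<in> L2_space M"
    and lim: "AE x in M. (\<lambda>n. f n x) \<longlonglongrightarrow> g x"
    and dom: "integrable M h" "\<And>n. AE x in M. (cmod (g x - f n x))\<^sup>2 \<le> h x"
  shows "g \<in> L2_closed_span M I \<phi>"
proof (rule L2_closed_span_limit[OF g])
  fix \<epsilon> :: real assume "\<epsilon> > 0"
  have [measurable]: "g \<in> borel_measurable M" "\<And>n. f n \<in> borel_measurable M"
    using g fn by (auto simp: L2_space_def L2_closed_span_def)
  have "(\<lambda>n. \<integral>x. (cmod (g x - f n x))\<^sup>2 \<partial>M) \<longlonglongrightarrow> (\<integral>x. 0 \<partial>M)"
  proof (rule integral_dominated_convergence[where w = h])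
    show "AE x in M. (\<lambda>n. (cmod (g x - f n x))\<^sup>2) \<longlonglongrightarrow> 0"
      using lim
    proof eventually_elim
      case (elim x)
      have "(\<lambda>n. (cmod (g x - f n x))\<^sup>2) \<longlonglongrightarrow> (cmod (g x - g x))\<^sup>2"
        by (intro tendsto_intros elim)
      then show ?case by simp
    qed
  qed (use dom in auto)
  then have "\<forall>\<^sub>F n in sequentially. L2_sq M (\<lambda>x. g x - f n x) < \<epsilon>"
    using \<open>\<epsilon> > 0\<close> by (intro order_tendstoD) auto
  then obtain n where "L2_sq M (\<lambda>x. g x - f n x) < \<epsilon>"
    by (auto simp: eventually_sequentially)
  then show "\<exists>g'\<in>L2_closed_span M I \<phi>. L2_sq M (\<lambda>x. g x - g' x) < \<epsilon>"
    using fn by blast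
qed

end

section \<open>From exponentials to all square-integrable functions\<close>

inductive_set trig_polys :: "(real \<Rightarrow> complex) set" where
  exp: "e_fun t \<in> trig_polys"
| scale: "f \<in> trig_polys \<Longrightarrow> (\<lambda>x. c * f x) \<in> trig_polys"
| add: "f \<in> trig_polys \<Longrightarrow> g \<in> trig_polys \<Longrightarrow> (\<lambda>x. f x + g x) \<in> trig_polys"

lemma trig_polys_mult:
  assumes "f \<in> trig_polys" "g \<in> trig_polys"
  shows "(\<lambda>x. f x * g x) \<in> trig_polys"
  using assms(1)
proof induction
  case (exp t)
  show ?case using assms(2)
  proof induction
    case (exp s)
    have "(\<lambda>x. e_fun t x * e_fun s x) = e_fun (t + s)" by (simp add: fun_eq_iff e_fun_add)
    then show ?case by (simp add: trig_polys.exp)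
  next
    case (scale f c)
    from trig_polys.scale[OF scale.IH, of c] show ?case by (simp add: mult_ac)
  next
    case (add f g)
    from trig_polys.add[OF add.IH] show ?case by (simp add: distrib_left)
  qed
next
  case (scale f c)
  from trig_polys.scale[OF scale.IH, of c] show ?case by (simp add: mult_ac)
next
  case (add f g)
  from trig_polys.add[OF add.IH] show ?case by (simp add: distrib_right)
qed

lemma trig_polys_continuous: "f \<in> trig_polys \<Longrightarrow> continuous_on UNIV f"
  by (induction rule: trig_polys.induct) (auto simp: e_fun_def[abs_def] intro!: continuous_intros)

lemma trig_polys_dense:
  fixes f :: "real \<Rightarrow> real"
  assumes "compact S" "continuous_on S f" "\<epsilon> > 0"
  obtains g where "(\<lambda>x. complex_of_real (g x)) \<in> trig_polys" "\<And>x. x \<in> S \<Longrightarrow> \<bar>f x - g x\<bar> < \<epsilon>"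
proof -
  let ?P = "\<lambda>h::real \<Rightarrow> real. (\<lambda>x. complex_of_real (h x)) \<in> trig_polys"
  have Re: "?P (\<lambda>x. Re (e_fun s x))" for s
  proof -
    have "(\<lambda>x. complex_of_real (Re (e_fun s x))) = (\<lambda>x. (1/2) * (e_fun s x + e_fun (- s) x))"
      by (simp add: fun_eq_iff e_fun_minus complex_add_cnj)
    then show ?thesis by (simp only:) (intro trig_polys.intros)
  qed
  have Im: "?P (\<lambda>x. Im (e_fun s x))" for s
  proof -
    have "(\<lambda>x. complex_of_real (Im (e_fun s x))) = (\<lambda>x. (- \<i>/2) * (e_fun s x + (- 1) * e_fun (- s) x))"
      by (simp add: fun_eq_iff e_fun_minus complex_eq_iff)
    then show ?thesis by (simp only:) (intro trig_polys.intros)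
  qed
  have "\<exists>g. ?P g \<and> (\<forall>x\<in>S. \<bar>f x - g x\<bar> < \<epsilon>)"
  proof (rule Stone_Weierstrass_HOL[OF assms(1)])
    show "?P (\<lambda>x. c)" for c
      using trig_polys.scale[OF trig_polys.exp[of 0], of "of_real c"] by simp
    show "continuous_on S h" if "?P h" for h
    proof -
      have "continuous_on S (\<lambda>x. Re (complex_of_real (h x)))"
        using trig_polys_continuous[OF that] by (intro continuous_on_Re) (auto intro: continuous_on_subset)
      then show ?thesis by simp
    qed
    show "?P (\<lambda>x. f x + g x)" if "?P f \<and> ?P g" for f g
      using that trig_polys.add[of "\<lambda>x. of_real (f x)" "\<lambda>x. of_real (g x)"] by simp
    show "?P (\<lambda>x. f x * g x)" if "?P f \<and> ?P g" for f g
      using that trig_polys_mult[of "\<lambda>x. of_real (f x)" "\<lambda>x. of_real (g x)"] by simp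
    show "\<exists>f. ?P f \<and> f x \<noteq> f y" if "x \<in> S \<and> y \<in> S \<and> x \<noteq> y" for x y
    proof -
      \<comment> \<open>This frequency turns by half a period between \<open>y\<close> and
        \<open>x\<close>, so the two values of the exponential are opposite.\<close>
      define s where "s = 1 / (2 * (x - y))"
      have "s * (x - y) = 1/2" using that by (simp add: s_def)
      moreover have "e_fun s x = e_fun s (x - y) * e_fun s y"
        using e_fun_add[of "x - y" y s] by (simp add: e_fun_commute[of s])
      moreover have "e_fun s (x - y) = - 1"
        unfolding e_fun_def \<open>s * (x - y) = 1/2\<close> by (simp add: mult.commute)
      ultimately have "e_fun s x = - e_fun s y" by simp
      moreover have "e_fun s y \<noteq> 0" using cmod_e_fun[of s y] by force
      ultimately have "e_fun s x \<noteq> e_fun s y" by simp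
      then have "Re (e_fun s x) \<noteq> Re (e_fun s y) \<or> Im (e_fun s x) \<noteq> Im (e_fun s y)"
        by (simp add: complex_eq_iff)
      then show ?thesis
      proof
        assume "Re (e_fun s x) \<noteq> Re (e_fun s y)"
        then show ?thesis using Re[of s] by (intro exI[of _ "\<lambda>x. Re (e_fun s x)"]) simp
      next
        assume "Im (e_fun s x) \<noteq> Im (e_fun s y)"
        then show ?thesis using Im[of s] by (intro exI[of _ "\<lambda>x. Im (e_fun s x)"]) simp
      qed
    qed
  qed (use assms in auto)
  then show ?thesis using that by blast
qed

context
  fixes M :: "real measure" and \<Gamma> :: "real set" and R :: real
  assumes M: "borel_prob_measure M" and supp: "AE x in M. \<bar>x\<bar> \<le> R"
    and exps: "\<And>t. e_fun t \<in> L2_closed_span M \<Gamma> e_fun"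
begin

interpretation prob_space M by (rule borel_prob_measureD[OF M])

lemma sets_M [measurable_cong]: "sets M = sets borel" by (rule borel_prob_measureD[OF M])

lemma e_fun_L2: "e_fun t \<in> L2_space M"
proof -
  have "e_fun t \<in> borel_measurable M" by measurable
  then show ?thesis by (simp add: L2_space_def)
qed

lemma L2_bounded: "f \<in> borel_measurable borel \<Longrightarrow> (\<And>x. cmod (f x) \<le> K) \<Longrightarrow> f \<in> L2_space M"
  by (auto simp: L2_space_def measurable_cong_sets[OF sets_M refl]
      intro!: integrable_const_bound[of _ "K\<^sup>2"] AE_I2 power_mono)

lemma trig_polys_span: "f \<in> trig_polys \<Longrightarrow> f \<in> L2_closed_span M \<Gamma> e_fun"
  by (induction rule: trig_polys.induct) (auto intro: exps e_fun_L2 L2_closed_span_add L2_closed_span_scale)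

lemma continuous_span:
  fixes f :: "real \<Rightarrow> real"
  assumes f: "continuous_on UNIV f" "\<And>x. \<bar>f x\<bar> \<le> K"
  shows "(\<lambda>x. complex_of_real (f x)) \<in> L2_closed_span M \<Gamma> e_fun"
proof (rule L2_closed_span_limit[OF e_fun_L2])
  have [measurable]: "f \<in> borel_measurable borel" using f by (simp add: borel_measurable_continuous_onI)
  show L2: "(\<lambda>x. complex_of_real (f x)) \<in> L2_space M" by (rule L2_bounded[of _ K]) (use f in auto)
  fix \<epsilon> :: real assume "\<epsilon> > 0"
  \<comment> \<open>Uniform approximation on [-R, R] controls the integral because the measure lives
    there and has mass 1; the squared error is at most \<epsilon> / 2.\<close>
  then have "sqrt (\<epsilon> / 2) > 0" by simp
  then obtain g where g: "(\<lambda>x. complex_of_real (g x)) \<in> trig_polys" "\<And>x. x \<in> {-R..R} \<Longrightarrow> \<bar>f x - g x\<bar> < sqrt (\<epsilon> / 2)"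
    using trig_polys_dense[of "{-R..R}" f "sqrt (\<epsilon> / 2)"] f(1) by (auto intro: continuous_on_subset)
  have gL2: "(\<lambda>x. complex_of_real (g x)) \<in> L2_closed_span M \<Gamma> e_fun" by (rule trig_polys_span[OF g(1)])
  then have "(\<lambda>x. complex_of_real (f x) - of_real (g x)) \<in> L2_space M"
    using L2 by (intro L2_space_diff) (auto simp: L2_closed_span_def)
  then have "L2_sq M (\<lambda>x. of_real (f x) - of_real (g x)) \<le> (\<integral>x. \<epsilon> / 2 \<partial>M)"
  proof (intro integral_mono_AE)
    show "AE x in M. (cmod (of_real (f x) - of_real (g x)))\<^sup>2 \<le> \<epsilon> / 2"
      using supp
    proof eventually_elim
      case (elim x)
      then have "\<bar>f x - g x\<bar> \<le> sqrt (\<epsilon> / 2)" using g(2)[of x] by (intro less_imp_le) (auto simp: abs_le_iff)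
      then have "\<bar>f x - g x\<bar>\<^sup>2 \<le> (sqrt (\<epsilon> / 2))\<^sup>2" by (intro power_mono) auto
      then show ?case using \<open>\<epsilon> > 0\<close> by (simp flip: of_real_diff)
    qed
  qed (auto simp: L2_space_def)
  then have "L2_sq M (\<lambda>x. of_real (f x) - of_real (g x)) < \<epsilon>"
    using \<open>\<epsilon> > 0\<close> by (simp add: prob_space)
  then show "\<exists>h\<in>L2_closed_span M \<Gamma> e_fun. L2_sq M (\<lambda>x. complex_of_real (f x) - h x) < \<epsilon>"
    using gL2 by (intro bexI[of _ "\<lambda>x. complex_of_real (g x)"])
qed

lemma indicator_atMost_span: "(\<lambda>x. indicator {..a} x :: complex) \<in> L2_closed_span M \<Gamma> e_fun"
proof (rule L2_closed_span_dominated[OF e_fun_L2])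
  \<comment> \<open>Continuous ramps that are 1 up to \<open>a\<close> and fall to 0 at a +
    1/n.\<close>
  define h where "h n x = max 0 (min 1 (1 - real n * (x - a)))" for n :: nat and x :: real
  show "(\<lambda>x. complex_of_real (h n x)) \<in> L2_closed_span M \<Gamma> e_fun" for n
    by (rule continuous_span[of _ 1]) (auto simp: h_def intro!: continuous_intros)
  have "(\<lambda>n. h n x) \<longlonglongrightarrow> indicator {..a} x" for x
  proof (cases "x \<le> a")
    case True
    have "h n x = 1" for n
    proof -
      have "real n * (x - a) \<le> 0" using True by (intro mult_nonneg_nonpos) auto
      then show ?thesis by (simp add: h_def)
    qed
    then show ?thesis using True by simp
  next
    case False
    obtain m where m: "1 < real m * (x - a)" using reals_Archimedean3[of "x - a"] False by auto
    have "h n x = 0" if "n \<ge> m" for n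
    proof -
      have "real m * (x - a) \<le> real n * (x - a)" using that False by (intro mult_right_mono) auto
      then show ?thesis using m by (simp add: h_def)
    qed
    then have "\<forall>\<^sub>F n in sequentially. h n x = indicator {..a} x"
      using False by (auto simp: eventually_sequentially)
    then show ?thesis by (rule tendsto_eventually)
  qed
  then show "AE x in M. (\<lambda>n. complex_of_real (h n x)) \<longlonglongrightarrow> indicator {..a} x"
  proof (intro AE_I2)
    fix x
    have "(\<lambda>n. complex_of_real (h n x)) \<longlonglongrightarrow> of_real (indicator {..a} x)"
      by (rule tendsto_of_real) fact
    then show "(\<lambda>n. complex_of_real (h n x)) \<longlonglongrightarrow> indicator {..a} x"
      by (simp only: of_real_indicator)
  qed
  show "AE x in M. (cmod (indicator {..a} x - complex_of_real (h n x)))\<^sup>2 \<le> 1" for n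
  proof (intro AE_I2)
    fix x
    have "cmod (indicator {..a} x - complex_of_real (h n x)) = \<bar>indicator {..a} x - h n x\<bar>"
      using norm_of_real[of "indicator {..a} x - h n x", where 'a = complex] by (simp only: of_real_diff of_real_indicator)
    also have "\<dots> \<le> 1" by (auto simp: h_def indicator_def)
    finally have "cmod (indicator {..a} x - complex_of_real (h n x)) \<le> 1" .
    then show "(cmod (indicator {..a} x - complex_of_real (h n x)))\<^sup>2 \<le> 1"
      by (simp add: power_le_one)
  qed
qed (auto intro: L2_bounded[of _ 1] simp: indicator_def)

text \<open>Dynkin's theorem, started from half-lines: the closed span visibly contains complements
  and countable disjoint unions, but its closure under products is not at hand.\<close>

lemma indicator_span:
  assumes "A \<in> sets borel"
  shows "(\<lambda>x. indicator A x :: complex) \<in> L2_closed_span M \<Gamma> e_fun"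
proof -
  let ?G = "range (\<lambda>a. {..a::real})"
  have A: "A \<in> sigma_sets UNIV ?G" using assms by (simp add: borel_eq_atMost sets_measure_of)
  have borel: "A \<in> sets borel" if "A \<in> sigma_sets UNIV ?G" for A
    using that by (simp add: borel_eq_atMost sets_measure_of)
  have "Int_stable ?G" "?G \<subseteq> Pow UNIV" by (auto simp: Int_stable_def)
  from this A show ?thesis
  proof (induction rule: sigma_sets_induct_disjoint)
    case (basic A)
    then show ?case using indicator_atMost_span by auto
  next
    case empty
    show ?case using L2_closed_span_0[OF e_fun_L2, of \<Gamma>] by simp
  next
    case (compl A)
    have "(\<lambda>x. e_fun 0 x + (- 1) * indicator A x) \<in> L2_closed_span M \<Gamma> e_fun"
      by (intro L2_closed_span_add L2_closed_span_scale e_fun_L2 exps compl)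
    also have "(\<lambda>x. e_fun 0 x + (- 1) * indicator A x) = indicator (UNIV - A)"
      by (auto simp: fun_eq_iff indicator_def)
    finally show ?case .
  next
    case (union A)
    show ?case
    proof (rule L2_closed_span_dominated[OF e_fun_L2])
      show "(\<lambda>x. \<Sum>i<n. indicator (A i) x :: complex) \<in> L2_closed_span M \<Gamma> e_fun" for n
        by (intro L2_closed_span_sum e_fun_L2 union)
      have *: "(\<Sum>i<n. indicator (A i) x :: complex) = indicator (\<Union>i<n. A i) x" for n x
        using union(1) by (intro indicator_UN_disjoint[symmetric]) (auto simp: disjoint_family_on_def)
      show "AE x in M. (\<lambda>n. \<Sum>i<n. indicator (A i) x :: complex) \<longlonglongrightarrow> indicator (\<Union>i. A i) x"
        unfolding * by (intro AE_I2 LIMSEQ_indicator_UN)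
      show "AE x in M. (cmod (indicator (\<Union>i. A i) x - (\<Sum>i<n. indicator (A i) x)))\<^sup>2 \<le> 1" for n
        unfolding * by (intro AE_I2) (auto simp: indicator_def)
      have "(\<Union>i. A i) \<in> sets borel" using union borel by (intro sets.countable_UN) auto
      then show "indicator (\<Union>i. A i) \<in> L2_space M"
        by (intro L2_bounded[of _ 1]) (auto simp: indicator_def)
    qed auto
  qed
qed

lemma L2_span: assumes f: "f \<in> L2_space M" shows "f \<in> L2_closed_span M \<Gamma> e_fun"
proof -
  have fm: "f \<in> borel_measurable M" using f by (simp add: L2_space_def)
  obtain s where s: "\<And>i. simple_function M (s i)" "\<And>x. x \<in> space M \<Longrightarrow> (\<lambda>i. s i x) \<longlonglongrightarrow> f x"
    "\<And>i x. x \<in> space M \<Longrightarrow> dist (s i x) 0 \<le> 2 * dist (f x) 0"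
    using borel_measurable_implies_sequence_metric[OF fm, of 0] by blast
  show ?thesis
  proof (rule L2_closed_span_dominated[OF e_fun_L2])
    show "s n \<in> L2_closed_span M \<Gamma> e_fun" for n
    proof -
      have fin: "finite (range (s n))" using s(1)[of n] borel_prob_measureD(3)[OF M] by (simp add: simple_function_def)
      have "(\<lambda>x. \<Sum>v\<in>range (s n). v * indicator (s n -` {v}) x) \<in> L2_closed_span M \<Gamma> e_fun"
      proof (intro L2_closed_span_sum L2_closed_span_scale e_fun_L2 indicator_span)
        fix v assume "v \<in> range (s n)"
        then show "s n -` {v} \<in> sets borel"
          using simple_functionD(2)[OF s(1)[of n], of "{v}"] borel_prob_measureD[OF M] by simp
      qed
      also have "(\<lambda>x. \<Sum>v\<in>range (s n). v * indicator (s n -` {v}) x) = s n"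
        using fin by (auto simp: fun_eq_iff indicator_def if_distrib[of "\<lambda>z. _ * z"] sum.delta cong: if_cong)
      finally show ?thesis .
    qed
    show "AE x in M. (\<lambda>n. s n x) \<longlonglongrightarrow> f x" using s by auto
    \<comment> \<open>The simple functions satisfy |s_n| <= 2 |f|, so |f - s_n| <= 3 |f|, whence
      9.\<close>
    show "integrable M (\<lambda>x. 9 * (cmod (f x))\<^sup>2)" using f by (simp add: L2_space_def)
    show "AE x in M. (cmod (f x - s n x))\<^sup>2 \<le> 9 * (cmod (f x))\<^sup>2" for n
    proof (intro AE_I2)
      fix x assume "x \<in> space M"
      then have "cmod (f x - s n x) \<le> 3 * cmod (f x)"
        using s(3)[of x n] norm_triangle_ineq4[of "f x" "s n x"] by simp
      then have "(cmod (f x - s n x))\<^sup>2 \<le> (3 * cmod (f x))\<^sup>2" by (intro power_mono) auto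
      then show "(cmod (f x - s n x))\<^sup>2 \<le> 9 * (cmod (f x))\<^sup>2" by (simp add: power_mult_distrib)
    qed
  qed (rule f)
qed

end

lemma (in hadamard_measure) e_fun_measurable: "e_fun t \<in> borel_measurable \<mu>"
  using measurable_e_fun by (simp add: measurable_cong_sets[OF sets_mu refl])

text \<open>Q(- t) = 1 is Parseval's identity for \<open>e_fun t\<close>: the squared distance to
  the span of finitely many exponentials is 1 minus a partial sum of Q(- t).\<close>

lemma (in hadamard_measure) e_fun_in_closed_span: "e_fun t \<in> L2_closed_span \<mu> \<Lambda> e_fun"
proof -
  have L2: "e_fun t \<in> L2_space \<mu>" using e_fun_measurable by (simp add: L2_space_def)
  have "\<exists>F c. finite F \<and> F \<subseteq> \<Lambda> \<and> L2_sq \<mu> (\<lambda>x. e_fun t x - (\<Sum>i\<in>F. c i * e_fun i x)) < \<epsilon>"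
    if "\<epsilon> > 0" for \<epsilon>
  proof -
    have "\<epsilon> / 2 > 0" using that by simp
    from has_sum_finite_approximation[OF Q_has_sum[of "- t"] this]
    obtain F where F: "finite F" "F \<subseteq> \<Lambda>"
      "dist (\<Sum>y\<in>F. (cmod (ftrans \<mu> (of_real (- t + y))))\<^sup>2) 1 \<le> \<epsilon> / 2"
      by (auto simp: Q_eq_1)
    have inner: "(cmod (L2_inner \<mu> (e_fun t) (e_fun y)))\<^sup>2 = (cmod (ftrans \<mu> (of_real (- t + y))))\<^sup>2" for y
    proof -
      have "ftrans \<mu> (of_real (t - y)) = cnj (ftrans \<mu> (of_real (- t + y)))" by (simp add: cnj_ftrans)
      then show ?thesis unfolding L2_inner_e_fun by simp
    qed
    have "L2_sq \<mu> (\<lambda>x. e_fun t x - (\<Sum>i\<in>F. L2_inner \<mu> (e_fun t) (e_fun i) * e_fun i x))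
      = L2_sq \<mu> (\<lambda>x. e_fun t x) - (\<Sum>i\<in>F. (cmod (L2_inner \<mu> (e_fun t) (e_fun i)))\<^sup>2)"
      using F orthonormal e_fun_measurable
      by (intro L2_norm_diff_projection prob_space_axioms L2) (auto simp: subset_iff)
    also have "L2_sq \<mu> (\<lambda>x. e_fun t x) = 1" by (simp add: prob_space)
    also have "1 - (\<Sum>i\<in>F. (cmod (L2_inner \<mu> (e_fun t) (e_fun i)))\<^sup>2) < \<epsilon>"
      using F(3) that unfolding inner dist_real_def by linarith
    finally show ?thesis using F(1,2) by (intro exI[of _ F] exI[of _ "\<lambda>i. L2_inner \<mu> (e_fun t) (e_fun i)"] conjI)
  qed
  then show ?thesis using L2 by (simp add: L2_closed_span_def)
qed

theorem (in hadamard_measure) spectral_pair_canonical: "spectral_pair \<mu> \<Lambda>"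
proof -
  obtain R where "AE x in \<mu>. \<bar>x\<bar> \<le> R" by (rule bounded_support)
  note dense = L2_span[OF borel_prob this e_fun_in_closed_span]
  have "\<exists>F c. finite F \<and> F \<subseteq> \<Lambda> \<and> L2_norm \<mu> (\<lambda>x. f x - (\<Sum>i\<in>F. c i * e_fun i x)) < \<epsilon>"
    if f: "f \<in> L2_space \<mu>" "\<epsilon> > 0" for f \<epsilon>
  proof -
    have "\<epsilon>\<^sup>2 > 0" using f by simp
    then obtain F c where "finite F" "F \<subseteq> \<Lambda>" "L2_sq \<mu> (\<lambda>x. f x - (\<Sum>i\<in>F. c i * e_fun i x)) < \<epsilon>\<^sup>2"
      using dense[OF f(1)] unfolding L2_closed_span_def by blast
    moreover from this(3) have "sqrt (L2_sq \<mu> (\<lambda>x. f x - (\<Sum>i\<in>F. c i * e_fun i x))) < \<epsilon>"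
      using real_sqrt_less_mono f(2) by fastforce
    ultimately show ?thesis unfolding L2_norm_def by blast
  qed
  then show ?thesis
    unfolding spectral_pair_def L2_orthonormal_basis_def
    using borel_prob countable_spectrum orthonormal e_fun_in_closed_span L2_closed_span_def by blast
qed

section \<open>Self-similar measures with a full set of digits\<close>

text \<open>Congruent digits would make (l - l') / N an integer, where m_B is 1 instead of
  0.\<close>

lemma hadamard_digits_distinct:
  assumes "hadamard_triple N B L" "l \<in> L" "l' \<in> L" "[l = l'] (mod int N)"
  shows "l = l'"
proof (rule ccontr)
  assume "l \<noteq> l'"
  obtain k where k: "l - l' = int N * k" using assms(4) by (auto simp: cong_iff_dvd_diff dvd_def)
  have N: "N > 0" "card B > 0" using assms(1) by (auto simp: hadamard_triple_def)
  have "m_fun B (of_int (l - l') / N) = m_fun B (0 + of_int k)"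
    unfolding k using N by simp
  also have "\<dots> = m_fun B 0" by (rule m_fun_periodic) (metis Ints_of_int of_int_mult)
  also have "\<dots> = 1" using assms(1) by (intro m_fun_0) (auto simp: hadamard_triple_def)
  finally show False using m_fun_hadamard(1)[OF assms(1-3) \<open>l \<noteq> l'\<close>] by simp
qed

lemma hadamard_card_le:
  assumes "hadamard_triple N B L"
  shows "card L \<le> N"
proof -
  have "inj_on (\<lambda>l. l mod int N) L"
    using hadamard_digits_distinct[OF assms] by (auto simp: inj_on_def cong_def)
  then have "card L = card ((\<lambda>l. l mod int N) ` L)" by (simp add: card_image)
  also have "\<dots> \<le> card {0..<int N}"
    using assms by (intro card_mono) (auto simp: hadamard_triple_def)
  finally show ?thesis by simp
qed

text \<open>With \<open>N\<close> digits in distinct residue classes, the integers \<open>\<Sum> b\<^sub>i N\<^sup>i\<close> are distinct, so that \<open>k\<close>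
  applications of the invariance equation spread an \<open>N\<close>-adic interval of level \<open>k\<close> over disjoint unit intervals.\<close>

fun digit_sums :: "nat \<Rightarrow> int set \<Rightarrow> nat \<Rightarrow> int set" where
  "digit_sums N B 0 = {0}"
| "digit_sums N B (Suc k) = (\<lambda>(w, b). int N * w + b) ` (digit_sums N B k \<times> B)"

lemma finite_digit_sums: "finite B \<Longrightarrow> finite (digit_sums N B k)"
  by (induction k) auto

lemma self_similar_iterate:
  assumes ss: "is_self_similar_measure N B \<mu>" and B: "finite B" "card B = N" "N \<ge> 2"
    and distinct: "\<And>b b'. b \<in> B \<Longrightarrow> b' \<in> B \<Longrightarrow> [b = b'] (mod int N) \<Longrightarrow> b = b'"
    and A: "A \<in> sets borel"
  shows "measure \<mu> A = (\<Sum>w\<in>digit_sums N B k. measure \<mu> {x. (x + of_int w) / real N ^ k \<in> A}) / real N ^ k"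
proof (induction k)
  case (Suc k)
  let ?S = "\<lambda>k w. {x. (x + of_int w) / real N ^ k \<in> A}"
  have S: "?S k w \<in> sets borel" for w
  proof -
    have "(\<lambda>x. (x + of_int w) / real N ^ k) \<in> borel_measurable borel" by simp
    from measurable_sets[OF this A] show ?thesis by (simp add: vimage_def)
  qed
  have step: "measure \<mu> (?S k w) = (\<Sum>b\<in>B. measure \<mu> (?S (Suc k) (int N * w + b))) / N" for w
  proof -
    have "tau N b -` ?S k w = ?S (Suc k) (int N * w + b)" for b
    proof -
      have "(tau N b x + of_int w) / real N ^ k = (x + of_int (int N * w + b)) / real N ^ Suc k" for x
        using B by (simp add: tau_def field_simps)
      then show ?thesis by auto
    qed
    then show ?thesis
      using ss S[of w] B unfolding is_self_similar_measure_def by simp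
  qed
  have inj: "inj_on (\<lambda>(w, b). int N * w + b) (digit_sums N B k \<times> B)"
  proof (rule inj_onI, clarify)
    fix w b w' b' assume b: "b \<in> B" "b' \<in> B" and eq: "int N * w + b = int N * w' + b'"
    then have "b - b' = int N * (w' - w)" by (simp add: algebra_simps)
    then have "b = b'" using distinct[OF b] by (simp add: cong_iff_dvd_diff)
    then show "w = w' \<and> b = b'" using eq B by simp
  qed
  have "measure \<mu> A = (\<Sum>w\<in>digit_sums N B k. \<Sum>b\<in>B. measure \<mu> (?S (Suc k) (int N * w + b))) / N / real N ^ k"
    unfolding Suc.IH step by (simp add: sum_divide_distrib)
  also have "(\<Sum>w\<in>digit_sums N B k. \<Sum>b\<in>B. measure \<mu> (?S (Suc k) (int N * w + b)))
     = (\<Sum>w\<in>digit_sums N B (Suc k). measure \<mu> (?S (Suc k) w))"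
    unfolding digit_sums.simps sum.reindex[OF inj] by (simp add: sum.cartesian_product case_prod_unfold)
  finally show ?case by simp
qed simp

lemma full_digits_interval_le:
  assumes ss: "is_self_similar_measure N B \<mu>" and B: "finite B" "card B = N" "N \<ge> 2"
    and distinct: "\<And>b b'. b \<in> B \<Longrightarrow> b' \<in> B \<Longrightarrow> [b = b'] (mod int N) \<Longrightarrow> b = b'"
  shows "measure \<mu> {x. \<lfloor>x * real N ^ k\<rfloor> = j} \<le> 1 / real N ^ k"
proof -
  have bp: "borel_prob_measure \<mu>" using ss by (simp add: is_self_similar_measure_def)
  interpret prob_space \<mu> by (rule borel_prob_measureD[OF bp])
  have sets: "sets \<mu> = sets borel" by (rule borel_prob_measureD[OF bp])
  have "{x. \<lfloor>x * real N ^ k\<rfloor> = j} \<in> sets borel" by measurable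
  note self_similar_iterate[OF ss B distinct this, of k]
  also have "(\<Sum>w\<in>digit_sums N B k. measure \<mu> {x. (x + of_int w) / real N ^ k \<in> {x. \<lfloor>x * real N ^ k\<rfloor> = j}})
     = (\<Sum>w\<in>digit_sums N B k. measure \<mu> {x. \<lfloor>x\<rfloor> = j - w})"
    using B by (intro sum.cong refl arg_cong[of _ _ "measure \<mu>"]) auto
  also have "\<dots> = measure \<mu> (\<Union>w\<in>digit_sums N B k. {x. \<lfloor>x\<rfloor> = j - w})"
  proof (rule finite_measure_finite_Union[symmetric])
    show "(\<lambda>w. {x::real. \<lfloor>x\<rfloor> = j - w}) ` digit_sums N B k \<subseteq> events"
      unfolding sets by auto
  qed (auto simp: disjoint_family_on_def finite_digit_sums B)
  also have "\<dots> / real N ^ k \<le> 1 / real N ^ k" by (intro divide_right_mono) auto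
  finally show ?thesis .
qed

text \<open>The N-adic intervals of level k contained in \<open>U\<close> satisfy the inequality,
  and their unions increase to \<open>U\<close>. For open sets this domination is all that is
  needed, by outer regularity of Lebesgue measure.\<close>

lemma full_digits_open_le:
  assumes ss: "is_self_similar_measure N B \<mu>" and B: "finite B" "card B = N" "N \<ge> 2"
    and distinct: "\<And>b b'. b \<in> B \<Longrightarrow> b' \<in> B \<Longrightarrow> [b = b'] (mod int N) \<Longrightarrow> b = b'"
    and U: "open U"
  shows "emeasure \<mu> U \<le> emeasure lborel U"
proof -
  have bp: "borel_prob_measure \<mu>" using ss by (simp add: is_self_similar_measure_def)
  interpret prob_space \<mu> by (rule borel_prob_measureD[OF bp])
  have sets: "sets \<mu> = sets borel" by (rule borel_prob_measureD[OF bp])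
  define I where "I k j = {x. \<lfloor>x * real N ^ k\<rfloor> = j}" for k :: nat and j :: int
  define V where "V k = (\<Union>j\<in>{j. I k j \<subseteq> U}. I k j)" for k
  have I [measurable]: "I k j \<in> sets borel" for k j unfolding I_def by measurable
  have V [measurable]: "V k \<in> sets borel" for k
    unfolding V_def by (intro sets.countable_UN'') auto
  have disj: "disjoint_family_on (I k) J" for k J
    by (auto simp: disjoint_family_on_def I_def)
  have lebI: "emeasure lborel (I k j) = ennreal (1 / real N ^ k)" for k j
  proof -
    have "I k j = {of_int j / real N ^ k ..< (of_int j + 1) / real N ^ k}"
      using B by (auto simp: I_def floor_eq_iff field_simps)
    then show ?thesis using B by (simp add: divide_right_mono diff_divide_distrib[symmetric])
  qed
  have le: "emeasure \<mu> (V k) \<le> emeasure lborel U" for k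
  proof -
    have "emeasure \<mu> (V k) = (\<integral>\<^sup>+ j. emeasure \<mu> (I k j) \<partial>count_space {j. I k j \<subseteq> U})"
      unfolding V_def by (intro emeasure_UN_countable disj) (auto simp: sets)
    also have "\<dots> \<le> (\<integral>\<^sup>+ j. emeasure lborel (I k j) \<partial>count_space {j. I k j \<subseteq> U})"
      using full_digits_interval_le[OF ss B distinct, folded I_def]
      by (intro nn_integral_mono) (simp add: lebI emeasure_eq_measure I_def[symmetric] ennreal_leI)
    also have "\<dots> = emeasure lborel (V k)"
      unfolding V_def by (intro emeasure_UN_countable[symmetric] disj) auto
    also have "\<dots> \<le> emeasure lborel U"
      using U by (intro emeasure_mono) (auto simp: V_def)
    finally show ?thesis .
  qed
  have "incseq V"
  proof (rule incseq_SucI)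
    fix k show "V k \<subseteq> V (Suc k)"
    proof
      fix x assume "x \<in> V k"
      then have sub: "I k \<lfloor>x * real N ^ k\<rfloor> \<subseteq> U" by (auto simp: V_def I_def)
      \<comment> \<open>The index of the interval at level k is determined by the one at level k +
        1, so the intervals are nested.\<close>
      have fl: "\<lfloor>y * real N ^ k\<rfloor> = \<lfloor>y * real N ^ Suc k\<rfloor> div int N" for y
        using floor_divide_real_eq_div[of "int N" "y * real N ^ Suc k"] B by simp
      have "I (Suc k) \<lfloor>x * real N ^ Suc k\<rfloor> \<subseteq> I k \<lfloor>x * real N ^ k\<rfloor>"
        unfolding I_def fl by auto
      then show "x \<in> V (Suc k)" using sub unfolding V_def by (auto simp: I_def)
    qed
  qed
  have "U \<subseteq> (\<Union>k. V k)"
  proof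
    fix x assume "x \<in> U"
    then obtain e where e: "e > 0" "ball x e \<subseteq> U" using U open_contains_ball by blast
    obtain k where k: "1 / e < real N ^ k" using real_arch_pow[of "real N" "1 / e"] B by auto
    have "I k \<lfloor>x * real N ^ k\<rfloor> \<subseteq> ball x e"
    proof
      fix y assume "y \<in> I k \<lfloor>x * real N ^ k\<rfloor>"
      then have "\<bar>(x - y) * real N ^ k\<bar> < 1"
        unfolding I_def left_diff_distrib by (simp add: abs_less_iff) linarith
      then have "\<bar>x - y\<bar> < 1 / real N ^ k"
        unfolding abs_mult using B by (simp add: pos_less_divide_eq)
      also have "\<dots> < e" using k e B by (simp add: field_simps)
      finally show "y \<in> ball x e" by (simp add: dist_real_def)
    qed
    then show "x \<in> (\<Union>k. V k)" using e unfolding V_def I_def by blast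
  qed
  then have "emeasure \<mu> U \<le> emeasure \<mu> (\<Union>k. V k)"
    using V by (intro emeasure_mono) (auto simp: sets)
  also have "\<dots> = (SUP k. emeasure \<mu> (V k))"
    using \<open>incseq V\<close> by (intro SUP_emeasure_incseq[symmetric]) (auto simp: sets)
  also have "\<dots> \<le> emeasure lborel U" by (rule SUP_least) (rule le)
  finally show ?thesis .
qed

text \<open>With N digits, distinct modulo N by the transposed triple, the measure is dominated by
  Lebesgue measure on open sets. A Lebesgue null set of full \<open>\<mu>\<close>-measure has an
  open neighbourhood of Lebesgue measure below 1, a contradiction.\<close>

theorem singular_imp_few_digits:
  assumes H: "hadamard_triple N B L" and ss: "is_self_similar_measure N B \<mu>" and sing: "singular_continuous \<mu>"
  shows "card L < N"
proof (rule ccontr)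
  assume "\<not> card L < N"
  have H': "hadamard_triple N L B" using H by (simp add: hadamard_transpose)
  have B: "finite B" "card B = N" "N \<ge> 2"
    using H \<open>\<not> card L < N\<close> hadamard_card_le[OF H] by (auto simp: hadamard_triple_def)
  have bp: "borel_prob_measure \<mu>" using ss by (simp add: is_self_similar_measure_def)
  interpret prob_space \<mu> by (rule borel_prob_measureD[OF bp])
  have sets: "sets \<mu> = sets borel" "space \<mu> = UNIV" by (rule borel_prob_measureD[OF bp])+
  obtain S where S: "S \<in> sets borel" "emeasure lborel S = 0" "emeasure \<mu> (- S) = 0"
    using sing unfolding singular_continuous_def by blast
  obtain U where U: "open U" "S \<subseteq> U" "emeasure lborel (U - S) < 1"
    using outer_regular_lborel[OF S(1), of 1] by auto
  have "emeasure \<mu> S = 1"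
  proof -
    have "emeasure \<mu> S = emeasure \<mu> (space \<mu> - (- S))" by (simp add: sets)
    also have "\<dots> = 1" using S sets emeasure_compl[of "- S" \<mu>] emeasure_space_1 by simp
    finally show ?thesis .
  qed
  then have "1 = emeasure \<mu> S" by simp
  also have "\<dots> \<le> emeasure \<mu> U" using U by (intro emeasure_mono) (auto simp: sets)
  also have "\<dots> \<le> emeasure lborel U"
    using hadamard_digits_distinct[OF H'] by (intro full_digits_open_le[OF ss B] U) auto
  also have "\<dots> = emeasure lborel ((U - S) \<union> S)" using U by (intro arg_cong[of _ _ "emeasure lborel"]) auto
  also have "\<dots> \<le> emeasure lborel (U - S) + emeasure lborel S"
    using U S by (intro emeasure_subadditive) auto
  also have "\<dots> < 1" using U S by simp
  finally show False by simp
qed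

section \<open>Galois conjugation of vanishing sums of roots of unity\<close>

text \<open>Elements of the ring \<int>[z] are represented by integer polynomials, so that
  divisibility by p in this ring becomes the existence of a polynomial.\<close>

definition ceval :: "int poly \<Rightarrow> complex \<Rightarrow> complex" where
  "ceval f z = poly (map_poly of_int f) z"

lemma ceval_0 [simp]: "ceval 0 z = 0"
  by (simp add: ceval_def)

lemma ceval_pCons: "ceval (pCons a f) z = of_int a + z * ceval f z"
  by (simp add: ceval_def map_poly_pCons)

lemma ceval_add: "ceval (f + g) z = ceval f z + ceval g z"
proof -
  have "map_poly of_int (f + g) = map_poly of_int f + (map_poly of_int g :: complex poly)"
    by (simp add: poly_eq_iff coeff_map_poly)
  then show ?thesis by (simp add: ceval_def)
qed

lemma ceval_smult: "ceval (Polynomial.smult a f) z = of_int a * ceval f z"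
proof -
  have "map_poly of_int (Polynomial.smult a f) = Polynomial.smult (of_int a) (map_poly of_int f :: complex poly)"
    by (simp add: poly_eq_iff coeff_map_poly)
  then show ?thesis by (simp add: ceval_def)
qed

lemma ceval_diff: "ceval (f - g) z = ceval f z - ceval g z"
  using ceval_add[of "f - g" g z] by simp

lemma ceval_mult: "ceval (f * g) z = ceval f z * ceval g z"
  by (induction f) (simp_all add: ceval_add ceval_smult ceval_pCons mult_pCons_left algebra_simps)

lemma ceval_1 [simp]: "ceval 1 z = 1"
  by (simp add: ceval_def one_pCons map_poly_pCons)

lemma ceval_power: "ceval (f ^ n) z = ceval f z ^ n"
  by (induction n) (simp_all add: ceval_mult)

lemma ceval_monom: "ceval (Polynomial.monom a n) z = of_int a * z ^ n"
  by (simp add: ceval_def map_poly_monom poly_monom)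

lemma ceval_sum: "ceval (\<Sum>i\<in>A. f i) z = (\<Sum>i\<in>A. ceval (f i) z)"
  by (induction A rule: infinite_finite_induct) (simp_all add: ceval_add)

text \<open>The congruence f(z)^p = f(z^p) modulo p \<int>[z], by induction on coefficients: the
  inner binomial coefficients are divisible by p, and the constant term is treated by Fermat's
  theorem.\<close>

lemma ceval_frobenius:
  assumes "prime p"
  obtains s where "ceval f z ^ p = ceval f (z ^ p) + of_nat p * ceval s z"
proof -
  have "\<exists>s. ceval f z ^ p = ceval f (z ^ p) + of_nat p * ceval s z"
  proof (induction f)
    case 0
    then show ?case using assms prime_gt_0_nat by (intro exI[of _ 0]) (simp add: zero_power)
  next
    case (pCons a f)
    then obtain s where s: "ceval f z ^ p = ceval f (z ^ p) + of_nat p * ceval s z" by blast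
    have p: "p > 0" using assms prime_gt_0_nat by simp
    have "[a ^ p = a] (mod int p)"
    proof (cases "int p dvd a")
      case True
      then have "int p dvd a ^ p" using p by (metis dvd_power_same dvd_trans dvd_power)
      then show ?thesis using True by (simp add: cong_def dvd_imp_mod_0)
    next
      case False
      define c where "c = nat (a mod int p)"
      have c: "int c = a mod int p" using p by (simp add: c_def)
      have "\<not> p dvd c" using False by (simp add: c dvd_mod_iff flip: int_dvd_int_iff)
      from fermat_theorem[OF assms this] have "[int c ^ (p - 1) = 1] (mod int p)"
        by (metis cong_int_iff of_nat_1 of_nat_power)
      moreover have "[a ^ (p - 1) = int c ^ (p - 1)] (mod int p)"
        unfolding c by (intro cong_pow) (simp add: cong_def)
      ultimately have "[a ^ (p - 1) * a = 1 * a] (mod int p)"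
        using cong_trans cong_scalar_right by blast
      moreover have "a ^ (p - 1) * a = a ^ p" using p by (simp flip: power_Suc2)
      ultimately show ?thesis by simp
    qed
    then obtain m where "a ^ p - a = int p * m" by (auto simp: cong_iff_dvd_diff dvd_def)
    then have "a ^ p = a + int p * m" by simp
    then have m: "(of_int a :: complex) ^ p = of_int a + of_nat p * of_int m"
      by (metis of_int_add of_int_mult of_int_of_nat_eq of_int_power)
    define G where "G = pCons 0 f"
    have G: "ceval G z = z * ceval f z" by (simp add: G_def ceval_pCons)
    have "\<exists>t. (\<Sum>k\<in>{1..<p}. of_nat (p choose k) * of_int a ^ k * ceval G z ^ (p - k)) = of_nat p * ceval t z"
    proof -
      have "of_nat (p choose k) * of_int a ^ k * ceval G z ^ (p - k)
        = of_nat p * ceval (Polynomial.smult (int ((p choose k) div p) * a ^ k) (G ^ (p - k))) z" if "k \<in> {1..<p}" for k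
      proof -
        have "p dvd (p choose k)" using that assms by (intro dvd_choose_prime) auto
        then have "p choose k = p * ((p choose k) div p)" by simp
        then have "(of_nat (p choose k) :: complex) = of_nat p * of_nat ((p choose k) div p)"
          by (metis of_nat_mult)
        then show ?thesis by (simp add: ceval_smult ceval_power)
      qed
      then have "(\<Sum>k\<in>{1..<p}. of_nat (p choose k) * of_int a ^ k * ceval G z ^ (p - k))
        = of_nat p * ceval (\<Sum>k\<in>{1..<p}. Polynomial.smult (int ((p choose k) div p) * a ^ k) (G ^ (p - k))) z"
        by (simp add: ceval_sum sum_distrib_left)
      then show ?thesis by blast
    qed
    then obtain t where t: "(\<Sum>k\<in>{1..<p}. of_nat (p choose k) * of_int a ^ k * ceval G z ^ (p - k)) = of_nat p * ceval t z"
      by blast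
    have "ceval (pCons a f) z ^ p = (of_int a + ceval G z) ^ p" by (simp add: ceval_pCons G)
    also have "\<dots> = (\<Sum>k\<le>p. of_nat (p choose k) * of_int a ^ k * ceval G z ^ (p - k))" by (rule binomial_ring)
    also have "{..p} = insert 0 (insert p {1..<p})" using p by auto
    also have "(\<Sum>k\<in>insert 0 (insert p {1..<p}). of_nat (p choose k) * of_int a ^ k * ceval G z ^ (p - k))
        = ceval G z ^ p + (of_int a ^ p + of_nat p * ceval t z)"
      using p t by simp
    also have "\<dots> = ceval (pCons a f) (z ^ p) + of_nat p * ceval ([:m:] + t + Polynomial.monom 1 p * s) z"
      by (simp add: ceval_pCons G power_mult_distrib s m ceval_add ceval_mult ceval_monom algebra_simps)
    finally show ?case by blast
  qed
  then show ?thesis using that by blast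
qed

text \<open>Taking the primitive part gives divisibility over the integers, not only over the
  rationals: pseudo-division yields a f = g q, and since \<open>g\<close> has content 1, Gauss's
  lemma lets \<open>a\<close> be cancelled from \<open>q\<close>.\<close>

lemma primitive_minimal_polynomial:
  assumes "f0 \<noteq> 0" "ceval f0 z = 0"
  obtains g where "g \<noteq> 0" "\<And>f. ceval f z = 0 \<longleftrightarrow> g dvd f"
    "\<And>f. ceval f z = 0 \<Longrightarrow> degree f < degree g \<Longrightarrow> f = 0"
proof -
  define P where "P f \<longleftrightarrow> f \<noteq> 0 \<and> ceval f z = 0" for f
  obtain g0 where g0: "P g0" "\<And>f. P f \<Longrightarrow> degree g0 \<le> degree f"
    using ex_has_least_nat[of P f0 degree] assms by (auto simp: P_def)
  define g where "g = primitive_part g0"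
  have eq: "g0 = Polynomial.smult (content g0) g" by (simp add: g_def)
  have g: "g \<noteq> 0" "ceval g z = 0" "degree g = degree g0" "content g = 1"
  proof -
    show "g \<noteq> 0" using g0 by (simp add: g_def P_def)
    have "content g0 \<noteq> 0" using g0 by (simp add: P_def)
    moreover have "ceval g0 z = of_int (content g0) * ceval g z"
      using arg_cong[OF eq, of "\<lambda>f. ceval f z"] by (simp only: ceval_smult)
    ultimately show "ceval g z = 0" using g0 by (simp add: P_def)
    show "degree g = degree g0" by (simp add: g_def)
    show "content g = 1" using g0 by (simp add: g_def P_def)
  qed
  have min: "f = 0" if "ceval f z = 0" "degree f < degree g" for f
    using g0(2)[of f] that g by (force simp: P_def)
  have "g dvd f" if "ceval f z = 0" for f
  proof -
    obtain a q where aq: "a \<noteq> 0" "Polynomial.smult a f = g * q + pseudo_mod f g"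
      using pseudo_mod(1)[OF g(1)] by blast
    have "ceval (pseudo_mod f g) z = 0"
      using arg_cong[OF aq(2), of "\<lambda>f. ceval f z"] that g(2) by (simp add: ceval_smult ceval_add ceval_mult)
    then have "pseudo_mod f g = 0" using pseudo_mod(2)[OF g(1), of f] min by blast
    then have eq: "Polynomial.smult a f = g * q" using aq by simp
    have "content (Polynomial.smult a f) = content q" unfolding eq content_mult using g by simp
    then have "a dvd content q" by (metis content_smult dvd_triv_left normalize_dvd_iff)
    then have "[:a:] dvd q" by (simp add: const_poly_dvd_iff_dvd_content)
    then obtain q' where "q = Polynomial.smult a q'" by (auto elim!: dvdE)
    then have "Polynomial.smult a (f - g * q') = 0" using eq by (simp add: smult_diff_right)
    then have "f = g * q'" using aq(1) by simp
    then show ?thesis by simp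
  qed
  moreover have "ceval f z = 0" if "g dvd f" for f
  proof -
    from that obtain k where "f = g * k" by (rule dvdE)
    then show ?thesis using g(2) by (simp add: ceval_mult)
  qed
  ultimately show ?thesis by (intro that[OF g(1) _ min] iffI)
qed

text \<open>Irreducibility of the cyclotomic polynomials in the form needed here. If \<open>g\<close> is the minimal polynomial
  of \<open>z\<close>, \<open>z\<^sup>N - 1 = g h\<close>, and \<open>z\<^sup>p\<close> were a root of \<open>h\<close>, then \<open>p\<close> would divide \<open>h(z)\<^sup>p\<close>, and hence \<open>N\<^sup>p\<close>,
  in \<open>\<int>[z]\<close>, because \<open>h(z)\<close> divides \<open>(g h)'(z) z = N\<close>.\<close>

lemma ceval_root_of_unity_prime_power:
  fixes N p :: nat
  assumes z: "z ^ N = 1" and N: "N > 0" and p: "prime p" "\<not> p dvd N" and f: "ceval f z = 0"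
  shows "ceval f (z ^ p) = 0"
proof -
  define X where "X = Polynomial.monom (1::int) N - 1"
  have X: "X \<noteq> 0" "lead_coeff X = 1" "ceval X w = w ^ N - 1" for w
  proof -
    have "degree X = N"
      using degree_add_eq_left[of "- 1" "Polynomial.monom (1::int) N"] N by (simp add: X_def degree_monom_eq)
    then show "lead_coeff X = 1" using N by (simp add: X_def)
    then show "X \<noteq> 0" by auto
    show "ceval X w = w ^ N - 1" by (simp add: X_def ceval_diff ceval_monom)
  qed
  obtain g where g: "g \<noteq> 0" "\<And>f. ceval f z = 0 \<longleftrightarrow> g dvd f"
    "\<And>f. ceval f z = 0 \<Longrightarrow> degree f < degree g \<Longrightarrow> f = 0"
    using primitive_minimal_polynomial[OF X(1), of z] z X(3) by auto
  have gz: "ceval g z = 0" using g(2) by simp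
  obtain h where h: "X = g * h" using g(2)[of X] z X(3) by (auto elim: dvdE)
  \<comment> \<open>A factor of the monic polynomial X^N - 1 is monic up to sign; hence
    pseudo-division by \<open>g\<close> below introduces only a unit \<open>a\<close>.\<close>
  have unit: "is_unit (lead_coeff g)"
    using X(2) unfolding h lead_coeff_mult by (metis dvd_triv_left)
  have deg: "degree g > 0"
  proof (rule ccontr)
    assume "\<not> degree g > 0"
    then obtain c where "g = [:c:]" by (auto elim: degree_eq_zeroE)
    then show False using gz g(1) by (simp add: ceval_pCons)
  qed
  have "ceval g (z ^ p) = 0"
  proof (rule ccontr)
    assume ne: "ceval g (z ^ p) \<noteq> 0"
    have "(z ^ p) ^ N = 1" using z by (metis mult.commute power_mult power_one)
    then have "ceval X (z ^ p) = 0" by (simp add: X(3))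
    then have "ceval h (z ^ p) = 0" using ne by (simp add: h ceval_mult)
    then obtain s where s: "ceval h z ^ p = of_nat p * ceval s z"
      using ceval_frobenius[OF p(1), of h z] by (metis add_0)
    have "of_nat N * z ^ (N - 1) = ceval (pderiv X) z"
      by (simp add: X_def pderiv_diff pderiv_monom ceval_monom ceval_diff)
    also have "\<dots> = ceval h z * ceval (pderiv g) z"
      by (simp add: h pderiv_mult ceval_add ceval_mult gz)
    finally have "of_nat N * (z * z ^ (N - 1)) = ceval h z * (z * ceval (pderiv g) z)" by simp
    also have "z * z ^ (N - 1) = 1" using z N by (simp flip: power_Suc)
    finally have "of_nat N = ceval h z * ceval (Polynomial.monom 1 1 * pderiv g) z" by (simp add: ceval_mult ceval_monom)
    then have "of_nat N ^ p = ceval h z ^ p * ceval (Polynomial.monom 1 1 * pderiv g) z ^ p" by (simp add: power_mult_distrib)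
    also have "\<dots> = of_nat p * ceval (s * (Polynomial.monom 1 1 * pderiv g) ^ p) z" by (simp add: s ceval_mult ceval_power)
    finally obtain w where w: "of_nat N ^ p = of_nat p * ceval w z" by blast
    obtain q r where qr: "pseudo_divmod w g = (q, r)" by force
    define a where "a = Polynomial.coeff g (degree g) ^ (Suc (degree w) - degree g)"
    have a: "is_unit a" using unit unfolding a_def by (metis is_unit_power_iff)
    have r: "Polynomial.smult a w = g * q + r" "r = 0 \<or> degree r < degree g"
      using pseudo_divmod[OF g(1) qr] by (auto simp: a_def)
    \<comment> \<open>Reducing \<open>w\<close> modulo \<open>g\<close> leaves a relation of degree
      below that of \<open>g\<close>, which must be the zero polynomial; comparing constant
      coefficients gives p | N^p.\<close>
    define k where "k = Polynomial.smult (int p) r - [:a * int N ^ p:]"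
    have "of_int a * ceval w z = ceval r z"
      using arg_cong[OF r(1), of "\<lambda>f. ceval f z"] by (simp add: ceval_smult ceval_add ceval_mult gz)
    then have "ceval k z = 0"
      using w by (simp add: k_def ceval_diff ceval_smult ceval_pCons)
    moreover have "degree k < degree g"
    proof -
      have "degree (Polynomial.smult (int p) r) < degree g" using r(2) deg by (auto intro: le_less_trans[OF degree_smult_le])
      then show ?thesis unfolding k_def using deg by (intro degree_diff_less) auto
    qed
    ultimately have "k = 0" using g(3) by blast
    then have "Polynomial.coeff (Polynomial.smult (int p) r) 0 = a * int N ^ p" by (simp add: k_def)
    then have "int p dvd a * int N ^ p" by (metis coeff_smult dvd_triv_left)
    then have "int p dvd int N ^ p" using a by (metis dvd_mult_unit_iff mult.commute)
    then show False using p prime_dvd_power by (metis of_nat_dvd_iff of_nat_power)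
  qed
  moreover have "g dvd f" using f g(2) by simp
  ultimately show ?thesis by (auto elim!: dvdE simp: ceval_mult)
qed

lemma e_fun_power: "e_fun t x ^ n = e_fun (of_nat n * t) x"
  by (simp add: e_fun_def mult_ac flip: exp_of_nat_mult)

text \<open>The sum vanishes at a power of a primitive N-th root of unity z; replacing z by z^p is
  the conjugation, which preserves the vanishing.\<close>

lemma m_fun_galois:
  fixes N p :: nat
  assumes "finite B" "B \<noteq> {}" "N > 0" "prime p" "\<not> p dvd N"
    and "m_fun B (of_int d / N) = 0"
  shows "m_fun B (of_int (int p * d) / N) = 0"
proof -
  define z where "z = e_fun 1 (1 / N)"
  have z: "z ^ N = 1" using assms(3) by (simp add: z_def e_fun_power e_fun_int)
  \<comment> \<open>Exponents are reduced modulo N because b d may be negative.\<close>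
  define f where "f = (\<Sum>b\<in>B. Polynomial.monom (1::int) (nat ((b * d) mod int N)))"
  have zmod: "z ^ (m * nat ((b * d) mod int N)) = e_fun (of_int b) (of_int (int m * d) / N)" for m b
  proof -
    define t where "t = (b * d) div int N"
    have "real (nat ((b * d) mod int N)) = of_int (b * d - int N * t)"
      using assms(3) by (simp add: t_def minus_mult_div_eq_mod del: of_int_diff)
    then have eq: "real (m * nat ((b * d) mod int N)) = of_int b * of_int (int m * d) + real N * of_int (- (int m * t))"
      unfolding of_nat_mult by (simp only:) (simp add: algebra_simps)
    have "z ^ (m * nat ((b * d) mod int N)) = e_fun (of_int b * of_int (int m * d) + real N * of_int (- (int m * t))) (1 / N)"
      by (simp only: z_def e_fun_power eq mult_1_right)
    also have "\<dots> = e_fun (of_int b * of_int (int m * d)) (1 / N)"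
    proof -
      have "e_fun (real N * of_int k) (1 / N) = 1" for k
        using assms(3) by (intro e_fun_int) simp
      then show ?thesis unfolding e_fun_add by (simp only: mult_1_right)
    qed
    finally show ?thesis by (simp add: e_fun_def)
  qed
  have f: "ceval f (z ^ m) = of_nat (card B) * m_fun B (of_int (int m * d) / N)" for m
    using assms(1,2) unfolding f_def m_fun_altdef by (simp add: ceval_sum ceval_monom zmod flip: power_mult)
  have "ceval f (z ^ 1) = 0" using assms(6) by (subst f) simp
  then have "ceval f (z ^ p) = 0"
    using ceval_root_of_unity_prime_power[OF z assms(3-5)] by simp
  then show ?thesis using assms(1,2) by (simp add: f)
qed

text \<open>Both orthogonality relations conjugate: scaling L multiplies the differences l - l' by
  p, and m_(pL)(x) = m_L(p x) multiplies the differences b - b' by p.\<close>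

theorem hadamard_scale_prime:
  assumes H: "hadamard_triple N B L" and p: "prime p" "\<not> p dvd N"
  shows "hadamard_triple N B ((\<lambda>l. int p * l) ` L)"
proof -
  have basic: "N \<ge> 2" "finite B" "finite L" "card B = card L" "card B \<ge> 2"
    using H by (auto simp: hadamard_triple_def)
  have p0: "p > 0" using p prime_gt_0_nat by simp
  have inj: "inj_on (\<lambda>l. int p * l) L" using p0 by (auto simp: inj_on_def)
  have "m_fun B (of_int (l - l') / N) = 0"
    if "l \<in> (\<lambda>l. int p * l) ` L" "l' \<in> (\<lambda>l. int p * l) ` L" "l \<noteq> l'" for l l'
  proof -
    obtain k k' where k: "k \<in> L" "k' \<in> L" "k \<noteq> k'" "l - l' = int p * (k - k')"
      using \<open>l \<in> _\<close> \<open>l' \<in> _\<close> \<open>l \<noteq> l'\<close> by (auto simp: right_diff_distrib)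
    show ?thesis
      unfolding k(4) using m_fun_hadamard(1)[OF H k(1-3)] basic p by (intro m_fun_galois) auto
  qed
  moreover have "m_fun ((\<lambda>l. int p * l) ` L) (of_int (b - b') / N) = 0" if b: "b \<in> B" "b' \<in> B" "b \<noteq> b'" for b b'
  proof -
    have "m_fun L (of_int (int p * (b - b')) / N) = 0"
      using m_fun_hadamard(1)[OF H[unfolded hadamard_transpose[of N B]] b] basic p by (intro m_fun_galois) auto
    moreover have "m_fun ((\<lambda>l. int p * l) ` L) (of_int (b - b') / N) = m_fun L (of_int (int p * (b - b')) / N)"
      unfolding m_fun_altdef sum.reindex[OF inj] card_image[OF inj] by (simp add: e_fun_def mult_ac)
    ultimately show ?thesis by simp
  qed
  ultimately show ?thesis
    using basic card_image[OF inj] unfolding hadamard_triple_iff by simp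
qed

section \<open>Cycles and the multiplicative order\<close>

lemma is_cycle_scale:
  assumes "is_cycle N L C"
  shows "is_cycle N ((\<lambda>l. c * l) ` L) ((\<lambda>x. of_int c * x) ` C)"
proof -
  obtain k :: nat and z l where C: "k \<ge> 1" "C = z ` {1..k}" "\<And>j. j \<in> {1..k} \<Longrightarrow> l j \<in> L"
    "\<And>j. j \<in> {1..<k} \<Longrightarrow> tau N (l j) (z j) = z (j + 1)" "tau N (l k) (z k) = z 1"
    using assms by (rule is_cycleE) blast
  have tau: "tau N (c * l) (of_int c * x) = of_int c * tau N l x" for l x
    by (simp add: tau_def distrib_left)
  show ?thesis
    unfolding is_cycle_def
  proof (intro exI conjI ballI)
    show "(\<lambda>x. of_int c * x) ` C = (\<lambda>j. of_int c * z j) ` {1..k}" by (simp add: C(2) image_image)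
    show "(\<lambda>j. c * l j) j \<in> (\<lambda>l. c * l) ` L" if "j \<in> {1..k}" for j using C(3)[OF that] by auto
    show "tau N (c * l j) (of_int c * z j) = of_int c * z (j + 1)" if "j \<in> {1..<k}" for j
      unfolding tau C(4)[OF that] ..
    show "tau N (c * l k) (of_int c * z k) = of_int c * z 1" unfolding tau C(5) ..
  qed (rule C(1))
qed

lemma is_cycle_unscale:
  assumes "is_cycle N ((\<lambda>l. c * l) ` L) C" "c \<noteq> 0"
  shows "is_cycle N L ((\<lambda>x. x / of_int c) ` C)"
proof -
  obtain k :: nat and z l where C: "k \<ge> 1" "C = z ` {1..k}" "\<And>j. j \<in> {1..k} \<Longrightarrow> l j \<in> (\<lambda>l. c * l) ` L"
    "\<And>j. j \<in> {1..<k} \<Longrightarrow> tau N (l j) (z j) = z (j + 1)" "tau N (l k) (z k) = z 1"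
    using assms(1) by (rule is_cycleE) blast
  have "\<forall>j\<in>{1..k}. \<exists>l'\<in>L. l j = c * l'" using C(3) by blast
  then obtain l' where l': "\<And>j. j \<in> {1..k} \<Longrightarrow> l' j \<in> L \<and> l j = c * l' j" by metis
  have tau: "tau N (l' j) (x / of_int c) = tau N (l j) x / of_int c" if "j \<in> {1..k}" for x j
    using l'[OF that] assms(2) by (simp add: tau_def add_divide_distrib)
  show ?thesis
    unfolding is_cycle_def
  proof (intro exI conjI ballI)
    show "(\<lambda>x. x / of_int c) ` C = (\<lambda>j. z j / of_int c) ` {1..k}" by (simp add: C(2) image_image)
    show "l' j \<in> L" if "j \<in> {1..k}" for j using l'[OF that] by simp
    show "tau N (l' j) (z j / of_int c) = z (j + 1) / of_int c" if "j \<in> {1..<k}" for j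
      using tau[of j "z j"] C(4)[OF that] that by simp
    show "tau N (l' k) (z k / of_int c) = z 1 / of_int c" using tau[of k "z k"] C(1,5) by simp
  qed (rule C(1))
qed

text \<open>At a point of largest modulus m, the relation N x = y + l with y in the cycle gives N m
  <= m + T, hence m <= T as N >= 2.\<close>

lemma cycle_bound:
  assumes C: "is_cycle N L C" and N: "N \<ge> 2" and T: "\<And>l. l \<in> L \<Longrightarrow> \<bar>real_of_int l\<bar> \<le> T" and "x \<in> C"
  shows "\<bar>x\<bar> \<le> T"
proof -
  have fin: "finite (abs ` C)" "abs ` C \<noteq> {}" using C \<open>x \<in> C\<close> by (auto elim: is_cycleE)
  define m where "m = Max (abs ` C)"
  have m: "\<bar>y\<bar> \<le> m" if "y \<in> C" for y using fin that by (auto simp: m_def)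
  obtain y where y: "y \<in> C" "\<bar>y\<bar> = m" using Max_in[OF fin] by (auto simp: m_def)
  obtain y' l where y': "y' \<in> C" "l \<in> L" "tau N l y' = y" using cycle_predecessor[OF C y(1)] .
  have "real N * m = \<bar>real N * y\<bar>" using y(2) by (simp add: abs_mult)
  also have "real N * y = y' + of_int l" using y'(3) N by (auto simp: tau_def)
  also have "\<bar>\<dots>\<bar> \<le> m + T" using m[OF y'(1)] T[OF y'(2)] by linarith
  finally have "real N * m \<le> m + T" .
  moreover have "2 * m \<le> real N * m" using N y(2) by (intro mult_right_mono) auto
  ultimately show ?thesis using m[OF \<open>x \<in> C\<close>] by linarith
qed

text \<open>Going back k steps along the cycle places x within O(N^(- k)) of w / N^k: this is the
  covering of the Cantor set at level k.\<close>

lemma cycle_expansion: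
  assumes C: "is_cycle N L C" and N: "N > 0" and "x \<in> C"
  shows "\<exists>y\<in>C. \<exists>w\<in>digit_sums N L k. real N ^ k * x = y + of_int w"
proof (induction k)
  case (Suc k)
  then obtain y w where y: "y \<in> C" "w \<in> digit_sums N L k" "real N ^ k * x = y + of_int w" by blast
  obtain y' l where y': "y' \<in> C" "l \<in> L" "tau N l y' = y" using cycle_predecessor[OF C y(1)] .
  have "real N * y = y' + of_int l" using y'(3) N by (auto simp: tau_def)
  then have "real N ^ Suc k * x = y' + of_int (int N * w + l)"
    using arg_cong[OF y(3), of "\<lambda>t. real N * t"] by (simp add: algebra_simps)
  moreover have "int N * w + l \<in> digit_sums N L (Suc k)" using y(2) y'(2) by force
  ultimately show ?case using y'(1) by blast
qed (use \<open>x \<in> C\<close> in auto)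

lemma card_digit_sums_le: "finite L \<Longrightarrow> card (digit_sums N L k) \<le> card L ^ k"
proof (induction k)
  case (Suc k)
  have "card (digit_sums N L (Suc k)) \<le> card (digit_sums N L k \<times> L)"
    unfolding digit_sums.simps using Suc.prems by (intro card_image_le) (simp add: finite_digit_sums)
  also have "\<dots> \<le> card L ^ k * card L" using Suc by (simp add: card_cartesian_product)
  finally show ?case by (simp add: mult.commute)
qed simp

lemma card_ints_near_le:
  assumes "M > 0" "r \<ge> 0"
  shows "finite {a::int. \<bar>M * of_int a - c\<bar> \<le> r}" "real (card {a::int. \<bar>M * of_int a - c\<bar> \<le> r}) \<le> 2 * r / M + 1"
proof -
  have sub: "{a::int. \<bar>M * of_int a - c\<bar> \<le> r} \<subseteq> {\<lceil>(c - r) / M\<rceil>..\<lfloor>(c + r) / M\<rfloor>}"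
    using assms by (auto simp: abs_le_iff ceiling_le_iff le_floor_iff field_simps)
  then show "finite {a::int. \<bar>M * of_int a - c\<bar> \<le> r}" by (rule finite_subset) simp
  have "card {a::int. \<bar>M * of_int a - c\<bar> \<le> r} \<le> nat (\<lfloor>(c + r) / M\<rfloor> - \<lceil>(c - r) / M\<rceil> + 1)"
    using card_mono[OF _ sub] by simp
  moreover have "real (nat (\<lfloor>(c + r) / M\<rfloor> - \<lceil>(c - r) / M\<rceil> + 1)) \<le> 2 * r / M + 1"
  proof -
    have "(c + r) / M - (c - r) / M = 2 * r / M" by (simp add: diff_divide_distrib[symmetric])
    moreover have "of_int \<lfloor>(c + r) / M\<rfloor> \<le> (c + r) / M" "(c - r) / M \<le> of_int \<lceil>(c - r) / M\<rceil>" by simp_all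
    moreover have "0 \<le> 2 * r / M" using assms by simp
    ultimately have "of_int (\<lfloor>(c + r) / M\<rfloor> - \<lceil>(c - r) / M\<rceil> + 1) \<le> 2 * r / M + 1" "0 \<le> 2 * r / M + 1"
      unfolding of_int_add of_int_diff of_int_1 by linarith+
    then show ?thesis by (cases "\<lfloor>(c + r) / M\<rfloor> - \<lceil>(c - r) / M\<rceil> + 1 \<ge> 0") (simp_all del: of_int_add of_int_diff)
  qed
  ultimately show "real (card {a::int. \<bar>M * of_int a - c\<bar> \<le> r}) \<le> 2 * r / M + 1" by linarith
qed

text \<open>If the cycle has a point whose reduced denominator contains \<open>p\<close>, then its points, scaled by \<open>b p\<close>, are integers
  meeting a whole coset of the group generated by \<open>N\<close> modulo \<open>p\<close>. On the other hand they lie in few short intervals.\<close>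

lemma bad_cycle_ord_le:
  assumes C: "is_cycle N L C" and N: "N \<ge> 2" and L: "finite L" and T: "\<And>l. l \<in> L \<Longrightarrow> \<bar>real_of_int l\<bar> \<le> T" "T \<ge> 0"
    and p: "prime p" "\<not> p dvd N" "p \<le> N ^ Suc k"
    and int: "\<And>x. x \<in> C \<Longrightarrow> of_int b * real p * x \<in> \<int>"
    and bad: "x0 \<in> C" "of_int b * x0 \<notin> \<int>"
  shows "real (ord p N) \<le> (2 * \<bar>of_int b\<bar> * T * N + 1) * real (card L) ^ k"
proof -
  define I where "I = {a::int. \<exists>x\<in>C. of_int a = of_int b * real p * x}"
  have p0: "p > 0" using p prime_gt_0_nat by simp
  \<comment> \<open>One step backwards along the cycle is multiplication by N modulo p: N x = y + l,
    and the digit contributes the multiple b p l of p.\<close>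
  have pred: "\<exists>a'\<in>I. [a' = int N * a] (mod int p)" if "a \<in> I" for a
  proof -
    obtain x where x: "x \<in> C" "of_int a = of_int b * real p * x" using \<open>a \<in> I\<close> by (auto simp: I_def)
    obtain y l where y: "y \<in> C" "l \<in> L" "tau N l y = x" using cycle_predecessor[OF C x(1)] .
    obtain a' where a': "of_int b * real p * y = of_int a'" using int[OF y(1)] by (auto elim: Ints_cases)
    have "real N * x = y + of_int l" using y(3) N by (auto simp: tau_def)
    then have "real_of_int (int N * a) = of_int b * real p * (y + of_int l)"
      using x(2) by (simp add: mult_ac)
    also have "\<dots> = of_int (a' + int p * (b * l))" using a' by (simp add: algebra_simps)
    finally have "int N * a = a' + int p * (b * l)" by (simp only: of_int_eq_iff)
    then have "[a' = int N * a] (mod int p)" by (simp add: cong_iff_dvd_diff)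
    moreover have "a' \<in> I" using a'[symmetric] y(1) unfolding I_def by blast
    ultimately show ?thesis by blast
  qed
  obtain a0 where a0: "of_int b * real p * x0 = of_int a0" using int[OF bad(1)] by (auto elim: Ints_cases)
  then have "a0 \<in> I" using bad(1) unfolding I_def by force
  have orbit: "\<exists>a\<in>I. [a = int N ^ i * a0] (mod int p)" for i
  proof (induction i)
    case 0
    then show ?case using \<open>a0 \<in> I\<close> by (intro bexI[of _ a0]) auto
  next
    case (Suc i)
    then obtain a where a: "a \<in> I" "[a = int N ^ i * a0] (mod int p)" by blast
    obtain a' where "a' \<in> I" "[a' = int N * a] (mod int p)" using pred[OF a(1)] by blast
    moreover have "[int N * a = int N * (int N ^ i * a0)] (mod int p)" by (rule cong_scalar_left[OF a(2)])
    ultimately show ?case by (metis cong_trans mult.assoc power_Suc)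
  qed
  \<comment> \<open>Otherwise b x0 would be an integer. Hence a0 is invertible modulo p, and its
    multiples by N^i are distinct for i below the order.\<close>
  have "\<not> int p dvd a0"
  proof
    assume "int p dvd a0"
    then obtain m where "a0 = int p * m" by (rule dvdE)
    then have "of_int b * x0 = of_int m" using a0 p0 by (simp add: field_simps)
    then show False using bad(2) by simp
  qed
  then have cop: "coprime a0 (int p)"
    using p(1) by (metis coprime_commute prime_imp_coprime prime_nat_int_transfer)
  have inj: "inj_on (\<lambda>i. int N ^ i * a0 mod int p) {..<ord p N}"
  proof (rule inj_onI)
    fix i j assume ij: "i \<in> {..<ord p N}" "j \<in> {..<ord p N}" "int N ^ i * a0 mod int p = int N ^ j * a0 mod int p"
    then have "[int N ^ i * a0 = int N ^ j * a0] (mod int p)" by (simp add: cong_def)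
    then have "[int N ^ i = int N ^ j] (mod int p)" using cong_mult_rcancel[OF cop] by simp
    then have "[N ^ i = N ^ j] (mod p)" by (metis cong_int_iff of_nat_power)
    moreover have "coprime p N" using p by (simp add: prime_imp_coprime)
    ultimately have "[i = j] (mod ord p N)" using order_divides_expdiff[of p N i j] by simp
    then show "i = j" using ij by (auto simp: cong_def)
  qed
  \<comment> \<open>The integers whose cycle points have the expansion \<open>w\<close>: there N^k a
    - b p w = b p y with |y| <= T. As p <= N^(k+1), the interval for a has bounded length.\<close>
  define D where "D w = {a::int. \<bar>real N ^ k * of_int a - of_int b * real p * of_int w\<bar> \<le> \<bar>of_int b\<bar> * real p * T}" for w :: int
  have D: "finite (D w)" "real (card (D w)) \<le> 2 * \<bar>of_int b\<bar> * T * N + 1" for w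
  proof -
    show "finite (D w)" unfolding D_def using N T by (intro card_ints_near_le) auto
    have "real (card (D w)) \<le> 2 * (\<bar>of_int b\<bar> * real p * T) / real N ^ k + 1"
      unfolding D_def using N T by (intro card_ints_near_le) auto
    also have "2 * (\<bar>of_int b\<bar> * real p * T) / real N ^ k = 2 * \<bar>of_int b\<bar> * T * (real p / real N ^ k)" by simp
    also have "real p / real N ^ k \<le> N"
    proof -
      have "real p \<le> real N ^ Suc k" using p(3) by (metis of_nat_le_iff of_nat_power)
      then show ?thesis using N by (simp add: pos_divide_le_eq)
    qed
    then have "2 * \<bar>of_int b\<bar> * T * (real p / real N ^ k) \<le> 2 * \<bar>of_int b\<bar> * T * N"
      using T by (intro mult_left_mono) auto
    finally show "real (card (D w)) \<le> 2 * \<bar>of_int b\<bar> * T * N + 1" by simp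
  qed
  have "I \<subseteq> (\<Union>w\<in>digit_sums N L k. D w)"
  proof
    fix a assume "a \<in> I"
    then obtain x where x: "x \<in> C" "of_int a = of_int b * real p * x" by (auto simp: I_def)
    obtain y w where y: "y \<in> C" "w \<in> digit_sums N L k" "real N ^ k * x = y + of_int w"
      using cycle_expansion[OF C _ x(1)] N by (metis gr0I not_numeral_le_zero)
    have "real N ^ k * of_int a - of_int b * real p * of_int w = of_int b * real p * y"
    proof -
      have "real N ^ k * of_int a = of_int b * real p * (y + of_int w)"
        using x(2) y(3) by (metis mult.left_commute)
      then show ?thesis by (simp add: algebra_simps)
    qed
    then have "\<bar>real N ^ k * of_int a - of_int b * real p * of_int w\<bar> = \<bar>of_int b\<bar> * real p * \<bar>y\<bar>"
      by (simp add: abs_mult)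
    also have "\<dots> \<le> \<bar>of_int b\<bar> * real p * T"
      using cycle_bound[OF C N T(1) y(1)] by (intro mult_left_mono) auto
    finally show "a \<in> (\<Union>w\<in>digit_sums N L k. D w)" using y(2) by (auto simp: D_def)
  qed
  moreover have finU: "finite (\<Union>w\<in>digit_sums N L k. D w)" using D finite_digit_sums[OF L] by auto
  ultimately have I: "finite I" "card I \<le> card (\<Union>w\<in>digit_sums N L k. D w)"
    by (auto intro: finite_subset card_mono)
  have "ord p N = card ((\<lambda>i. int N ^ i * a0 mod int p) ` {..<ord p N})"
    using card_image[OF inj] by simp
  also have "\<dots> \<le> card ((\<lambda>a. a mod int p) ` I)"
  proof (rule card_mono)
    show "(\<lambda>i. int N ^ i * a0 mod int p) ` {..<ord p N} \<subseteq> (\<lambda>a. a mod int p) ` I"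
    proof clarify
      fix i
      obtain a where "a \<in> I" "[a = int N ^ i * a0] (mod int p)" using orbit by blast
      then show "int N ^ i * a0 mod int p \<in> (\<lambda>a. a mod int p) ` I"
        by (intro image_eqI[of _ _ a]) (simp_all add: cong_def)
    qed
  qed (use I in auto)
  also have "\<dots> \<le> card I" by (rule card_image_le[OF I(1)])
  also note I(2)
  finally have "real (ord p N) \<le> real (card (\<Union>w\<in>digit_sums N L k. D w))" by simp
  also have "\<dots> \<le> real (\<Sum>w\<in>digit_sums N L k. card (D w))"
    using card_UN_le[OF finite_digit_sums[OF L]] by (simp only: of_nat_le_iff)
  also have "\<dots> \<le> (\<Sum>w\<in>digit_sums N L k. 2 * \<bar>of_int b\<bar> * T * N + 1)"
    using D by (simp only: of_nat_sum) (intro sum_mono)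
  also have "\<dots> = (2 * \<bar>of_int b\<bar> * T * N + 1) * real (card (digit_sums N L k))" by simp
  also have "\<dots> \<le> (2 * \<bar>of_int b\<bar> * T * N + 1) * real (card L) ^ k"
    using card_digit_sums_le[OF L, of N k] T
    by (intro mult_left_mono) (auto simp flip: of_nat_power)
  finally show ?thesis .
qed

lemma canonical_spectrum_scale:
  assumes "p > 0"
    and up: "\<And>C. is_m_cycle N B L C \<Longrightarrow> is_m_cycle N B ((\<lambda>l. int p * l) ` L) ((\<lambda>x. real p * x) ` C)"
    and down: "\<And>C. is_m_cycle N B ((\<lambda>l. int p * l) ` L) C \<Longrightarrow> is_m_cycle N B L ((\<lambda>x. x / real p) ` C)"
  shows "canonical_spectrum N B ((\<lambda>l. int p * l) ` L) = (\<lambda>x. real p * x) ` canonical_spectrum N B L"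
proof
  show "(\<lambda>x. real p * x) ` canonical_spectrum N B L \<subseteq> canonical_spectrum N B ((\<lambda>l. int p * l) ` L)"
  proof clarify
    fix y assume "y \<in> canonical_spectrum N B L"
    then show "real p * y \<in> canonical_spectrum N B ((\<lambda>l. int p * l) ` L)"
    proof induction
      case (cycle C x)
      then have "real p * x \<in> (\<lambda>x. real p * x) ` C" by blast
      from canonical_spectrum.cycle[OF up[OF cycle(1)] this] show ?case by simp
    next
      case (step y l)
      have "int p * l \<in> (\<lambda>l. int p * l) ` L" using step(2) by blast
      from canonical_spectrum.step[OF step.IH this] show ?case by (simp add: distrib_left mult.left_commute)
    qed
  qed
  show "canonical_spectrum N B ((\<lambda>l. int p * l) ` L) \<subseteq> (\<lambda>x. real p * x) ` canonical_spectrum N B L"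
  proof
    fix y assume "y \<in> canonical_spectrum N B ((\<lambda>l. int p * l) ` L)"
    then show "y \<in> (\<lambda>x. real p * x) ` canonical_spectrum N B L"
    proof induction
      case (cycle C x)
      then have "- (x / real p) \<in> canonical_spectrum N B L"
        using canonical_spectrum.cycle[OF down[OF cycle(1)]] by blast
      then show ?case using assms(1) by (intro image_eqI[of _ _ "- (x / real p)"]) auto
    next
      case (step y l)
      then obtain z m where z: "z \<in> canonical_spectrum N B L" "y = real p * z" "m \<in> L" "l = int p * m" by auto
      then show ?case
        using canonical_spectrum.step[OF z(1) z(3)]
        by (intro image_eqI[of _ _ "real N * z + of_int m"]) (auto simp: algebra_simps)
    qed
  qed
qed

theorem (in hadamard_system) canonical_spectrum_scale_prime:
  obtains K where "\<And>p. prime p \<Longrightarrow> \<not> p dvd N \<Longrightarrow> K * real p powr log N (card L) < real (ord p N) \<Longrightarrow>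
    canonical_spectrum N B ((\<lambda>l. int p * l) ` L) = (\<lambda>x. real p * x) ` \<Lambda>"
proof -
  define T where "T = real_of_int (Max (abs ` L))"
  define \<beta> where "\<beta> = real_of_int (Max (abs ` B))"
  have T: "\<bar>real_of_int l\<bar> \<le> T" if "l \<in> L" for l
    using that finite_L by (auto simp: T_def simp flip: of_int_abs)
  have \<beta>: "\<bar>real_of_int b\<bar> \<le> \<beta>" if "b \<in> B" for b
    using that finite_B by (auto simp: \<beta>_def simp flip: of_int_abs)
  have T0: "T \<ge> 0" using T[OF zero_L] by simp
  define K where "K = 2 * \<beta> * T * N + 1"
  note iff = cmod_m_fun_eq_1_iff[OF finite_B zero_B]
  have "canonical_spectrum N B ((\<lambda>l. int p * l) ` L) = (\<lambda>x. real p * x) ` \<Lambda>"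
    if p: "prime p" "\<not> p dvd N" and ord: "K * real p powr log N (card L) < real (ord p N)" for p
  proof (rule canonical_spectrum_scale)
    show p0: "p > 0" using p prime_gt_0_nat by simp
    fix C
    show "is_m_cycle N B ((\<lambda>l. int p * l) ` L) ((\<lambda>x. real p * x) ` C)" if "is_m_cycle N B L C"
    proof -
      have "of_int b * (real p * x) \<in> \<int>" if "b \<in> B" "x \<in> C" for b x
      proof -
        have "real p * (of_int b * x) \<in> \<int>"
          using \<open>is_m_cycle N B L C\<close> that by (intro Ints_mult[OF Ints_of_nat]) (auto simp: is_m_cycle_def iff)
        then show ?thesis by (simp add: mult_ac)
      qed
      then show ?thesis using \<open>is_m_cycle N B L C\<close> is_cycle_scale[of N L C "int p"]
        by (auto simp: is_m_cycle_def iff)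
    qed
    show "is_m_cycle N B L ((\<lambda>x. x / real p) ` C)" if C: "is_m_cycle N B ((\<lambda>l. int p * l) ` L) C"
    proof -
      \<comment> \<open>Working with a cycle of \<open>L\<close> itself keeps \<open>T\<close> and
        the number of digits, and thus \<open>K\<close>, independent of p; the scaling survives only
        as a possible factor p in denominators.\<close>
      have cyc: "is_cycle N L ((\<lambda>x. x / real p) ` C)"
        using C is_cycle_unscale[of N "int p" L C] p0 by (auto simp: is_m_cycle_def)
      have int: "of_int b * real p * x \<in> \<int>" if "b \<in> B" "x \<in> (\<lambda>x. x / real p) ` C" for b x
        using C that p0 by (auto simp: is_m_cycle_def iff)
      have "of_int b * x \<in> \<int>" if b: "b \<in> B" "x \<in> (\<lambda>x. x / real p) ` C" for b x
      proof (rule ccontr)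
        assume bad: "of_int b * x \<notin> \<int>"
        \<comment> \<open>At this level (card L)^k = (N^k)^s <= p^s, while each of the short
          intervals still contains O(1) integers.\<close>
        obtain k where k: "N ^ k \<le> p" "p < N ^ Suc k"
          using ex_power_ivl1[of N p] N_ge_2 p0 by auto
        have "real (ord p N) \<le> (2 * \<bar>of_int b\<bar> * T * N + 1) * real (card L) ^ k"
          using k by (intro bad_cycle_ord_le[OF cyc N_ge_2 finite_L T T0 p _ int[OF b(1)] b(2) bad]) auto
        also have "\<dots> \<le> K * real (card L) ^ k"
          unfolding K_def using \<beta>[OF b(1)] T0 by (intro mult_right_mono add_mono mult_mono) auto
        also have "real (card L) ^ k = (real N ^ k) powr log N (card L)"
        proof -
          have "real (card L) = real N powr log N (card L)"
            using N_ge_2 card_B card_L by simp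
          then show ?thesis using N_ge_2 by (metis gr0I not_numeral_le_zero of_nat_0_less_iff powr_powr powr_realpow mult.commute
            powr_gt_zero)
        qed
        also have "K * (real N ^ k) powr log N (card L) \<le> K * real p powr log N (card L)"
        proof (rule mult_left_mono)
          have "real N ^ k \<le> real p" using k(1) by (metis of_nat_le_iff of_nat_power)
          then show "(real N ^ k) powr log N (card L) \<le> real p powr log N (card L)"
            using N_ge_2 card_B card_L by (intro powr_mono2) auto
          show "K \<ge> 0" unfolding K_def using \<beta>[OF zero_B] T0 by (intro add_nonneg_nonneg mult_nonneg_nonneg) auto
        qed
        finally show False using ord by simp
      qed
      then show ?thesis using cyc by (auto simp: is_m_cycle_def iff)
    qed
  qed
  then show ?thesis using that by blast
qed

section \<open>Primes modulo which a given integer has large order\<close>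

text \<open>Passing from M to its power N = M^m costs the order at most the constant factor m, which
  the gap between p^s and p absorbs.\<close>

lemma ord_power_ge:
  fixes p M m :: nat
  assumes "prime p" "\<not> p dvd M" "m > 0"
  shows "ord p M \<le> m * ord p (M ^ m)"
proof -
  have cop: "coprime p (M ^ m)" using assms by (simp add: prime_imp_coprime)
  then have "ord p (M ^ m) > 0" by simp
  have "[(M ^ m) ^ ord p (M ^ m) = 1] (mod p)" by (rule ord)
  then have "ord p M dvd m * ord p (M ^ m)" by (simp add: ord_divides' flip: power_mult)
  then show ?thesis using \<open>ord p (M ^ m) > 0\<close> \<open>m > 0\<close> by (intro dvd_imp_le) auto
qed

lemma nonsquare_root:
  fixes N :: nat
  assumes "N \<ge> 2"
  obtains M m where "M \<ge> 2" "\<nexists>b. M = b\<^sup>2" "m > 0" "N = M ^ m"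
proof -
  have "\<exists>M m. M \<ge> 2 \<and> (\<nexists>b. M = b\<^sup>2) \<and> m > 0 \<and> N = M ^ m"
    using assms
  proof (induction N rule: less_induct)
    case (less N)
    show ?case
    proof (cases "\<exists>b. N = b\<^sup>2")
      case False
      then show ?thesis using less.prems by (intro exI[of _ N] exI[of _ 1]) auto
    next
      case True
      then obtain b where b: "N = b\<^sup>2" by blast
      have "b \<ge> 2"
      proof (rule ccontr)
        assume "\<not> b \<ge> 2"
        then have "b = 0 \<or> b = 1" by auto
        then show False using less.prems b by auto
      qed
      then have "b < N" by (simp add: b power2_eq_square)
      then obtain M m where "M \<ge> 2" "\<nexists>b. M = b\<^sup>2" "m > 0" "b = M ^ m" using less.IH \<open>b \<ge> 2\<close> by blast
      then show ?thesis using b by (intro exI[of _ M] exI[of _ "m * 2"]) (auto simp: power_mult)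
    qed
  qed
  then show ?thesis using that by blast
qed

lemma sublinear_powr:
  fixes s K c :: real
  assumes "s < 1" "c > 0"
  shows "\<forall>\<^sub>F n in sequentially. K * real n powr s < c * (real n - 1)"
proof -
  define d where "d = 1 - s"
  have "d > 0" using assms by (simp add: d_def)
  then have "((\<lambda>n. K * real n powr (- d)) \<longlongrightarrow> 0) sequentially" by real_asymp
  then have "\<forall>\<^sub>F n in sequentially. K * real n powr (- d) < c / 2"
    using assms(2) by (intro order_tendstoD) auto
  then show ?thesis
    using eventually_gt_at_top[of 2]
  proof eventually_elim
    case (elim n)
    have "K * real n powr s = K * real n powr (- d) * real n"
      using elim by (simp add: d_def powr_diff powr_minus field_simps)
    also have "\<dots> < c / 2 * real n" using elim by (intro mult_strict_right_mono) auto
    also have "\<dots> \<le> c * (real n - 1)"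
    proof -
      have "c * (real n / 2) \<le> c * (real n - 1)" using elim assms(2) by (intro mult_left_mono) auto
      then show ?thesis by simp
    qed
    finally show ?case .
  qed
qed

lemma artin_large_ord:
  assumes "artin_conjecture" "N \<ge> 2" "s < 1"
  shows "infinite {p. prime p \<and> \<not> p dvd N \<and> K * real p powr s < real (ord p N)}"
proof -
  obtain M m where M: "M \<ge> 2" "\<nexists>b. M = b\<^sup>2" "m > 0" "N = M ^ m" using nonsquare_root[OF assms(2)] .
  let ?A = "{p. prime p \<and> \<not> p dvd M \<and> ord p M = p - 1}"
  have "infinite ?A" using assms(1) M unfolding artin_conjecture_def by blast
  obtain P where P: "\<And>n. n \<ge> P \<Longrightarrow> K * real n powr s < 1 / m * (real n - 1)"
    using sublinear_powr[OF assms(3), of "1 / m" K] M by (auto simp: eventually_sequentially)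
  have "?A - {..<P} \<subseteq> {p. prime p \<and> \<not> p dvd N \<and> K * real p powr s < real (ord p N)}"
  proof clarsimp
    fix p assume p: "prime p" "\<not> p dvd M" "ord p M = p - Suc 0" "\<not> p < P"
    have "real (ord p M) \<le> real m * real (ord p N)"
      using ord_power_ge[OF p(1,2) M(3)] M(4) by (simp flip: of_nat_mult)
    moreover have "real (ord p M) = real p - 1" using p prime_ge_1_nat[OF p(1)] by (simp add: of_nat_diff)
    ultimately have "1 / m * (real p - 1) \<le> real (ord p N)" using M(3) by (simp add: field_simps)
    moreover have "K * real p powr s < 1 / m * (real p - 1)" using P p by simp
    ultimately have "K * real p powr s < real (ord p N)" by linarith
    then show "\<not> p dvd N \<and> K * real p powr s < real (ord p N)"
      using p M(4) prime_dvd_power by blast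
  qed
  moreover have "infinite (?A - {..<P})" using \<open>infinite ?A\<close> by simp
  ultimately show ?thesis using finite_subset by blast
qed

section \<open>Chebyshev and Mertens bounds\<close>

definition chebyshev_psi :: "nat \<Rightarrow> real" where
  "chebyshev_psi n = (\<Sum>m\<in>{1..n}. mangoldt m)"

lemma ln_fact_mangoldt: "ln (fact n :: real) = (\<Sum>m\<in>{1..n}. mangoldt m * real (n div m))"
proof (induction n)
  case (Suc n)
  have div: "real (Suc n div m) = real (n div m) + (if m dvd Suc n then 1 else 0)" for m
    by (auto simp: div_Suc dvd_eq_mod_eq_0)
  have "(\<Sum>m\<in>{1..Suc n}. mangoldt m * real (Suc n div m))
      = (\<Sum>m\<in>{1..Suc n}. mangoldt m * real (n div m)) + (\<Sum>m\<in>{1..Suc n}. if m dvd Suc n then mangoldt m else 0)"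
    unfolding div by (simp add: distrib_left sum.distrib[symmetric] if_distrib cong: if_cong)
  also have "(\<Sum>m\<in>{1..Suc n}. if m dvd Suc n then mangoldt m else 0) = (\<Sum>m | m dvd Suc n. mangoldt m :: real)"
  proof (rule sum.mono_neutral_cong_right)
    show "{m. m dvd Suc n} \<subseteq> {1..Suc n}"
      using dvd_imp_le[of _ "Suc n"] by (auto simp: Suc_le_eq intro!: Nat.gr0I)
  qed auto
  also have "\<dots> = ln (real (Suc n))" by (subst mangoldt_sum) auto
  also have "(\<Sum>m\<in>{1..Suc n}. mangoldt m * real (n div m)) = ln (fact n)"
    unfolding Suc.IH by simp
  also have "ln (fact n) + ln (real (Suc n)) = ln (fact (Suc n) :: real)"
    using ln_mult_pos[of "fact n :: real" "real (Suc n)"] by (simp add: mult.commute del: of_nat_Suc)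
  finally show ?case by simp
qed simp

lemma chebyshev_psi_mono: "m \<le> n \<Longrightarrow> chebyshev_psi m \<le> chebyshev_psi n"
  unfolding chebyshev_psi_def by (intro sum_mono2) (auto simp: mangoldt_nonneg)

text \<open>In the logarithm of the binomial coefficient \<open>mangoldt m\<close> has the
  coefficient floor(2k/m) - 2 floor(k/m), which lies between 0 and 1 and equals 1 for k < m <=
  2k.\<close>

lemma ln_central_binomial:
  "chebyshev_psi (2 * k) - chebyshev_psi k \<le> ln (real ((2 * k) choose k))"
  "ln (real ((2 * k) choose k)) \<le> chebyshev_psi (2 * k)"
proof -
  define c where "c m = real ((2 * k) div m) - 2 * real (k div m)" for m
  have c: "0 \<le> c m" "c m \<le> 1" for m
  proof -
    have "2 * (k div m) \<le> (2 * k) div m" 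
      by (cases "m = 0") (simp_all add: less_eq_div_iff_mult_less_eq mult.assoc)
    moreover have "(2 * k) div m \<le> 2 * (k div m) + 1"
    proof (cases "m = 0")
      case False
      have "k = m * (k div m) + k mod m" by simp
      moreover have "k mod m < m" using False by simp
      ultimately have "2 * k < m * (2 * (k div m) + 2)" unfolding distrib_left by linarith
      then have "(2 * k) div m < 2 * (k div m) + 2" using False by (simp add: div_less_iff_less_mult mult.commute)
      then show ?thesis by simp
    qed simp
    ultimately show "0 \<le> c m" "c m \<le> 1" unfolding c_def by linarith+
  qed
  have "fact (2 * k) = (fact k * fact k * ((2 * k) choose k) :: nat)"
    using binomial_fact_lemma[of k "2 * k"] by (simp add: mult_2)
  then have "(fact (2 * k) :: real) = fact k * fact k * real ((2 * k) choose k)"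
    by (metis of_nat_fact of_nat_mult)
  then have "ln (fact (2 * k) :: real) = 2 * ln (fact k) + ln (real ((2 * k) choose k))"
    by (simp add: ln_mult)
  then have "ln (real ((2 * k) choose k)) = (\<Sum>m\<in>{1..2*k}. mangoldt m * real ((2 * k) div m)) - 2 * (\<Sum>m\<in>{1..k}. mangoldt m * real (k div m))"
    by (simp add: ln_fact_mangoldt)
  also have "(\<Sum>m\<in>{1..k}. mangoldt m * real (k div m)) = (\<Sum>m\<in>{1..2*k}. mangoldt m * real (k div m))"
    by (rule sum.mono_neutral_left) auto
  finally have eq: "ln (real ((2 * k) choose k)) = (\<Sum>m\<in>{1..2*k}. mangoldt m * c m)"
    by (simp add: c_def sum_distrib_left right_diff_distrib sum_subtractf mult_ac)
  have "(\<Sum>m\<in>{1..2*k}. mangoldt m * c m) \<le> (\<Sum>m\<in>{1..2*k}. mangoldt m * 1)"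
    using c by (intro sum_mono mult_left_mono mangoldt_nonneg)
  then show "ln (real ((2 * k) choose k)) \<le> chebyshev_psi (2 * k)" by (simp add: eq chebyshev_psi_def)
  have "{1..2*k} = {1..k} \<union> {k<..2*k}" by auto
  then have "chebyshev_psi (2 * k) = chebyshev_psi k + (\<Sum>m\<in>{k<..2*k}. mangoldt m)"
    unfolding chebyshev_psi_def by (simp only:) (rule sum.union_disjoint; auto)
  then have "chebyshev_psi (2 * k) - chebyshev_psi k = (\<Sum>m\<in>{k<..2*k}. mangoldt m)" by simp
  also have "\<dots> \<le> (\<Sum>m\<in>{k<..2*k}. mangoldt m * c m)"
  proof (rule sum_mono)
    fix m assume m: "m \<in> {k<..2*k}"
    then have "(2 * k) div m = 1" by (intro div_nat_eqI) auto
    then have "c m = 1" using m by (simp add: c_def)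
    then show "mangoldt m \<le> mangoldt m * c m" by simp
  qed
  also have "\<dots> \<le> (\<Sum>m\<in>{1..2*k}. mangoldt m * c m)"
    using c by (intro sum_mono2) (auto simp: mangoldt_nonneg)
  finally show "chebyshev_psi (2 * k) - chebyshev_psi k \<le> ln (real ((2 * k) choose k))" by (simp add: eq)
qed

lemma chebyshev_psi_le: "chebyshev_psi n \<le> 4 * real n"
proof (induction n rule: less_induct)
  case (less n)
  show ?case
  proof (cases "n \<le> 1")
    case True
    then have "n = 0 \<or> n = 1" by auto
    then show ?thesis by (auto simp: chebyshev_psi_def)
  next
    case False
    define k where "k = (n + 1) div 2"
    have k: "n \<le> 2 * k" "2 * k \<le> n + 1" "k < n" using False by (auto simp: k_def)
    have "real ((2 * k) choose k) \<le> 2 ^ (2 * k)"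
      using binomial_le_pow2[of "2 * k" k] by (metis of_nat_le_iff of_nat_numeral of_nat_power)
    moreover have "real ((2 * k) choose k) > 0" by simp
    ultimately have "ln (real ((2 * k) choose k)) \<le> ln (2 ^ (2 * k))" by (simp only: ln_le_cancel_iff zero_less_power zero_less_numeral)
    also have "\<dots> = 2 * real k * ln 2" by (simp add: ln_realpow)
    also have "\<dots> \<le> 2 * real k * 1" using ln_2_less_1 by (intro mult_left_mono) auto
    finally have "chebyshev_psi (2 * k) \<le> chebyshev_psi k + 2 * real k" using ln_central_binomial(1)[of k] by simp
    moreover have "chebyshev_psi n \<le> chebyshev_psi (2 * k)" using k by (intro chebyshev_psi_mono)
    moreover have "chebyshev_psi k \<le> 4 * real k" using less k by blast
    ultimately have "chebyshev_psi n \<le> real (6 * k)" by simp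
    \<comment> \<open>Twice 2k <= n + 1 plus twice k <= n - 1 gives exactly this, also for small n;
      hence the constant 4.\<close>
    also have "6 * k \<le> 4 * n" using k by linarith
    finally show ?thesis by simp
  qed
qed

text \<open>Since ln n! <= n ln n, only the replacement of n / m by the integer quotient plus 1
  costs anything, namely psi(n) <= 4 n.\<close>

lemma mertens_upper:
  assumes "n > 0"
  shows "(\<Sum>m\<in>{1..n}. mangoldt m / real m) \<le> ln (real n) + 4"
proof -
  have "real n * (\<Sum>m\<in>{1..n}. mangoldt m / real m) = (\<Sum>m\<in>{1..n}. mangoldt m * (real n / real m))"
    by (simp add: sum_distrib_left mult.commute)
  also have "\<dots> \<le> (\<Sum>m\<in>{1..n}. mangoldt m * (real (n div m) + 1))"
  proof (intro sum_mono mult_left_mono mangoldt_nonneg)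
    fix m assume "m \<in> {1..n}"
    then have "n < m * (n div m + 1)" using dividend_less_times_div[of m n] by simp
    then have "real n < real m * (real (n div m) + 1)"
      by (metis of_nat_1 of_nat_add of_nat_less_iff of_nat_mult)
    then show "real n / real m \<le> real (n div m) + 1" using \<open>m \<in> {1..n}\<close> by (simp add: field_simps)
  qed
  also have "\<dots> = ln (fact n) + chebyshev_psi n"
    by (simp add: ln_fact_mangoldt chebyshev_psi_def distrib_left sum.distrib)
  also have "ln (fact n :: real) \<le> ln (real n ^ n)"
    using fact_le_power[of n, where 'a = real] assms by (subst ln_le_cancel_iff) auto
  also have "\<dots> = real n * ln (real n)" using assms by (simp add: ln_realpow)
  finally have "real n * (\<Sum>m\<in>{1..n}. mangoldt m / real m) \<le> real n * (ln (real n) + 4)"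
    using chebyshev_psi_le[of n] by (simp add: distrib_left)
  then show ?thesis using assms by simp
qed

lemma sum_mangoldt_prime_powers:
  "(\<Sum>m\<in>{1..n}. mangoldt m * g m :: real) =
   (\<Sum>q | prime q \<and> q \<le> n. \<Sum>a | a \<ge> 1 \<and> q ^ a \<le> n. ln (real q) * g (q ^ a))"
proof -
  define S where "S = Sigma {q::nat. prime q \<and> q \<le> n} (\<lambda>q. {a. a \<ge> 1 \<and> q ^ a \<le> n})"
  have fin: "finite {a. a \<ge> 1 \<and> q ^ a \<le> n}" if "prime q" for q
  proof (rule finite_subset)
    show "{a. a \<ge> 1 \<and> q ^ a \<le> n} \<subseteq> {..n}"
    proof clarsimp
      fix a assume "q ^ a \<le> n"
      moreover have "a < q ^ a" using prime_gt_1_nat[OF that] power_gt_expt[of q a] by simp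
      ultimately show "a \<le> n" by simp
    qed
  qed simp
  have inj: "inj_on (\<lambda>(q, a). q ^ a) S"
    unfolding S_def
  proof (rule inj_onI, clarsimp)
    fix q a q' a' :: nat
    assume q: "prime q" "prime q'" "Suc 0 \<le> a" "Suc 0 \<le> a'" and eq: "q ^ a = q' ^ a'"
    have "q = q'" using aprimedivisor_prime_power[OF q(1), of a] aprimedivisor_prime_power[OF q(2), of a'] q eq by simp
    then show "q = q' \<and> a = a'" using eq prime_gt_1_nat[OF q(1)] by simp
  qed
  have image: "(\<lambda>(q, a). q ^ a) ` S = {m \<in> {1..n}. primepow m}"
  proof (intro equalityI subsetI)
    fix m assume "m \<in> (\<lambda>(q, a). q ^ a) ` S"
    then show "m \<in> {m \<in> {1..n}. primepow m}"
      by (auto simp: S_def primepow_def Suc_le_eq prime_gt_0_nat)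
  next
    fix m assume "m \<in> {m \<in> {1..n}. primepow m}"
    then obtain q a where qa: "prime q" "a > 0" "m = q ^ a" "m \<le> n" by (auto simp: primepow_def)
    have "q \<le> n" using qa self_le_power[of q a] prime_ge_1_nat[OF qa(1)] by linarith
    then show "m \<in> (\<lambda>(q, a). q ^ a) ` S" using qa by (auto simp: S_def intro!: image_eqI[of _ _ "(q, a)"])
  qed
  have "(\<Sum>m\<in>{1..n}. mangoldt m * g m) = (\<Sum>m\<in>{m \<in> {1..n}. primepow m}. mangoldt m * g m)"
    by (rule sum.mono_neutral_right) (auto simp: mangoldt_def)
  also have "\<dots> = (\<Sum>(q, a)\<in>S. mangoldt (q ^ a) * g (q ^ a))"
    unfolding image[symmetric] sum.reindex[OF inj] by (simp add: case_prod_unfold)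
  also have "\<dots> = (\<Sum>(q, a)\<in>S. ln (real q) * g (q ^ a))"
    by (intro sum.cong refl) (auto simp: S_def)
  also have "\<dots> = (\<Sum>q | prime q \<and> q \<le> n. \<Sum>a | a \<ge> 1 \<and> q ^ a \<le> n. ln (real q) * g (q ^ a))"
    unfolding S_def using fin by (intro sum.Sigma[symmetric]) (auto intro: finite_subset[of _ "{..n}"])
  finally show ?thesis .
qed

text \<open>The weights 1 / totient m are the expected densities of primes congruent to 1 modulo m.
  Passing to them from 1 / m changes the sum by a convergent series over primes.\<close>

lemma mertens_totient:
  obtains c where "c \<ge> 0" "\<And>n. n > 0 \<Longrightarrow> (\<Sum>m\<in>{1..n}. mangoldt m / real (totient m)) \<le> ln (real n) + c"
proof -
  have bound: "ln (real q) / (real q)\<^sup>2 \<le> 2 * real q powr (- (3/2))" if "q > 0" for q :: nat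
  proof -
    have "ln (real q) = 2 * ln (sqrt (real q))" using that by (simp add: ln_sqrt)
    also have "\<dots> \<le> 2 * real q powr (1/2)"
      using ln_bound[of "sqrt (real q)"] that by (simp add: powr_half_sqrt)
    finally have "ln (real q) / (real q)\<^sup>2 \<le> 2 * real q powr (1/2) / (real q)\<^sup>2" by (intro divide_right_mono) auto
    also have "\<dots> = 2 * real q powr (1/2 - 2)"
      unfolding powr_diff using that by (simp add: powr_numeral)
    finally show ?thesis by simp
  qed
  have summable: "summable (\<lambda>q::nat. 8 * real q powr (- (3/2)))"
    by (intro summable_mult) (simp add: summable_real_powr_iff)
  define c where "c = (\<Sum>q::nat. 8 * real q powr (- (3/2)))"
  have "c \<ge> 0" unfolding c_def by (intro suminf_nonneg summable) auto
  have "(\<Sum>m\<in>{1..n}. mangoldt m / real (totient m)) \<le> ln (real n) + (4 + c)" if "n > 0" for n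
  proof -
    have inner: "(\<Sum>a | a \<ge> 1 \<and> q ^ a \<le> n. ln (real q) * (1 / real (totient (q ^ a)) - 1 / real (q ^ a))) \<le> 8 * real q powr (- (3/2))"
      if q: "prime q" for q
    proof -
      have q1: "real q > 1" "real q \<ge> 2" using prime_gt_1_nat[OF q] by auto
      have "(\<Sum>a | a \<ge> 1 \<and> q ^ a \<le> n. ln (real q) * (1 / real (totient (q ^ a)) - 1 / real (q ^ a)))
         \<le> (\<Sum>a | a \<ge> 1 \<and> q ^ a \<le> n. 2 * ln (real q) / real q * (1 / real q) ^ a)"
      proof (rule sum_mono)
        fix a assume "a \<in> {a. a \<ge> 1 \<and> q ^ a \<le> n}"
        then obtain b where b: "a = Suc b" by (cases a) auto
        have "real (totient (q ^ a)) = real q ^ b * (real q - 1)"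
          unfolding b totient_prime_power_Suc[OF q] using q1 by (simp add: of_nat_diff)
        then have "1 / real (totient (q ^ a)) - 1 / real (q ^ a) = 1 / (real q - 1) * (1 / real q) ^ a"
        proof -
          have *: "1 / (x * (y - 1)) - 1 / (y * x) = 1 / (y - 1) * (1 / y * (1 / x))" if "x > 0" "y > 1" for x y :: real
            using that by (simp add: field_simps)
          show ?thesis
            using *[of "real q ^ b" "real q"] q1 \<open>real (totient (q ^ a)) = _\<close> by (simp add: b power_one_over)
        qed
        also have "\<dots> \<le> 2 / real q * (1 / real q) ^ a"
          using q1 by (intro mult_right_mono) (auto simp: field_simps)
        finally have "ln (real q) * (1 / real (totient (q ^ a)) - 1 / real (q ^ a)) \<le> ln (real q) * (2 / real q * (1 / real q) ^ a)"
          using q1 by (intro mult_left_mono) auto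
        then show "ln (real q) * (1 / real (totient (q ^ a)) - 1 / real (q ^ a)) \<le> 2 * ln (real q) / real q * (1 / real q) ^ a"
          by (simp add: mult_ac)
      qed
      also have "\<dots> = 2 * ln (real q) / real q * (\<Sum>a | a \<ge> 1 \<and> q ^ a \<le> n. (1 / real q) ^ a)" by (simp add: sum_distrib_left)
      \<comment> \<open>The geometric series from exponent 1 is 1 / (q - 1) <= 2 / q, so each prime
        contributes only O(ln q / q^2).\<close>
      also have "\<dots> \<le> 2 * ln (real q) / real q * (2 / real q)"
      proof (rule mult_left_mono)
        have "{a. a \<ge> 1 \<and> q ^ a \<le> n} \<subseteq> {1..<Suc n}"
        proof clarsimp
          fix a assume "q ^ a \<le> n"
          then show "a < Suc n" using power_gt_expt[of q a] prime_gt_1_nat[OF q] by simp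
        qed
        then have "(\<Sum>a | a \<ge> 1 \<and> q ^ a \<le> n. (1 / real q) ^ a) \<le> (\<Sum>a\<in>{1..<Suc n}. (1 / real q) ^ a)"
          by (intro sum_mono2) auto
        also have "\<dots> = (\<Sum>a<n. (1 / real q) * (1 / real q) ^ a)"
          using sum.shift_bounds_Suc_ivl[of "\<lambda>a. (1 / real q) ^ a" 0 n] by (simp only: One_nat_def power_Suc lessThan_atLeast0)
        also have "\<dots> = 1 / real q * (\<Sum>a<n. (1 / real q) ^ a)" by (simp add: sum_distrib_left)
        also have "\<dots> \<le> 1 / real q * (1 / (1 - 1 / real q))"
        proof (rule mult_left_mono)
          have "(\<lambda>a. (1 / real q) ^ a) sums (1 / (1 - 1 / real q))" using q1 by (intro geometric_sums) auto
          then show "(\<Sum>a<n. (1 / real q) ^ a) \<le> 1 / (1 - 1 / real q)"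
            using q1 by (metis sums_unique sums_summable sum_le_suminf finite_lessThan zero_le_power zero_le_divide_1_iff of_nat_0_le_iff)
        qed (use q1 in auto)
        also have "\<dots> \<le> 2 / real q" using q1 by (simp add: field_simps)
        finally show "(\<Sum>a | a \<ge> 1 \<and> q ^ a \<le> n. (1 / real q) ^ a) \<le> 2 / real q" .
      qed (use q1 in auto)
      also have "\<dots> = 4 * (ln (real q) / (real q)\<^sup>2)" by (simp add: power2_eq_square)
      also have "\<dots> \<le> 8 * real q powr (- (3/2))" using bound[of q] q1 by simp
      finally show ?thesis .
    qed
    have "(\<Sum>m\<in>{1..n}. mangoldt m / real (totient m)) - (\<Sum>m\<in>{1..n}. mangoldt m / real m)
       = (\<Sum>m\<in>{1..n}. mangoldt m * (1 / real (totient m) - 1 / real m))"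
      by (simp add: sum_subtractf right_diff_distrib)
    also have "\<dots> \<le> (\<Sum>q | prime q \<and> q \<le> n. 8 * real q powr (- (3/2)))"
      unfolding sum_mangoldt_prime_powers by (intro sum_mono inner) auto
    also have "\<dots> \<le> c"
      unfolding c_def by (intro sum_le_suminf summable) (auto intro: finite_subset[of _ "{..n}"])
    finally show ?thesis using mertens_upper[OF that] by simp
  qed
  then show ?thesis using that[of "4 + c"] \<open>c \<ge> 0\<close> by simp
qed

lemma prime_count_real: "prime_count (real n) = card {p. prime p \<and> p \<le> n}"
  by (simp add: prime_count_def)

lemma chebyshev_psi_le_prime_count: "chebyshev_psi n \<le> real (prime_count (real n)) * ln (real n)"
proof (cases "n = 0")
  case False
  have "chebyshev_psi n = (\<Sum>q | prime q \<and> q \<le> n. \<Sum>a | a \<ge> 1 \<and> q ^ a \<le> n. ln (real q))"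
    using sum_mangoldt_prime_powers[of "\<lambda>_. 1" n] by (simp add: chebyshev_psi_def)
  also have "\<dots> \<le> (\<Sum>q | prime q \<and> q \<le> n. ln (real n))"
  proof (rule sum_mono)
    fix q assume "q \<in> {q. prime q \<and> q \<le> n}"
    then have q: "prime q" "q > 1" using prime_gt_1_nat by auto
    obtain k where k: "q ^ k \<le> n" "n < q ^ Suc k" using ex_power_ivl1[of q n] q False by auto
    have "{a. a \<ge> 1 \<and> q ^ a \<le> n} \<subseteq> {1..k}"
    proof clarsimp
      fix a assume "q ^ a \<le> n"
      then have "q ^ a < q ^ Suc k" using k by linarith
      then show "a \<le> k" using q by (simp only: power_strict_increasing_iff)
    qed
    then have "card {a. a \<ge> 1 \<and> q ^ a \<le> n} \<le> k" using card_mono[of "{1..k}"] by fastforce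
    then have "(\<Sum>a | a \<ge> 1 \<and> q ^ a \<le> n. ln (real q)) \<le> real k * ln (real q)"
      using q by (auto intro!: mult_right_mono)
    also have "\<dots> = ln (real q ^ k)" using q by (simp add: ln_realpow)
    also have "real q ^ k \<le> real n" using k(1) by (metis of_nat_le_iff of_nat_power)
    then have "ln (real q ^ k) \<le> ln (real n)" using q False by (subst ln_le_cancel_iff) auto
    finally show "(\<Sum>a | a \<ge> 1 \<and> q ^ a \<le> n. ln (real q)) \<le> ln (real n)" .
  qed
  finally show ?thesis by (simp add: prime_count_real)
qed (simp add: chebyshev_psi_def)

text \<open>Chebyshev's lower bound, with 1/2 as a constant below ln 2. It makes every error of size
  o(n) negligible against the number of primes times ln n.\<close>

lemma prime_count_lower: "\<forall>\<^sub>F n in sequentially. real n / 2 \<le> real (prime_count (real n)) * ln (real n)"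
proof -
  have "\<forall>\<^sub>F n in sequentially. real n / 2 \<le> (real n - 1) * ln 2 - ln (real n)" 
  proof -
    have "((\<lambda>n. ((real n - 1) * ln 2 - ln (real n)) / real n) \<longlongrightarrow> ln 2) sequentially" by real_asymp
    moreover have "1 / 2 < (ln 2 :: real)" using ln2_ge_two_thirds by linarith
    ultimately have "\<forall>\<^sub>F n in sequentially. 1 / 2 < ((real n - 1) * ln 2 - ln (real n)) / real n"
      by (rule order_tendstoD)
    then show ?thesis using eventually_gt_at_top[of 0] by eventually_elim (simp add: field_simps)
  qed
  then show ?thesis using eventually_gt_at_top[of 2]
  proof eventually_elim
    case (elim n)
    define k where "k = n div 2"
    have k: "k > 0" "2 * k \<le> n" "n \<le> 2 * k + 1" using elim by (auto simp: k_def)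
    have "4 ^ k / (2 * real k) \<le> real ((2 * k) choose k)" using central_binomial_lower_bound[OF k(1)] by simp
    then have "ln (4 ^ k / (2 * real k)) \<le> ln (real ((2 * k) choose k))" using k(1) by (subst ln_le_cancel_iff) auto
    moreover have "ln (4 ^ k / (2 * real k)) = real (2 * k) * ln 2 - ln (real (2 * k))"
    proof -
      have "(4::real) ^ k = 2 ^ (2 * k)" by (simp add: power_mult)
      then show ?thesis using k(1) by (simp add: ln_div ln_realpow del: power_mult)
    qed
    moreover have "(real n - 1) * ln 2 \<le> real (2 * k) * ln 2" using k(3) by (intro mult_right_mono) auto
    moreover have "ln (real (2 * k)) \<le> ln (real n)" using k by (subst ln_le_cancel_iff) auto
    ultimately have "real n / 2 \<le> chebyshev_psi (2 * k)" using ln_central_binomial(2)[of k] elim(1) by linarith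
    also have "\<dots> \<le> chebyshev_psi n" using k by (intro chebyshev_psi_mono)
    also have "\<dots> \<le> real (prime_count (real n)) * ln (real n)" by (rule chebyshev_psi_le_prime_count)
    finally show ?case .
  qed
qed

section \<open>Large orders from the Elliott--Halberstam conjecture\<close>

lemma two_power_card_prime_factors_le:
  assumes "n > 0"
  shows "2 ^ card (prime_factors n) \<le> (n :: nat)"
proof -
  have "2 ^ card (prime_factors n) = (\<Prod>p\<in>prime_factors n. 2)" by simp
  also have "\<dots> \<le> (\<Prod>p\<in>prime_factors n. p ^ multiplicity p n)"
  proof (rule prod_mono, intro conjI)
    fix p assume p: "p \<in> prime_factors n"
    then have "p \<ge> 2" "multiplicity p n > 0" using prime_ge_2_nat by (auto simp: prime_factors_multiplicity)
    then show "2 \<le> p ^ multiplicity p n" using self_le_power[of p "multiplicity p n"] by linarith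
  qed simp
  also have "\<dots> = n" using assms by (simp add: prime_factorization_nat[symmetric])
  finally show ?thesis .
qed

text \<open>Such a p divides N^m - 1 for some m <= z, and this number has at most N m prime
  factors.\<close>

lemma card_small_ord_le:
  assumes "N \<ge> 2"
  shows "finite {p. prime p \<and> \<not> p dvd N \<and> ord p N \<le> z}"
    "card {p. prime p \<and> \<not> p dvd N \<and> ord p N \<le> z} \<le> N * z\<^sup>2"
proof -
  let ?A = "{p. prime p \<and> \<not> p dvd N \<and> ord p N \<le> z}"
  have pos: "N ^ m - 1 > 0" if "m \<in> {1..z}" for m
    using that assms one_less_power[of N m] by auto
  have sub: "?A \<subseteq> (\<Union>m\<in>{1..z}. prime_factors (N ^ m - 1))"
  proof
    fix p assume "p \<in> ?A"
    then have p: "prime p" "\<not> p dvd N" "ord p N \<le> z" by auto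
    then have cop: "coprime p N" by (simp add: prime_imp_coprime)
    then have m: "ord p N \<in> {1..z}" using p(3) by (simp add: Suc_le_eq)
    have "[N ^ ord p N = 1] (mod p)" by (rule ord)
    then have "p dvd N ^ ord p N - 1" by (rule cong_to_1_nat)
    then have "p \<in> prime_factors (N ^ ord p N - 1)" using pos[OF m] p(1) by (intro prime_factorsI) auto
    then show "p \<in> (\<Union>m\<in>{1..z}. prime_factors (N ^ m - 1))" using m by blast
  qed
  then show fin: "finite ?A" by (rule finite_subset) simp
  have "card ?A \<le> card (\<Union>m\<in>{1..z}. prime_factors (N ^ m - 1))" by (rule card_mono[OF _ sub]) simp
  also have "\<dots> \<le> (\<Sum>m\<in>{1..z}. card (prime_factors (N ^ m - 1)))" by (rule card_UN_le) simp
  also have "\<dots> \<le> (\<Sum>m\<in>{1..z}. N * z)"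
  proof (rule sum_mono)
    fix m assume m: "m \<in> {1..z}"
    have "2 ^ card (prime_factors (N ^ m - 1)) \<le> N ^ m - 1" by (rule two_power_card_prime_factors_le[OF pos[OF m]])
    \<comment> \<open>N < 2^N is a crude replacement for the binary logarithm of N.\<close>
    also have "\<dots> \<le> (2 ^ N) ^ m"
      using power_mono[of N "2 ^ N" m] less_exp[of N] by (simp add: le_diff_conv le_Suc_eq)
    also have "\<dots> = 2 ^ (N * m)" by (simp add: power_mult)
    finally have "card (prime_factors (N ^ m - 1)) \<le> N * m" by simp
    also have "\<dots> \<le> N * z" using m by simp
    finally show "card (prime_factors (N ^ m - 1)) \<le> N * z" .
  qed
  also have "\<dots> = N * z\<^sup>2" by (simp add: power2_eq_square)
  finally show "card ?A \<le> N * z\<^sup>2" .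
qed

text \<open>Counts all integers k = p - 1 up to n; the sum of n / r^2 over r >= W is dominated by a
  telescoping one.\<close>

lemma card_square_divisor_le:
  fixes W n :: nat
  assumes "W \<ge> 2"
  shows "real (card {p. prime p \<and> p \<le> n \<and> (\<exists>r\<ge>W. r\<^sup>2 dvd p - 1)}) \<le> real n / (real W - 1)"
proof -
  let ?A = "{p. prime p \<and> p \<le> n \<and> (\<exists>r\<ge>W. r\<^sup>2 dvd p - 1)}"
  let ?D = "\<lambda>r. {k. 1 \<le> k \<and> k \<le> n \<and> r\<^sup>2 dvd k}"
  have fin: "finite (?D r)" for r by (rule finite_subset[of _ "{..n}"]) auto
  have sub: "(\<lambda>p. p - 1) ` ?A \<subseteq> (\<Union>r\<in>{W..n}. ?D r)"
  proof clarify
    fix p r assume p: "prime p" "p \<le> n" "W \<le> r" "r\<^sup>2 dvd p - 1"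
    have "p - 1 \<ge> 1" using prime_ge_2_nat[OF p(1)] by simp
    then have "r\<^sup>2 \<le> p - 1" using p(4) by (intro dvd_imp_le) auto
    moreover have "r \<le> r\<^sup>2" by (simp add: power2_eq_square)
    ultimately show "p - 1 \<in> (\<Union>r\<in>{W..n}. ?D r)" using p \<open>p - 1 \<ge> 1\<close> by auto
  qed
  have cardD: "real (card (?D r)) \<le> real n / (real r)\<^sup>2" if "r \<ge> 1" for r
  proof -
    have "?D r \<subseteq> (\<lambda>j. r\<^sup>2 * j) ` {1..n div r\<^sup>2}"
    proof clarify
      fix k assume k: "1 \<le> k" "k \<le> n" "r\<^sup>2 dvd k"
      then obtain j where j: "k = r\<^sup>2 * j" by (auto elim: dvdE)
      then have "j \<ge> 1" using k by (cases j) auto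
      moreover have "j \<le> n div r\<^sup>2" using j k that by (simp add: less_eq_div_iff_mult_less_eq mult.commute)
      ultimately show "k \<in> (\<lambda>j. r\<^sup>2 * j) ` {1..n div r\<^sup>2}" using j by auto
    qed
    then have "card (?D r) \<le> card ((\<lambda>j. r\<^sup>2 * j) ` {1..n div r\<^sup>2})" by (intro card_mono) auto
    also have "\<dots> \<le> n div r\<^sup>2" using card_image_le[of "{1..n div r\<^sup>2}"] by simp
    finally have "real (card (?D r)) \<le> real (n div r\<^sup>2)" by simp
    also have "\<dots> \<le> real n / real (r\<^sup>2)"
      by (metis floor_divide_of_nat_eq of_int_floor_le of_int_of_nat_eq)
    finally show ?thesis by simp
  qed
  have inj: "inj_on (\<lambda>p. p - 1) ?A"
  proof (rule inj_onI)
    fix p q :: nat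
    assume "p \<in> ?A" "q \<in> ?A" "p - 1 = q - 1"
    then show "p = q" using prime_ge_2_nat[of p] prime_ge_2_nat[of q] by auto
  qed
  have "card ?A \<le> card (\<Union>r\<in>{W..n}. ?D r)"
    unfolding card_image[OF inj, symmetric] using fin by (intro card_mono sub) auto
  also have "\<dots> \<le> (\<Sum>r\<in>{W..n}. card (?D r))" by (rule card_UN_le) simp
  finally have "real (card ?A) \<le> real (\<Sum>r\<in>{W..n}. card (?D r))"
    by (simp only: of_nat_le_iff)
  also have "\<dots> = (\<Sum>r\<in>{W..n}. real (card (?D r)))" by (rule of_nat_sum)
  also have "\<dots> \<le> (\<Sum>r\<in>{W..n}. real n * (1 / (real r - 1) - 1 / real r))"
  proof (rule sum_mono)
    fix r assume r: "r \<in> {W..n}"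
    then have r2: "real r \<ge> 2" using assms by simp
    have "real (card (?D r)) \<le> real n * (1 / (real r)\<^sup>2)" using cardD[of r] r assms by simp
    also have "1 / (real r)\<^sup>2 \<le> 1 / ((real r - 1) * real r)"
      using r2 by (intro divide_left_mono) (auto simp: power2_eq_square)
    also have "\<dots> = 1 / (real r - 1) - 1 / real r" using r2 by (simp add: field_simps)
    finally show "real (card (?D r)) \<le> real n * (1 / (real r - 1) - 1 / real r)" by (simp add: mult_left_mono)
  qed
  also have "\<dots> = real n * (\<Sum>r\<in>{W..n}. 1 / (real r - 1) - 1 / real r)" by (simp add: sum_distrib_left)
  also have "(\<Sum>r\<in>{W..n}. 1 / (real r - 1) - 1 / real r) \<le> 1 / (real W - 1)"
  proof (cases "W \<le> n")
    case True
    have "(\<Sum>r\<in>{W..n}. 1 / (real r - 1) - 1 / real r) = (\<Sum>r\<in>{W..n}. (- 1 / (real (Suc r) - 1)) - (- 1 / (real r - 1)))"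
      by (intro sum.cong) auto
    also have "\<dots> = (- 1 / (real (Suc n) - 1)) - (- 1 / (real W - 1))"
      using True by (intro sum_Suc_diff) auto
    also have "\<dots> \<le> 1 / (real W - 1)" by simp
    finally show ?thesis .
  qed (use assms in simp)
  finally show ?thesis by (simp add: mult_left_mono)
qed

text \<open>The witness is q to the power a div 2; the worst case a = 3 dictates the cube, and with
  it the exponent \<theta> / 3 below.\<close>

lemma prime_power_cube_le_square:
  fixes q a :: nat
  assumes "q \<ge> 1" "a \<ge> 2"
  obtains r where "r\<^sup>2 dvd q ^ a" "q ^ a \<le> r ^ 3"
proof
  show "(q ^ (a div 2))\<^sup>2 dvd q ^ a" by (simp add: le_imp_power_dvd flip: power_mult)
  have "a \<le> a div 2 * 3" using assms(2) by linarith
  then show "q ^ a \<le> (q ^ (a div 2)) ^ 3" using assms(1) by (simp add: power_increasing flip: power_mult)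
qed

text \<open>A proper prime power contributes a large square. If m is a prime q, then either q
  divides the order, which is then large, or q is coprime to it and q times the order divides p - 1,
  so the order is small.\<close>

lemma large_prime_power_factor_cases:
  fixes N p n :: nat and y :: real
  assumes p: "prime p" "p \<le> n" "\<not> p dvd N" and m: "primepow m" "m dvd p - 1" "real m > y" and y: "y \<ge> 1"
  shows "real (ord p N) > y \<or> real (ord p N) \<le> real n / y \<or> (\<exists>r. real r ^ 3 > y \<and> r\<^sup>2 dvd p - 1)"
proof -
  have p2: "p \<ge> 2" by (rule prime_ge_2_nat[OF p(1)])
  obtain q a where q: "prime q" "a > 0" "m = q ^ a" using m(1) by (auto simp: primepow_def)
  show ?thesis
  proof (cases "a \<ge> 2")
    case True
    obtain r where r: "r\<^sup>2 dvd q ^ a" "q ^ a \<le> r ^ 3"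
      using prime_power_cube_le_square[OF _ True, of q] prime_ge_1_nat[OF q(1)] by blast
    have "y < real (r ^ 3)" using m(3) q(3) r(2) by (metis le_less_trans less_le_trans of_nat_le_iff)
    moreover have "r\<^sup>2 dvd p - 1" using r(1) m(2) q(3) dvd_trans by blast
    ultimately show ?thesis by auto
  next
    case False
    then have "m = q" using q by (simp add: not_le less_2_cases_iff)
    have cop: "coprime p N" using p by (simp add: prime_imp_coprime)
    then have ordpos: "ord p N > 0" by simp
    have "ord p N dvd totient p" using cop by (intro order_divides_totient) (simp add: coprime_commute)
    then have ord: "ord p N dvd p - 1" using p(1) by (simp add: totient_prime)
    show ?thesis
    proof (cases "q dvd ord p N")
      case True
      then have "q \<le> ord p N" using ordpos by (rule dvd_imp_le)
      then have "real (ord p N) > y" using m(3) \<open>m = q\<close> by linarith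
      then show ?thesis by blast
    next
      case False
      then have "coprime q (ord p N)" using q(1) by (simp add: prime_imp_coprime)
      then have "q * ord p N dvd p - 1" using ord m(2) \<open>m = q\<close> by (intro divides_mult) auto
      then have "q * ord p N \<le> p - 1" using p2 by (intro dvd_imp_le) auto
      then have "q * ord p N \<le> n" using p(2) by linarith
      then have "real q * real (ord p N) \<le> real n" by (metis of_nat_le_iff of_nat_mult)
      moreover have "y * real (ord p N) \<le> real q * real (ord p N)"
        using m(3) \<open>m = q\<close> by (intro mult_right_mono) auto
      ultimately have "real (ord p N) \<le> real n / y" using y by (simp add: field_simps)
      then show ?thesis by blast
    qed
  qed
qed

section \<open>Primes p such that p - 1 has only small prime power factors\<close>

text \<open>Write ln (p - 1) as a sum of \<open>mangoldt\<close> over the divisors of p - 1 and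
  exchange the sums: the p with m | p - 1 are the primes congruent to 1 modulo m.\<close>

lemma sum_ln_pred_le:
  fixes y :: real
  assumes G: "\<And>p. p \<in> G \<Longrightarrow> prime p \<and> p \<le> n \<and> (\<forall>m. primepow m \<and> m dvd p - 1 \<longrightarrow> real m \<le> y)"
  shows "(\<Sum>p\<in>G. ln (real (p - 1))) \<le> (\<Sum>m\<in>{1..nat \<lfloor>y\<rfloor>}. mangoldt m * real (prime_count_mod (real n) m 1))"
proof -
  have finG: "finite G" using G by (intro finite_subset[of G "{..n}"]) auto
  have "(\<Sum>p\<in>G. ln (real (p - 1))) = (\<Sum>p\<in>G. \<Sum>m\<in>{1..nat \<lfloor>y\<rfloor>}. if m dvd p - 1 then mangoldt m else 0)"
  proof (rule sum.cong[OF refl])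
    fix p assume "p \<in> G"
    note p = G[OF this]
    then have p2: "p - 1 \<noteq> 0" using prime_ge_2_nat[of p] by simp
    have "ln (real (p - 1)) = (\<Sum>m | m dvd p - 1. mangoldt m)" using mangoldt_sum[OF p2, where 'a = real] by simp
    also have "\<dots> = (\<Sum>m | m dvd p - 1 \<and> primepow m. mangoldt m)"
      using p2 by (intro sum.mono_neutral_right) (auto simp: mangoldt_def)
    also have "\<dots> = (\<Sum>m\<in>{1..nat \<lfloor>y\<rfloor>}. if m dvd p - 1 then mangoldt m else 0)"
    proof (rule sum.mono_neutral_cong_left)
      show "{m. m dvd p - 1 \<and> primepow m} \<subseteq> {1..nat \<lfloor>y\<rfloor>}"
      proof clarify
        fix m assume m: "m dvd p - 1" "primepow m"
        then have "real m \<le> y" using p by blast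
        moreover have "m \<ge> 1" using m(2) primepow_gt_Suc_0[of m] by simp
        ultimately show "m \<in> {1..nat \<lfloor>y\<rfloor>}" by (simp add: le_nat_floor)
      qed
    qed (auto simp: mangoldt_def)
    finally show "ln (real (p - 1)) = (\<Sum>m\<in>{1..nat \<lfloor>y\<rfloor>}. if m dvd p - 1 then mangoldt m else 0)" .
  qed
  also have "\<dots> = (\<Sum>m\<in>{1..nat \<lfloor>y\<rfloor>}. \<Sum>p\<in>G. if m dvd p - 1 then mangoldt m else 0)" by (rule sum.swap)
  also have "\<dots> \<le> (\<Sum>m\<in>{1..nat \<lfloor>y\<rfloor>}. mangoldt m * real (prime_count_mod (real n) m 1))"
  proof (rule sum_mono)
    fix m
    have "(\<Sum>p\<in>G. if m dvd p - 1 then mangoldt m else 0 :: real) = mangoldt m * real (card {p \<in> G. m dvd p - 1})"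
      using finG by (simp add: sum.If_cases Int_def mult.commute)
    also have "\<dots> \<le> mangoldt m * real (prime_count_mod (real n) m 1)"
    proof (intro mult_left_mono mangoldt_nonneg)
      have "{p \<in> G. m dvd p - 1} \<subseteq> {p. prime p \<and> real p \<le> real n \<and> [int p = 1] (mod int m)}"
      proof clarify
        fix p assume p: "p \<in> G" "m dvd p - 1"
        then have "p \<ge> 1" using G prime_ge_1_nat by blast
        then have "int m dvd int p - 1" using p(2) by (metis int_dvd_int_iff of_nat_1 of_nat_diff)
        then show "prime p \<and> real p \<le> real n \<and> [int p = 1] (mod int m)" using G[OF p(1)] by (simp add: cong_iff_dvd_diff)
      qed
      moreover have "finite {p. prime p \<and> real p \<le> real n \<and> [int p = 1] (mod int m)}"
        by (rule finite_subset[of _ "{..n}"]) auto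
      ultimately show "real (card {p \<in> G. m dvd p - 1}) \<le> real (prime_count_mod (real n) m 1)"
        unfolding prime_count_mod_def by (simp add: card_mono)
    qed
    finally show "(\<Sum>p\<in>G. if m dvd p - 1 then mangoldt m else 0) \<le> mangoldt m * real (prime_count_mod (real n) m 1)" .
  qed
  finally show ?thesis .
qed

text \<open>At most u + 1 members have p - 1 < u, and each of the others contributes at least ln u.
  Used with u = n^(1 - \<epsilon>), this loses only the factor 1 - \<epsilon> against ln n.\<close>

lemma sum_ln_pred_ge:
  fixes u :: real
  assumes G: "finite G" "\<And>p. p \<in> G \<Longrightarrow> p \<ge> (1::nat)" and u: "u \<ge> 1"
  shows "(real (card G) - (u + 1)) * ln u \<le> (\<Sum>p\<in>G. ln (real (p - 1)))"
proof -
  define G' where "G' = {p \<in> G. real (p - 1) \<ge> u}"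
  have "G - G' \<subseteq> {p. 1 \<le> p \<and> p \<le> Suc (nat \<lfloor>u\<rfloor>)}"
  proof
    fix p assume "p \<in> G - G'"
    then have "p \<ge> 1" "real (p - 1) \<le> u" using G(2) by (auto simp: G'_def)
    then show "p \<in> {p. 1 \<le> p \<and> p \<le> Suc (nat \<lfloor>u\<rfloor>)}" using le_nat_floor[of "p - 1" u] by simp
  qed
  then have "card (G - G') \<le> card {1..Suc (nat \<lfloor>u\<rfloor>)}" by (intro card_mono) (auto simp: atLeastAtMost_def)
  moreover have "real (Suc (nat \<lfloor>u\<rfloor>)) \<le> u + 1" using u by (simp add: of_nat_floor)
  ultimately have "real (card (G - G')) \<le> u + 1" by simp
  moreover have "card G = card (G - G') + card G'"
    using G(1) by (subst card_Un_disjoint[symmetric]) (auto simp: G'_def intro: arg_cong[of _ _ card])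
  ultimately have "real (card G) - (u + 1) \<le> real (card G')" by simp
  then have "(real (card G) - (u + 1)) * ln u \<le> real (card G') * ln u" using u by (intro mult_right_mono) auto
  also have "\<dots> = (\<Sum>p\<in>G'. ln u)" by simp
  also have "\<dots> \<le> (\<Sum>p\<in>G'. ln (real (p - 1)))"
    using u by (intro sum_mono) (auto simp: G'_def)
  also have "\<dots> \<le> (\<Sum>p\<in>G. ln (real (p - 1)))"
    using G(1)
  proof (rule sum_mono2)
    fix p assume "p \<in> G - G'"
    \<comment> \<open>For p = 1 this rests on the convention ln 0 = 0.\<close>
    show "0 \<le> ln (real (p - 1))" by (cases "p - 1 = 0") (auto simp: Suc_le_eq)
  qed (auto simp: G'_def)
  finally show ?thesis .
qed

lemma EH_error_le_max: "y \<le> x \<Longrightarrow> coprime a (int q) \<Longrightarrow> EH_error q y a \<le> EH_max_error q x"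
proof -
  assume y: "y \<le> x" and a: "coprime a (int q)"
  have "EH_error q y a \<le> (MAX a\<in>{a. coprime a (int q)}. EH_error q y a)"
    using a by (intro Max_ge EH_inner_finite) auto
  also have "\<dots> \<le> EH_max_error q x"
    unfolding EH_max_error_def using y by (intro Max_ge EH_outer_finite) auto
  finally show ?thesis .
qed

text \<open>Replacing each count by its expected value leaves a Mertens sum. Bounding
  \<open>mangoldt m\<close> by ln n in the error costs one logarithm, so the conjecture is later
  applied with the exponent A = 2.\<close>

lemma sum_mangoldt_prime_count_mod_le:
  fixes n :: nat and y :: real
  assumes c: "\<And>n. n > 0 \<Longrightarrow> (\<Sum>m\<in>{1..n}. mangoldt m / real (totient m)) \<le> ln (real n) + c"
    and y: "1 \<le> y" "y \<le> real n"
    and EH: "(\<Sum>q | 1 \<le> q \<and> real q \<le> y. EH_max_error q (real n)) \<le> E"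
  shows "(\<Sum>m\<in>{1..nat \<lfloor>y\<rfloor>}. mangoldt m * real (prime_count_mod (real n) m 1))
    \<le> real (prime_count (real n)) * (ln y + c) + ln (real n) * E"
proof -
  let ?\<pi> = "real (prime_count (real n))"
  have set: "{q. 1 \<le> q \<and> real q \<le> y} = {1..nat \<lfloor>y\<rfloor>}" using y by (auto simp: le_nat_floor le_nat_iff le_floor_iff)
  have n: "n \<ge> 1" using y by linarith
  have "(\<Sum>m\<in>{1..nat \<lfloor>y\<rfloor>}. mangoldt m * real (prime_count_mod (real n) m 1))
     \<le> (\<Sum>m\<in>{1..nat \<lfloor>y\<rfloor>}. ?\<pi> * (mangoldt m / real (totient m)) + ln (real n) * EH_max_error m (real n))"
  proof (rule sum_mono)
    fix m assume m: "m \<in> {1..nat \<lfloor>y\<rfloor>}"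
    have "\<bar>real (prime_count_mod (real n) m 1) - ?\<pi> / real (totient m)\<bar> \<le> EH_max_error m (real n)"
      using EH_error_le_max[of "real n" "real n" 1 m] by (simp add: EH_error_def)
    then have le: "real (prime_count_mod (real n) m 1) \<le> ?\<pi> / real (totient m) + EH_max_error m (real n)"
      and nonneg: "0 \<le> EH_max_error m (real n)" by linarith+
    have "mangoldt m * real (prime_count_mod (real n) m 1) \<le> mangoldt m * (?\<pi> / real (totient m)) + mangoldt m * EH_max_error m (real n)"
      using mult_left_mono[OF le mangoldt_nonneg[of m]] by (simp add: distrib_left)
    also have "mangoldt m * EH_max_error m (real n) \<le> ln (real n) * EH_max_error m (real n)"
    proof (rule mult_right_mono[OF _ nonneg])
      have "real m \<le> real n" using m y le_floor_iff by (auto simp: le_nat_iff) linarith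
      then have "ln (real m) \<le> ln (real n)" using m by simp
      then show "mangoldt m \<le> ln (real n)" using mangoldt_le[of m] m by simp
    qed
    finally show "mangoldt m * real (prime_count_mod (real n) m 1) \<le> ?\<pi> * (mangoldt m / real (totient m)) + ln (real n) * EH_max_error m (real n)"
      by (simp add: mult_ac)
  qed
  also have "\<dots> = ?\<pi> * (\<Sum>m\<in>{1..nat \<lfloor>y\<rfloor>}. mangoldt m / real (totient m)) + ln (real n) * (\<Sum>m\<in>{1..nat \<lfloor>y\<rfloor>}. EH_max_error m (real n))"
    by (simp add: sum.distrib sum_distrib_left)
  also have "\<dots> \<le> ?\<pi> * (ln y + c) + ln (real n) * E"
  proof (intro add_mono mult_left_mono)
    have fl: "nat \<lfloor>y\<rfloor> > 0" "real (nat \<lfloor>y\<rfloor>) \<le> y" using y by (auto simp: of_nat_floor)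
    have "(\<Sum>m\<in>{1..nat \<lfloor>y\<rfloor>}. mangoldt m / real (totient m)) \<le> ln (real (nat \<lfloor>y\<rfloor>)) + c" by (rule c[OF fl(1)])
    also have "ln (real (nat \<lfloor>y\<rfloor>)) \<le> ln y" using fl y by (subst ln_le_cancel_iff) auto
    finally show "(\<Sum>m\<in>{1..nat \<lfloor>y\<rfloor>}. mangoldt m / real (totient m)) \<le> ln y + c" by simp
    show "(\<Sum>m\<in>{1..nat \<lfloor>y\<rfloor>}. EH_max_error m (real n)) \<le> E" using EH unfolding set .
  qed (use n in auto)
  finally show ?thesis .
qed

text \<open>If no such p existed, nearly all primes up to n would have p - 1 composed of prime
  powers at most n^\<theta>. Their logarithms would then sum to about (1 - \<epsilon>) \<pi>(n) ln
  n, while those prime powers supply only about \<theta> \<pi>(n) ln n.\<close>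

lemma eh_large_ord_exists:
  assumes EH: "elliott_halberstam_conjecture" and N: "N \<ge> 2" and \<theta>: "7/8 \<le> \<theta>" "\<theta> < 1"
  shows "\<forall>\<^sub>F n in sequentially. \<exists>p. prime p \<and> p \<le> n \<and> \<not> p dvd N \<and> real n powr \<theta> < real (ord p N)"
proof -
  \<comment> \<open>Half of the gap to 1, so that (1 - \<epsilon>) - \<theta> = \<epsilon> is the
    surplus that produces the contradiction.\<close>
  define \<epsilon> where "\<epsilon> = (1 - \<theta>) / 2"
  have \<epsilon>: "\<epsilon> > 0" "\<epsilon> < 1" using \<theta> by (auto simp: \<epsilon>_def)
  obtain C where C: "\<And>x. x > 2 \<Longrightarrow> (\<Sum>q | 1 \<le> q \<and> real q \<le> x powr \<theta>. EH_max_error q x) \<le> C * x / (ln x) powr 2"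
    using EH[unfolded elliott_halberstam_conjecture_def, rule_format, of \<theta> 2] \<theta> by auto
  obtain c where c: "c \<ge> 0" "\<And>n. n > 0 \<Longrightarrow> (\<Sum>m\<in>{1..n}. mangoldt m / real (totient m)) \<le> ln (real n) + c"
    by (rule mertens_totient) blast
  \<comment> \<open>Bounds for the exceptional primes, times ln n: divisors of N, large squares in p
    - 1, small orders, and p - 1 below n^(1 - \<epsilon>). The last term is the Elliott--Halberstam
    error. Since \<theta> >= 7/8 gives 2 - 2 \<theta> < 1, all of this is o(n).\<close>
  define err where "err n = (real N + 1 + 2 * real n powr (1 - \<theta> / 3) + real N * real n powr (2 - 2 * \<theta>) + real n powr (1 - \<epsilon>)) * ln (real n) + C * real n / ln (real n)" for n :: nat
  have err: "\<forall>\<^sub>F n in sequentially. err n < \<epsilon> / 4 * real n"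
  proof -
    have lim: "(\<lambda>n. real n powr a * ln (real n) / real n) \<longlonglongrightarrow> 0" if "a < 1" for a
    proof -
      define d where "d = 1 - a"
      have "d > 0" using that by (simp add: d_def)
      have "a = 1 - d" by (simp add: d_def)
      then show ?thesis using \<open>d > 0\<close> by real_asymp
    qed
    define h where "h n = (real N + 1) * (real n powr 0 * ln (real n) / real n) + 2 * (real n powr (1 - \<theta> / 3) * ln (real n) / real n)
       + real N * (real n powr (2 - 2 * \<theta>) * ln (real n) / real n) + real n powr (1 - \<epsilon>) * ln (real n) / real n + C / ln (real n)" for n :: nat
    have "h \<longlonglongrightarrow>
       (real N + 1) * 0 + 2 * 0 + real N * 0 + 0 + 0"
      unfolding h_def
    proof (intro tendsto_add tendsto_mult_left lim)
      show "(\<lambda>n. C / ln (real n)) \<longlonglongrightarrow> 0" by real_asymp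
    qed (use \<theta> \<epsilon> in auto)
    then have "\<forall>\<^sub>F n in sequentially. h n < \<epsilon> / 4"
      using \<epsilon> by (intro order_tendstoD) auto
    then show ?thesis using eventually_gt_at_top[of 1]
    proof eventually_elim
      case (elim n)
      have "err n / real n = h n"
        using elim(2) by (simp add: err_def h_def add_divide_distrib distrib_right)
      with elim(1) have "err n / real n < \<epsilon> / 4" by simp
      then show ?case using elim(2) by (simp add: field_simps)
    qed
  qed
  have lnlarge: "\<forall>\<^sub>F n in sequentially. 2 * c \<le> \<epsilon> * ln (real n)"
  proof -
    have "filterlim (\<lambda>n. \<epsilon> * ln (real n)) at_top sequentially" using \<epsilon>(1) by real_asymp
    then show ?thesis by (simp add: filterlim_at_top)
  qed
  have ylarge: "\<forall>\<^sub>F n in sequentially. 2 \<le> real n powr (\<theta> / 3)"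
  proof -
    have "\<theta> / 3 > 0" using \<theta> by simp
    then have "filterlim (\<lambda>n. real n powr (\<theta> / 3)) at_top sequentially" by real_asymp
    then show ?thesis by (simp add: filterlim_at_top)
  qed
  show ?thesis using err lnlarge ylarge prime_count_lower eventually_gt_at_top[of 2]
  proof eventually_elim
    case (elim n)
    show ?case
    proof (rule ccontr)
      assume no: "\<not> (\<exists>p. prime p \<and> p \<le> n \<and> \<not> p dvd N \<and> real n powr \<theta> < real (ord p N))"
      define y where "y = real n powr \<theta>"
      define u where "u = real n powr (1 - \<epsilon>)"
      \<comment> \<open>\<open>W\<close> and \<open>z\<close> translate the cases of
        \<open>large_prime_power_factor_cases\<close>: r^3 > y gives r >= W, and an order at most n
        / y is at most z.\<close>
      define W where "W = nat \<lceil>real n powr (\<theta> / 3)\<rceil>"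
      define z where "z = nat \<lfloor>real n / y\<rfloor>"
      define \<pi> where "\<pi> = real (prime_count (real n))"
      have n: "real n > 2" "ln (real n) > 0" using elim by auto
      have y: "1 \<le> y" "y \<le> real n" "ln y = \<theta> * ln (real n)"
        using n \<theta> powr_mono[of \<theta> 1 "real n"] by (auto simp: y_def ln_powr intro!: ge_one_powr_ge_zero)
      have u: "1 \<le> u" "ln u = (1 - \<epsilon>) * ln (real n)"
        using n \<epsilon> by (auto simp: u_def ln_powr intro!: ge_one_powr_ge_zero)
      have W: "W \<ge> 2" "real W \<ge> real n powr (\<theta> / 3)"
        using elim(3) unfolding W_def by linarith+
      define G where "G = {p. prime p \<and> p \<le> n \<and> (\<forall>m. primepow m \<and> m dvd p - 1 \<longrightarrow> real m \<le> y)}"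
      define D where "D = {p. prime p \<and> p \<le> n \<and> (\<exists>r\<ge>W. r\<^sup>2 dvd p - 1)}"
      define S where "S = {p. prime p \<and> \<not> p dvd N \<and> ord p N \<le> z}"
      have fin: "finite G" "finite D" "finite S" "finite {p. p dvd N}"
        using N card_small_ord_le(1)[OF N] by (auto simp: G_def D_def S_def intro: finite_subset[of _ "{..n}"])
      have cover: "{p. prime p \<and> p \<le> n} \<subseteq> G \<union> D \<union> S \<union> {p. p dvd N}"
      proof (rule subsetI, rule ccontr)
        fix p assume "p \<in> {p. prime p \<and> p \<le> n}" and notin: "p \<notin> G \<union> D \<union> S \<union> {p. p dvd N}"
        then have p: "prime p" "p \<le> n" "\<not> p dvd N" "p \<notin> S" "p \<notin> D" by auto
        have "real m \<le> y" if m: "primepow m" "m dvd p - 1" for m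
        proof (rule ccontr)
          assume "\<not> real m \<le> y"
          then have "real m > y" by simp
          from large_prime_power_factor_cases[OF p(1-3) m this y(1)] consider
            "real (ord p N) > y" | "real (ord p N) \<le> real n / y" | r where "real r ^ 3 > y" "r\<^sup>2 dvd p - 1" by blast
          then show False
          proof cases
            case 1
            then show False using no p unfolding y_def by blast
          next
            case 2
            then have "ord p N \<le> z" by (simp add: z_def le_nat_floor)
            then show False using p by (simp add: S_def)
          next
            case 3
            have "real r > real n powr (\<theta> / 3)"
            proof (rule power_less_imp_less_base)
              have "(real n powr (\<theta> / 3)) ^ 3 = (real n powr (\<theta> / 3)) powr 3" using n by (simp add: powr_numeral)
              also have "\<dots> = y" by (simp add: y_def powr_powr)
              finally show "(real n powr (\<theta> / 3)) ^ 3 < real r ^ 3" using 3 by simp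
            qed simp
            then have "r \<ge> W" by (simp add: W_def nat_le_iff ceiling_le_iff)
            then show False using 3 p by (auto simp: D_def)
          qed
        qed
        then show False using p notin by (auto simp: G_def)
      qed
      have "\<pi> \<le> real (card (G \<union> D \<union> S \<union> {p. p dvd N}))"
        unfolding \<pi>_def prime_count_real using fin by (intro of_nat_mono card_mono cover) auto
      also have "\<dots> \<le> real (card G + card D + card S + card {p. p dvd N})"
        using card_Un_le[of "G \<union> D \<union> S" "{p. p dvd N}"] card_Un_le[of "G \<union> D" S] card_Un_le[of G D] by simp
      finally have "\<pi> \<le> real (card G) + real (card D) + real (card S) + real (card {p. p dvd N})" by simp
      moreover have "real (card D) \<le> 2 * real n powr (1 - \<theta> / 3)"
      proof -
        have "real (card D) \<le> real n / (real W - 1)" unfolding D_def by (rule card_square_divisor_le[OF W(1)])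
        also have "\<dots> \<le> real n / (real n powr (\<theta> / 3) / 2)"
          using W elim(3) n by (intro divide_left_mono mult_pos_pos) auto
        also have "\<dots> = 2 * real n powr (1 - \<theta> / 3)" using n by (simp add: powr_diff)
        finally show ?thesis .
      qed
      moreover have "real (card S) \<le> real N * real n powr (2 - 2 * \<theta>)"
      proof -
        have "real (card S) \<le> real (N * z\<^sup>2)" unfolding S_def using card_small_ord_le(2)[OF N] by (simp only: of_nat_le_iff)
        also have "\<dots> = real N * (real z)\<^sup>2" by simp
        also have "\<dots> \<le> real N * (real n / y)\<^sup>2"
          using y n by (intro mult_left_mono power_mono) (auto simp: z_def of_nat_floor)
        also have "real n / y = real n powr (1 - \<theta>)" using n by (simp add: y_def powr_diff)
        also have "(real n powr (1 - \<theta>))\<^sup>2 = real n powr (2 - 2 * \<theta>)"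
          by (simp add: power2_eq_square flip: powr_add)
        finally show ?thesis .
      qed
      moreover have "real (card {p. p dvd N}) \<le> real N"
      proof -
        have "{p. p dvd N} \<subseteq> {1..N}" using N dvd_imp_le[of _ N] by (auto simp: Suc_le_eq intro!: Nat.gr0I)
        then have "card {p. p dvd N} \<le> card {1..N}" by (intro card_mono) auto
        then show ?thesis by simp
      qed
      ultimately have G: "\<pi> - (real N + 1 + 2 * real n powr (1 - \<theta> / 3) + real N * real n powr (2 - 2 * \<theta>) + u) \<le> real (card G) - (u + 1)"
        by linarith
      define r where "r = real N + 1 + 2 * real n powr (1 - \<theta> / 3) + real N * real n powr (2 - 2 * \<theta>) + u"
      have "r \<ge> 0" using u by (auto simp: r_def)
      have "(\<pi> - r) * ln u \<le> (real (card G) - (u + 1)) * ln u"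
        by (rule mult_right_mono[OF G[folded r_def] ln_ge_zero[OF u(1)]])
      also have "\<dots> \<le> (\<Sum>p\<in>G. ln (real (p - 1)))"
        by (rule sum_ln_pred_ge[OF fin(1) _ u(1)]) (use prime_ge_1_nat in \<open>auto simp: G_def\<close>)
      also have "\<dots> \<le> (\<Sum>m\<in>{1..nat \<lfloor>y\<rfloor>}. mangoldt m * real (prime_count_mod (real n) m 1))"
        by (intro sum_ln_pred_le) (auto simp: G_def)
      also have "\<dots> \<le> \<pi> * (ln y + c) + ln (real n) * (C * real n / (ln (real n)) powr 2)"
        unfolding \<pi>_def using C[of "real n"] n by (intro sum_mangoldt_prime_count_mod_le c y) (auto simp: y_def)
      also have "ln (real n) * (C * real n / (ln (real n)) powr 2) = C * real n / ln (real n)"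
        using n by (simp add: powr_numeral power2_eq_square)
      finally have main: "(\<pi> - r) * ((1 - \<epsilon>) * ln (real n)) \<le> \<pi> * (\<theta> * ln (real n) + c) + C * real n / ln (real n)"
        by (simp add: u y)
      have "\<pi> * (\<epsilon> * ln (real n) - c) = \<pi> * ((1 - \<epsilon>) * ln (real n)) - \<pi> * (\<theta> * ln (real n) + c)"
        unfolding \<epsilon>_def by (simp add: field_simps)
      also have "\<dots> \<le> r * ((1 - \<epsilon>) * ln (real n)) + C * real n / ln (real n)"
        using main by (simp add: left_diff_distrib)
      also have "\<dots> \<le> r * (1 * ln (real n)) + C * real n / ln (real n)"
        using \<open>r \<ge> 0\<close> \<epsilon> n by (intro add_right_mono mult_left_mono mult_right_mono) auto
      also have "\<dots> = err n" by (simp add: err_def r_def u_def)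
      also have "\<dots> < \<epsilon> / 4 * real n" by (rule elim(1))
      also have "\<dots> = \<epsilon> / 2 * (real n / 2)" by simp
      also have "\<dots> \<le> \<epsilon> / 2 * (\<pi> * ln (real n))" using elim(4) \<epsilon> unfolding \<pi>_def by (intro mult_left_mono) auto
      also have "\<dots> = \<pi> * (\<epsilon> / 2 * ln (real n))" by simp
      also have "\<dots> \<le> \<pi> * (\<epsilon> * ln (real n) - c)"
        using elim(2) by (intro mult_left_mono) (auto simp: \<pi>_def)
      finally show False by simp
    qed
  qed
qed

text \<open>An order above n^\<theta> forces p itself above n^\<theta>, so the primes found are
  unbounded as n grows; and p <= n turns the bound into one by p^\<theta>, which beats K p^s because
  \<theta> is chosen above s.\<close>

lemma eh_large_ord:
  assumes EH: "elliott_halberstam_conjecture" and N: "N \<ge> 2" and s: "s < 1"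
  shows "infinite {p. prime p \<and> \<not> p dvd N \<and> K * real p powr s < real (ord p N)}"
proof -
  define \<theta> where "\<theta> = max (7/8) ((1 + s) / 2)"
  have \<theta>: "7/8 \<le> \<theta>" "\<theta> < 1" "s < \<theta>" using s by (auto simp: \<theta>_def less_max_iff_disj)
  have "\<forall>\<^sub>F p in sequentially. K * real p powr s < real p powr \<theta>"
  proof -
    define d where "d = \<theta> - s"
    have "d > 0" using \<theta> by (simp add: d_def)
    then have "filterlim (\<lambda>p. real p powr d) at_top sequentially" by real_asymp
    then have "\<forall>\<^sub>F p in sequentially. K < real p powr d" by (simp add: filterlim_at_top_dense)
    then show ?thesis using eventually_gt_at_top[of 0]
    proof eventually_elim
      case (elim p)
      then have "K * real p powr s < real p powr d * real p powr s" by (intro mult_strict_right_mono) auto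
      then show ?case by (simp add: d_def flip: powr_add)
    qed
  qed
  then obtain P where P: "\<And>p. p \<ge> P \<Longrightarrow> K * real p powr s < real p powr \<theta>"
    by (auto simp: eventually_sequentially)
  have "\<exists>p>m. prime p \<and> \<not> p dvd N \<and> K * real p powr s < real (ord p N)" for m
  proof -
    have "\<theta> > 0" using \<theta> by simp
    then have "filterlim (\<lambda>n. real n powr \<theta>) at_top sequentially" by real_asymp
    then have "\<forall>\<^sub>F n in sequentially. real (m + P) < real n powr \<theta>" by (simp only: filterlim_at_top_dense)
    from eventually_conj[OF this eh_large_ord_exists[OF EH N \<theta>(1,2)]]
    obtain n p where np: "real (m + P) < real n powr \<theta>" "prime p" "p \<le> n" "\<not> p dvd N" "real n powr \<theta> < real (ord p N)"
      using eventually_happens'[OF sequentially_bot] by blast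
    have "coprime N p" using np by (metis coprime_commute prime_imp_coprime)
    then have "ord p N dvd totient p" by (intro order_divides_totient) (simp add: coprime_commute)
    then have "ord p N \<le> totient p" using np(2) by (intro dvd_imp_le) (auto simp: prime_gt_0_nat)
    also have "\<dots> \<le> p" by (rule totient_le)
    finally have "real (m + P) < real p" using np by linarith
    then have "p > m" "p \<ge> P" by simp_all
    have "K * real p powr s < real p powr \<theta>" using P[OF \<open>p \<ge> P\<close>] .
    also have "\<dots> \<le> real n powr \<theta>" using np(3) \<open>\<theta> > 0\<close> by (intro powr_mono2) auto
    also note np(5)
    finally show ?thesis using np \<open>p > m\<close> by blast
  qed
  then show ?thesis by (simp add: infinite_nat_iff_unbounded)
qed

section \<open>Infinitely many spectral eigenvalues\<close>

theorem theorem1p3: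
  fixes N :: nat and B L :: "int set" and \<mu> :: "real measure"
  assumes "artin_conjecture \<or> elliott_halberstam_conjecture"
    and "hadamard_triple N B L"
    and "0 \<in> B \<inter> L"
    and "is_self_similar_measure N B \<mu>"
    and "singular_continuous \<mu>"
  shows "infinite {t. spectral_eigenvalue \<mu> (canonical_spectrum N B L) t}"
proof -
  interpret hadamard_measure N B L \<mu>
    using assms(2-4) by unfold_locales auto
  define s where "s = log N (card L)"
  have "s < 1"
    using singular_imp_few_digits[OF assms(2,4,5)] N_ge_2 card_B card_L by (simp add: s_def log_less_one_cancel_iff)
  obtain K where K: "\<And>p. prime p \<Longrightarrow> \<not> p dvd N \<Longrightarrow> K * real p powr s < real (ord p N) \<Longrightarrow>
      canonical_spectrum N B ((\<lambda>l. int p * l) ` L) = (\<lambda>x. real p * x) ` \<Lambda>"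
    using canonical_spectrum_scale_prime unfolding s_def by metis
  define S where "S = {p. prime p \<and> \<not> p dvd N \<and> K * real p powr s < real (ord p N)}"
  have "infinite S"
    using assms(1) artin_large_ord[OF _ N_ge_2 \<open>s < 1\<close>] eh_large_ord[OF _ N_ge_2 \<open>s < 1\<close>]
    unfolding S_def by blast
  moreover have "spectral_eigenvalue \<mu> \<Lambda> (real p)" if "p \<in> S" for p
  proof -
    have p: "prime p" "\<not> p dvd N" "K * real p powr s < real (ord p N)" using that by (auto simp: S_def)
    \<comment> \<open>Same B and same measure, new digit set: \<open>spectral_pair_canonical\<close>
      is applied a second time, and \<open>K\<close> identifies the resulting spectrum with p
      \<Lambda>.\<close>
    interpret scaled: hadamard_measure N B "(\<lambda>l. int p * l) ` L" \<mu>
      using hadamard_scale_prime[OF assms(2) p(1,2)] zero_B zero_L self_similar by unfold_locales auto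
    show ?thesis
      using spectral_pair_canonical scaled.spectral_pair_canonical K[OF p]
      by (simp add: spectral_eigenvalue_def)
  qed
  then have "real ` S \<subseteq> {t. spectral_eigenvalue \<mu> \<Lambda> t}" by blast
  ultimately show ?thesis
    by (metis finite_imageD finite_subset inj_on_of_nat)
qed

end
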